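(* Let $\mathbb F$ be a finite field and let $\mathcal C$ be a class of matroids represented over $\mathbb F$, all given under the null representation or all given under the independence representation. Then $\mathcal C$ has bounded MSO width if and only if $\mathcal C$ has bounded branchwidth.
   Context: A matroid represented over $\mathbb F$ is a finite nonempty set of elements with a map to a vector space over $\mathbb F$. Independence representation: universe = elements, one set relation $\mathrm{independent}(X)$ (vectors of $X$ linearly independent; duplicates make a set dependent). Null representation: universe = elements, one relation on $n=|\mathbb F|-1$ sets $X_1,\dots,X_n$ holding iff the sum over $i$ of the sums of vectors representing $X_i$ is $0$. The rank of a set of elements is the dimension of the span of their vectors; the connectivity of a partition $X_1\cup X_2$ of the elements is $\mathrm{rank}(X_1)+\mathrm{rank}(X_2)-\mathrm{rank}(X_1\cup X_2)$. A branch decomposition is a binary tree whose leaves are labelled bijectively by the matroid elements; each edge of the tree induces the partition of elements into those labelling leaves below it and the rest; its width is the maximal connectivity of such partitions; the branchwidth of a matroid is the minimal width of its branch decompositions; a class has bounded branchwidth if there is a uniform bound. MSO means monadic second-order logic with modulo-counting predicates; an MSO transduction is a binary relation between structures (closed under isomorphism) obtained by composing finitely many MSO interpretations, filterings by MSO sentences, $k$-copyings and $k$-colourings. "Trees" are finite rooted unranked unordered unlabelled trees (universe = nodes, parent relation). A class $\mathcal C$ of structures has bounded MSO width if it is contained in the set of outputs of some MSO transduction whose inputs are trees.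
   Formalization: In the null representation the sum of the vectors of the i-th set is multiplied by the i-th nonzero scalar; with unweighted sums the claim fails over non-prime fields such as the field with four elements, and over prime fields the two relations are MSO-interdefinable. *)

theory Defs
  imports Complex_Main "HOL-Library.Cardinality"
begin

section \<open>Structures\<close>

text \<open>
  A vocabulary has finitely many relation names of two kinds: relations on elements and relations
  on sets of elements. Relations of each kind are named by their positions in the list of arities.
\<close>

record vocabulary =
  elem_arities :: "nat list"
  set_arities :: "nat list"

record 'a struct =
  universe :: "'a set"
  elem_rel :: "nat \<Rightarrow> 'a list \<Rightarrow> bool"
  set_rel :: "nat \<Rightarrow> 'a set list \<Rightarrow> bool"

text \<open>
  The empty universe is not excluded, since an interpretation or a copying can produce or receive
  it as an intermediate result. It has no influence on bounded MSO width of nonempty structures: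
  every operation below maps an empty structure only to empty structures.
\<close>

definition struct_over :: "vocabulary \<Rightarrow> 'a struct \<Rightarrow> bool" where
  "struct_over V A \<longleftrightarrow>
     finite (universe A) \<and>
     (\<forall>R xs. elem_rel A R xs \<longrightarrow>
        R < length (elem_arities V) \<and> length xs = elem_arities V ! R \<and> set xs \<subseteq> universe A) \<and>
     (\<forall>R Xs. set_rel A R Xs \<longrightarrow>
        R < length (set_arities V) \<and> length Xs = set_arities V ! R \<and> (\<forall>X\<in>set Xs. X \<subseteq> universe A))"

definition isomorphism :: "('a \<Rightarrow> 'b) \<Rightarrow> 'a struct \<Rightarrow> 'b struct \<Rightarrow> bool" where
  "isomorphism f A B \<longleftrightarrow>
     bij_betw f (universe A) (universe B) \<and>
     (\<forall>R xs. set xs \<subseteq> universe A \<longrightarrow> (elem_rel A R xs \<longleftrightarrow> elem_rel B R (map f xs))) \<and>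
     (\<forall>R Xs. (\<forall>X\<in>set Xs. X \<subseteq> universe A) \<longrightarrow>
        (set_rel A R Xs \<longleftrightarrow> set_rel B R (map ((`) f) Xs)))"

definition isomorphic :: "'a struct \<Rightarrow> 'b struct \<Rightarrow> bool" where
  "isomorphic A B \<longleftrightarrow> (\<exists>f. isomorphism f A B)"

section \<open>Monadic second-order logic with modulo counting\<close>

text \<open>Element variables and set variables are two separate families, each indexed by \<open>nat\<close>.\<close>

datatype mso =
    Eq nat nat
  | Mem nat nat                \<comment> \<open>element variable, set variable\<close>
  | Elem_Rel nat "nat list"    \<comment> \<open>relation name, element variables\<close>
  | Set_Rel nat "nat list"     \<comment> \<open>relation name, set variables\<close>
  | Card_Mod nat nat nat       \<comment> \<open>\<open>Card_Mod X r m\<close>: the size of \<open>X\<close> is congruent to \<open>r\<close> modulo \<open>m\<close>\<close>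
  | Neg mso
  | Conj mso mso
  | Ex_Elem nat mso
  | Ex_Set nat mso

fun sat :: "'a struct \<Rightarrow> (nat \<Rightarrow> 'a) \<Rightarrow> (nat \<Rightarrow> 'a set) \<Rightarrow> mso \<Rightarrow> bool" where
  "sat A e s (Eq x y) \<longleftrightarrow> e x = e y"
| "sat A e s (Mem x X) \<longleftrightarrow> e x \<in> s X"
| "sat A e s (Elem_Rel R xs) \<longleftrightarrow> elem_rel A R (map e xs)"
| "sat A e s (Set_Rel R Xs) \<longleftrightarrow> set_rel A R (map s Xs)"
| "sat A e s (Card_Mod X r m) \<longleftrightarrow> card (s X) mod m = r mod m"
| "sat A e s (Neg \<phi>) \<longleftrightarrow> \<not> sat A e s \<phi>"
| "sat A e s (Conj \<phi> \<psi>) \<longleftrightarrow> sat A e s \<phi> \<and> sat A e s \<psi>"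
| "sat A e s (Ex_Elem x \<phi>) \<longleftrightarrow> (\<exists>a\<in>universe A. sat A (e(x := a)) s \<phi>)"
| "sat A e s (Ex_Set X \<phi>) \<longleftrightarrow> (\<exists>U\<subseteq>universe A. sat A e (s(X := U)) \<phi>)"

fun free_elem :: "mso \<Rightarrow> nat set" where
  "free_elem (Eq x y) = {x, y}"
| "free_elem (Mem x X) = {x}"
| "free_elem (Elem_Rel R xs) = set xs"
| "free_elem (Set_Rel R Xs) = {}"
| "free_elem (Card_Mod X r m) = {}"
| "free_elem (Neg \<phi>) = free_elem \<phi>"
| "free_elem (Conj \<phi> \<psi>) = free_elem \<phi> \<union> free_elem \<psi>"
| "free_elem (Ex_Elem x \<phi>) = free_elem \<phi> - {x}"
| "free_elem (Ex_Set X \<phi>) = free_elem \<phi>"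

fun free_set :: "mso \<Rightarrow> nat set" where
  "free_set (Eq x y) = {}"
| "free_set (Mem x X) = {X}"
| "free_set (Elem_Rel R xs) = {}"
| "free_set (Set_Rel R Xs) = set Xs"
| "free_set (Card_Mod X r m) = {X}"
| "free_set (Neg \<phi>) = free_set \<phi>"
| "free_set (Conj \<phi> \<psi>) = free_set \<phi> \<union> free_set \<psi>"
| "free_set (Ex_Elem x \<phi>) = free_set \<phi>"
| "free_set (Ex_Set X \<phi>) = free_set \<phi> - {X}"

fun formula_over :: "vocabulary \<Rightarrow> mso \<Rightarrow> bool" where
  "formula_over V (Eq x y) \<longleftrightarrow> True"
| "formula_over V (Mem x X) \<longleftrightarrow> True"
| "formula_over V (Elem_Rel R xs) \<longleftrightarrow>
     R < length (elem_arities V) \<and> length xs = elem_arities V ! R"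
| "formula_over V (Set_Rel R Xs) \<longleftrightarrow>
     R < length (set_arities V) \<and> length Xs = set_arities V ! R"
| "formula_over V (Card_Mod X r m) \<longleftrightarrow> m > 0"
| "formula_over V (Neg \<phi>) \<longleftrightarrow> formula_over V \<phi>"
| "formula_over V (Conj \<phi> \<psi>) \<longleftrightarrow> formula_over V \<phi> \<and> formula_over V \<psi>"
| "formula_over V (Ex_Elem x \<phi>) \<longleftrightarrow> formula_over V \<phi>"
| "formula_over V (Ex_Set X \<phi>) \<longleftrightarrow> formula_over V \<phi>"

definition sentence_over :: "vocabulary \<Rightarrow> mso \<Rightarrow> bool" where
  "sentence_over V \<phi> \<longleftrightarrow> formula_over V \<phi> \<and> free_elem \<phi> = {} \<and> free_set \<phi> = {}"

definition models :: "'a struct \<Rightarrow> mso \<Rightarrow> bool" where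
  "models A \<phi> \<longleftrightarrow> sat A (\<lambda>_. undefined) (\<lambda>_. {}) \<phi>"

section \<open>MSO transductions\<close>

subsection \<open>Interpretations\<close>

text \<open>
  An interpretation selects the new universe by a formula with one free element variable \<open>0\<close>, and
  defines each relation of arity \<open>n\<close> of the output vocabulary by a formula of the input vocabulary
  whose free variables are the element (respectively set) variables \<open>0, \<dots>, n - 1\<close>.
\<close>

record mso_interpretation =
  universe_formula :: mso
  elem_formulas :: "mso list"
  set_formulas :: "mso list"

definition interpretation_from_to :: "vocabulary \<Rightarrow> vocabulary \<Rightarrow> mso_interpretation \<Rightarrow> bool" where
  "interpretation_from_to V W I \<longleftrightarrow>
     formula_over V (universe_formula I) \<and>
     free_elem (universe_formula I) \<subseteq> {0} \<and> free_set (universe_formula I) = {} \<and>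
     length (elem_formulas I) = length (elem_arities W) \<and>
     (\<forall>R < length (elem_arities W).
        formula_over V (elem_formulas I ! R) \<and>
        free_elem (elem_formulas I ! R) \<subseteq> {..<elem_arities W ! R} \<and>
        free_set (elem_formulas I ! R) = {}) \<and>
     length (set_formulas I) = length (set_arities W) \<and>
     (\<forall>R < length (set_arities W).
        formula_over V (set_formulas I ! R) \<and>
        free_elem (set_formulas I ! R) = {} \<and>
        free_set (set_formulas I ! R) \<subseteq> {..<set_arities W ! R})"

definition interpreted_universe :: "mso_interpretation \<Rightarrow> 'a struct \<Rightarrow> 'a set" where
  "interpreted_universe I A =
     {a \<in> universe A. sat A (\<lambda>_. a) (\<lambda>_. {}) (universe_formula I)}"

definition interpreted_struct :: "vocabulary \<Rightarrow> mso_interpretation \<Rightarrow> 'a struct \<Rightarrow> 'a struct" where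
  "interpreted_struct W I A =
     \<lparr>universe = interpreted_universe I A,
      elem_rel = (\<lambda>R xs.
        R < length (elem_arities W) \<and> length xs = elem_arities W ! R \<and>
        set xs \<subseteq> interpreted_universe I A \<and>
        sat A (\<lambda>i. xs ! i) (\<lambda>_. {}) (elem_formulas I ! R)),
      set_rel = (\<lambda>R Xs.
        R < length (set_arities W) \<and> length Xs = set_arities W ! R \<and>
        (\<forall>X\<in>set Xs. X \<subseteq> interpreted_universe I A) \<and>
        sat A (\<lambda>_. undefined) (\<lambda>i. Xs ! i) (set_formulas I ! R))\<rparr>"

subsection \<open>Copying\<close>

text \<open>
  The output of \<open>k\<close>-copying is the disjoint union of \<open>k\<close> copies of the input, with one additional
  \<open>k\<close>-ary element relation which lists, in order, the \<open>k\<close> copies of each element of the input.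
  A tuple of sets in a relation has all its sets in the same copy.
\<close>

definition copy_vocabulary :: "nat \<Rightarrow> vocabulary \<Rightarrow> vocabulary" where
  "copy_vocabulary k V =
     \<lparr>elem_arities = elem_arities V @ [k], set_arities = set_arities V\<rparr>"

definition copy_struct :: "vocabulary \<Rightarrow> nat \<Rightarrow> 'a struct \<Rightarrow> (nat \<times> 'a) struct" where
  "copy_struct V k A =
     \<lparr>universe = {..<k} \<times> universe A,
      elem_rel = (\<lambda>R xs.
        (R < length (elem_arities V) \<and> (\<exists>i<k. \<exists>ys. xs = map (Pair i) ys \<and> elem_rel A R ys)) \<or>
        (R = length (elem_arities V) \<and> (\<exists>a\<in>universe A. xs = map (\<lambda>i. (i, a)) [0..<k]))),
      set_rel = (\<lambda>R Xs. \<exists>i<k. \<exists>Ys. Xs = map ((`) (Pair i)) Ys \<and> set_rel A R Ys)\<rparr>"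

subsection \<open>Colouring\<close>

text \<open>A \<open>k\<close>-colouring adds \<open>k\<close> unary element relations which partition the universe.\<close>

definition colour_vocabulary :: "nat \<Rightarrow> vocabulary \<Rightarrow> vocabulary" where
  "colour_vocabulary k V =
     \<lparr>elem_arities = elem_arities V @ replicate k 1, set_arities = set_arities V\<rparr>"

definition colour_struct :: "vocabulary \<Rightarrow> nat \<Rightarrow> ('a \<Rightarrow> nat) \<Rightarrow> 'a struct \<Rightarrow> 'a struct" where
  "colour_struct V k c A =
     \<lparr>universe = universe A,
      elem_rel = (\<lambda>R xs.
        (R < length (elem_arities V) \<and> elem_rel A R xs) \<or>
        (\<exists>i<k. R = length (elem_arities V) + i \<and> (\<exists>a\<in>universe A. c a = i \<and> xs = [a]))),
      set_rel = set_rel A\<rparr>"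

subsection \<open>Transductions\<close>

text \<open>
  Every finite structure has an isomorphic copy with universe in \<open>nat\<close>, so a relation between
  structures that is closed under isomorphism is determined by its restriction to such structures.
\<close>

inductive mso_transduction ::
    "vocabulary \<Rightarrow> vocabulary \<Rightarrow> (nat struct \<Rightarrow> nat struct \<Rightarrow> bool) \<Rightarrow> bool" where
  interpreting:
    "interpretation_from_to V W I \<Longrightarrow>
     mso_transduction V W
       (\<lambda>A B. struct_over V A \<and> struct_over W B \<and> isomorphic (interpreted_struct W I A) B)"
| filtering:
    "sentence_over V \<phi> \<Longrightarrow>
     mso_transduction V V
       (\<lambda>A B. struct_over V A \<and> struct_over V B \<and> models A \<phi> \<and> isomorphic A B)"
| copying:
    "k > 0 \<Longrightarrow>
     mso_transduction V (copy_vocabulary k V)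
       (\<lambda>A B. struct_over V A \<and> struct_over (copy_vocabulary k V) B \<and>
          isomorphic (copy_struct V k A) B)"
| colouring:
    "k > 0 \<Longrightarrow>
     mso_transduction V (colour_vocabulary k V)
       (\<lambda>A B. struct_over V A \<and> struct_over (colour_vocabulary k V) B \<and>
          (\<exists>c. c ` universe A \<subseteq> {..<k} \<and> isomorphic (colour_struct V k c A) B))"
| composition:
    "mso_transduction U V S \<Longrightarrow> mso_transduction V W T \<Longrightarrow> mso_transduction U W (S OO T)"

section \<open>Bounded MSO width\<close>

definition tree_vocabulary :: vocabulary where
  "tree_vocabulary = \<lparr>elem_arities = [2], set_arities = []\<rparr>"

text \<open>\<open>elem_rel A 0 [x, y]\<close> says that \<open>x\<close> is the parent of \<open>y\<close>.\<close>

definition is_tree :: "'a struct \<Rightarrow> bool" where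
  "is_tree A \<longleftrightarrow>
     struct_over tree_vocabulary A \<and>
     (\<exists>r\<in>universe A.
        (\<forall>x. \<not> elem_rel A 0 [x, r]) \<and>
        (\<forall>y\<in>universe A. y \<noteq> r \<longrightarrow> (\<exists>!x. elem_rel A 0 [x, y])) \<and>
        (\<forall>y\<in>universe A. (r, y) \<in> {(u, v). elem_rel A 0 [u, v]}\<^sup>*))"

definition bounded_mso_width :: "vocabulary \<Rightarrow> 'a struct set \<Rightarrow> bool" where
  "bounded_mso_width W \<C> \<longleftrightarrow>
     (\<exists>T. mso_transduction tree_vocabulary W T \<and>
          (\<forall>A\<in>\<C>. \<exists>t B. is_tree t \<and> T t B \<and> isomorphic A B))"

section \<open>Represented matroids\<close>

text \<open>
  The vector space is the whole type \<open>'v\<close>, with scalar multiplication \<open>scale\<close> passed separately; it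
  may be infinite-dimensional. Matroids represented in different vector spaces can be placed in a
  common one, the direct sum of these spaces, without affecting linear dependence.
\<close>

record ('e, 'v) rep_matroid =
  elements :: "'e set"
  vec :: "'e \<Rightarrow> 'v"

definition rep_matroid :: "('e, 'v) rep_matroid \<Rightarrow> bool" where
  "rep_matroid M \<longleftrightarrow> finite (elements M) \<and> elements M \<noteq> {}"

definition independent_vocabulary :: vocabulary where
  "independent_vocabulary = \<lparr>elem_arities = [], set_arities = [1]\<rparr>"

definition independent_struct ::
    "('f::field \<Rightarrow> 'v::ab_group_add \<Rightarrow> 'v) \<Rightarrow> ('e, 'v) rep_matroid \<Rightarrow> 'e struct" where
  "independent_struct scale M =
     \<lparr>universe = elements M,
      elem_rel = (\<lambda>_ _. False),
      set_rel = (\<lambda>R Xs. R = 0 \<and> (\<exists>X\<subseteq>elements M. Xs = [X] \<and>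
        inj_on (vec M) X \<and> \<not> module.dependent scale (vec M ` X)))\<rparr>"

text \<open>
  In the null representation the \<open>n\<close> arguments of the relation stand for the \<open>n\<close> nonzero scalars:
  the sum of the vectors in the \<open>i\<close>-th set is multiplied by the \<open>i\<close>-th nonzero scalar, where \<open>cs\<close>
  lists the nonzero scalars. Over a prime field the coefficients make no difference to MSO
  definability. Over other fields they cannot be left out: without them, the relation
  only depends on the linear structure over the prime subfield. For example, over the field with
  four elements, \<open>w\<close> a generator, \<open>b\<close> a basis and \<open>U\<close> an invertible matrix over the two-element
  field, the vectors \<open>b\<^sub>j\<close> together with \<open>w (U b)\<^sub>j\<close> are independent over the two-element field,
  so the relation without coefficients would carry no information except the number of elements,
  although such matroids have unbounded branchwidth.
\<close>

definition null_vocabulary :: "nat \<Rightarrow> vocabulary" where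
  "null_vocabulary n = \<lparr>elem_arities = [], set_arities = [n]\<rparr>"

definition null_struct ::
    "('f::field \<Rightarrow> 'v::ab_group_add \<Rightarrow> 'v) \<Rightarrow> 'f list \<Rightarrow> ('e, 'v) rep_matroid \<Rightarrow> 'e struct" where
  "null_struct scale cs M =
     \<lparr>universe = elements M,
      elem_rel = (\<lambda>_ _. False),
      set_rel = (\<lambda>R Xs. R = 0 \<and> length Xs = length cs \<and> (\<forall>X\<in>set Xs. X \<subseteq> elements M) \<and>
        (\<Sum>i<length cs. scale (cs ! i) (\<Sum>x\<in>Xs ! i. vec M x)) = 0)\<rparr>"

section \<open>Branchwidth\<close>

definition rank ::
    "('f::field \<Rightarrow> 'v::ab_group_add \<Rightarrow> 'v) \<Rightarrow> ('e, 'v) rep_matroid \<Rightarrow> 'e set \<Rightarrow> nat" where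
  "rank scale M X = vector_space.dim scale (module.span scale (vec M ` X))"

text \<open>The subtraction is never truncated, because the rank is subadditive.\<close>

definition connectivity ::
    "('f::field \<Rightarrow> 'v::ab_group_add \<Rightarrow> 'v) \<Rightarrow> ('e, 'v) rep_matroid \<Rightarrow> 'e set \<Rightarrow> 'e set \<Rightarrow> nat" where
  "connectivity scale M X Y = rank scale M X + rank scale M Y - rank scale M (X \<union> Y)"

datatype 'e btree = Leaf 'e | Node "'e btree" "'e btree"

fun leaves :: "'e btree \<Rightarrow> 'e list" where
  "leaves (Leaf x) = [x]"
| "leaves (Node l r) = leaves l @ leaves r"

text \<open>
  Each edge of the tree is identified with the subtree below it, that is, with a proper subtree;
  \<open>edge_sets\<close> collects the sets of labels of the leaves below the edges.
\<close>

fun edge_sets :: "'e btree \<Rightarrow> 'e set set" where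
  "edge_sets (Leaf x) = {}"
| "edge_sets (Node l r) = {set (leaves l), set (leaves r)} \<union> edge_sets l \<union> edge_sets r"

definition branch_decomposition :: "('e, 'v) rep_matroid \<Rightarrow> 'e btree \<Rightarrow> bool" where
  "branch_decomposition M t \<longleftrightarrow> distinct (leaves t) \<and> set (leaves t) = elements M"

text \<open>A tree that consists of a single leaf has no edges; its width is \<open>Sup {} = 0\<close>.\<close>

definition decomposition_width ::
    "('f::field \<Rightarrow> 'v::ab_group_add \<Rightarrow> 'v) \<Rightarrow> ('e, 'v) rep_matroid \<Rightarrow> 'e btree \<Rightarrow> nat" where
  "decomposition_width scale M t =
     (SUP X\<in>edge_sets t. connectivity scale M X (elements M - X))"

definition branchwidth ::
    "('f::field \<Rightarrow> 'v::ab_group_add \<Rightarrow> 'v) \<Rightarrow> ('e, 'v) rep_matroid \<Rightarrow> nat" where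
  "branchwidth scale M = (INF t\<in>{t. branch_decomposition M t}. decomposition_width scale M t)"

definition bounded_branchwidth ::
    "('f::field \<Rightarrow> 'v::ab_group_add \<Rightarrow> 'v) \<Rightarrow> ('e, 'v) rep_matroid set \<Rightarrow> bool" where
  "bounded_branchwidth scale \<C> \<longleftrightarrow> (\<exists>k. \<forall>M\<in>\<C>. branchwidth scale M \<le> k)"

end

(* The statement follows from the cycle: bounded branchwidth, bounded MSO width of the null
   representations, bounded MSO width of the independence representations, bounded branchwidth.

   A cut of a branch decomposition of width k meets in a space with at most q^k vectors. A tree whose
   nodes are coloured with the addition tables of these spaces therefore determines the null relation:
   a tuple of sets has sum zero iff the nodes can be labelled by partial sums consistently with the
   tables, and an MSO formula can guess such a labelling. Independence is MSO definable from the null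
   relation, because disjoint sets, one for each nonzero scalar, are a coefficient vector.

   For the last implication, no automata are needed: call the index of a relation across a cut the
   number of classes of tuples of subsets of one side, with respect to all completions on the other
   side. If the atomic relations have bounded index across a cut, then so has every MSO formula, since
   an existential quantifier at most exponentiates the index. Hence a binary tree over the universe
   all of whose cuts have bounded index survives every step of a transduction, and for the
   independence relation the index of a cut exceeds its connectivity. *)

theory Submission
  imports Defs "HOL-Library.FuncSet" "HOL-Library.Countable"
begin

section \<open>The index of a relation across a cut\<close>

text \<open>The classes are residuals in the sense of Myhill and Nerode, taken for the side of a cut
  that lies below an edge. Only sets can be split along a cut, so elements are treated as
  singletons, and relations and formulas alike become predicates on families of sets, indexed by
  argument positions or by variables; a quantifier then updates one member of the family. The bounds
  obtained depend on the transduction and never on the structure, which is what makes the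
  branchwidth uniformly bounded. A transduction starts from a tree of unbounded degree whose inner
  nodes belong to the universe, whereas a decomposition is binary and has all elements at its
  leaves. Its cuts are therefore single nodes and unions of subtrees of siblings; the latter are
  entered only by edges from one common node, and this gives the initial bound 36. In the other
  direction the tree is unordered, so a colour must also say whether a node is a left or a right
  child.\<close>

definition cut_class ::
  "'a set \<Rightarrow> 'a set \<Rightarrow> (('i \<Rightarrow> 'a set) \<Rightarrow> bool) \<Rightarrow> ('i \<Rightarrow> 'a set) \<Rightarrow> ('i \<Rightarrow> 'a set) set" where
  "cut_class U Y P \<sigma> = {\<tau>. (\<forall>i. \<tau> i \<subseteq> U - Y) \<and> P (\<lambda>i. \<sigma> i \<union> \<tau> i)}"

text \<open>Finiteness is a separate conjunct because \<open>card\<close> of an infinite set is 0;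
  with infinitely many indices the families are infinitely many even for a finite nonempty
  \<open>Y\<close>.\<close>

definition index_le :: "nat \<Rightarrow> 'a set \<Rightarrow> 'a set \<Rightarrow> (('i \<Rightarrow> 'a set) \<Rightarrow> bool) \<Rightarrow> bool" where
  "index_le N U Y P \<longleftrightarrow>
     finite (cut_class U Y P ` {\<sigma>. \<forall>i. \<sigma> i \<subseteq> Y}) \<and> card (cut_class U Y P ` {\<sigma>. \<forall>i. \<sigma> i \<subseteq> Y}) \<le> N"

text \<open>An invariant \<open>G\<close> with values in \<open>S\<close> that determines the class
  bounds the number of classes, since a class is recovered from any representative with its value of
  \<open>G\<close>. One implication suffices because \<open>\<sigma>\<close> and
  \<open>\<sigma>'\<close> may be exchanged.\<close>

lemma index_leI:
  assumes "finite S" "card S \<le> N"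
    and G: "\<And>\<sigma>. \<forall>i. \<sigma> i \<subseteq> Y \<Longrightarrow> G \<sigma> \<in> S"
    and imp: "\<And>\<sigma> \<sigma>' \<tau>. \<lbrakk>\<forall>i. \<sigma> i \<subseteq> Y; \<forall>i. \<sigma>' i \<subseteq> Y; G \<sigma> = G \<sigma>'; \<forall>i. \<tau> i \<subseteq> U - Y;
      P (\<lambda>i. \<sigma> i \<union> \<tau> i)\<rbrakk> \<Longrightarrow> P (\<lambda>i. \<sigma>' i \<union> \<tau> i)"
  shows "index_le N U Y P"
proof -
  let ?L = "{\<sigma>. \<forall>i. \<sigma> i \<subseteq> Y}"
  have eq: "cut_class U Y P \<sigma> = cut_class U Y P (inv_into ?L G (G \<sigma>))" if "\<sigma> \<in> ?L" for \<sigma>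
  proof -
    have 1: "inv_into ?L G (G \<sigma>) \<in> ?L" using that by (intro inv_into_into) blast
    have 2: "G (inv_into ?L G (G \<sigma>)) = G \<sigma>" using that f_inv_into_f[of "G \<sigma>" G ?L] by blast
    show ?thesis unfolding cut_class_def
      using imp[of \<sigma> "inv_into ?L G (G \<sigma>)"] imp[of "inv_into ?L G (G \<sigma>)" \<sigma>] that 1 2 by auto
  qed
  have sub: "cut_class U Y P ` ?L \<subseteq> (\<lambda>g. cut_class U Y P (inv_into ?L G g)) ` S"
    using eq G by blast
  have "card (cut_class U Y P ` ?L) \<le> card S"
    using card_mono[OF _ sub] card_image_le[OF assms(1)] assms(1) le_trans by blast
  moreover have "finite (cut_class U Y P ` ?L)"
    by (rule finite_subset[OF sub]) (simp add: assms(1))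
  ultimately show ?thesis
    unfolding index_le_def using assms(2) by simp
qed

lemma index_leD:
  assumes "cut_class U Y P \<sigma> = cut_class U Y P \<sigma>'" "\<forall>i. \<tau> i \<subseteq> U - Y" "P (\<lambda>i. \<sigma> i \<union> \<tau> i)"
  shows "P (\<lambda>i. \<sigma>' i \<union> \<tau> i)"
  using assms unfolding cut_class_def by blast

lemma index_le_mono: "index_le N U Y P \<Longrightarrow> N \<le> N' \<Longrightarrow> index_le N' U Y P"
  unfolding index_le_def by simp

text \<open>A substitution \<open>r\<close> that commutes with unions and respects both sides of the
  cut cannot create classes. Renaming of variables, isomorphisms, restriction to a smaller universe
  and slices of copies are instances.\<close>

lemma index_le_comp:
  fixes r :: "('i \<Rightarrow> 'a set) \<Rightarrow> ('j \<Rightarrow> 'b set)"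
  assumes P: "index_le N U' Y' P"
    and un: "\<And>\<sigma> \<tau>. r (\<lambda>i. \<sigma> i \<union> \<tau> i) = (\<lambda>j. r \<sigma> j \<union> r \<tau> j)"
    and inn: "\<And>\<sigma> j. \<forall>i. \<sigma> i \<subseteq> Y \<Longrightarrow> r \<sigma> j \<subseteq> Y'"
    and out: "\<And>\<tau> j. \<forall>i. \<tau> i \<subseteq> U - Y \<Longrightarrow> r \<tau> j \<subseteq> U' - Y'"
    and YU: "Y \<subseteq> U"
    and Q: "\<And>\<sigma>. \<forall>i. \<sigma> i \<subseteq> U \<Longrightarrow> Q \<sigma> \<longleftrightarrow> P (r \<sigma>)"
  shows "index_le N U Y Q"
proof (rule index_leI[where G = "\<lambda>\<sigma>. cut_class U' Y' P (r \<sigma>)"])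
  show "finite (cut_class U' Y' P ` {\<sigma>. \<forall>i. \<sigma> i \<subseteq> Y'})"
    "card (cut_class U' Y' P ` {\<sigma>. \<forall>i. \<sigma> i \<subseteq> Y'}) \<le> N"
    using P unfolding index_le_def by auto
next
  fix \<sigma> \<sigma>' \<tau> :: "'i \<Rightarrow> 'a set"
  assume *: "\<forall>i. \<sigma> i \<subseteq> Y" "\<forall>i. \<sigma>' i \<subseteq> Y" "cut_class U' Y' P (r \<sigma>) = cut_class U' Y' P (r \<sigma>')"
    "\<forall>i. \<tau> i \<subseteq> U - Y" "Q (\<lambda>i. \<sigma> i \<union> \<tau> i)"
  have a: "\<forall>i. \<sigma> i \<union> \<tau> i \<subseteq> U" "\<forall>i. \<sigma>' i \<union> \<tau> i \<subseteq> U" using * YU by blast+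
  have "P (\<lambda>j. r \<sigma> j \<union> r \<tau> j)" using Q[OF a(1)] * un by simp
  then have "P (\<lambda>j. r \<sigma>' j \<union> r \<tau> j)" using index_leD[OF *(3)] out[OF *(4)] by blast
  then show "Q (\<lambda>i. \<sigma>' i \<union> \<tau> i)" using Q[OF a(2)] un by simp
qed (use inn in blast)

lemma index_le_cong:
  assumes "index_le N U Y P" "Y \<subseteq> U" "\<And>\<sigma>. \<forall>i. \<sigma> i \<subseteq> U \<Longrightarrow> Q \<sigma> \<longleftrightarrow> P \<sigma>"
  shows "index_le N U Y Q"
  by (rule index_le_comp[where r = "\<lambda>\<sigma>. \<sigma>", OF assms(1)]) (use assms(2,3) in auto)

section \<open>Connectives and set quantifiers\<close>

lemma index_le_neg:
  assumes "index_le N U Y P"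
  shows "index_le N U Y (\<lambda>\<sigma>. \<not> P \<sigma>)"
proof (rule index_leI[where G = "cut_class U Y P"])
  show "finite (cut_class U Y P ` {\<sigma>. \<forall>i. \<sigma> i \<subseteq> Y})" "card (cut_class U Y P ` {\<sigma>. \<forall>i. \<sigma> i \<subseteq> Y}) \<le> N"
    using assms unfolding index_le_def by auto
next
  fix \<sigma> \<sigma>' \<tau>
  assume "cut_class U Y P \<sigma> = cut_class U Y P \<sigma>'" "\<forall>i. \<tau> i \<subseteq> U - Y" "\<not> P (\<lambda>i. \<sigma> i \<union> \<tau> i)"
  then show "\<not> P (\<lambda>i. \<sigma>' i \<union> \<tau> i)" using index_leD[of U Y P \<sigma>' \<sigma> \<tau>] by metis
qed auto

lemma index_le_conj:
  assumes "index_le N U Y P" "index_le M U Y Q"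
  shows "index_le (N * M) U Y (\<lambda>\<sigma>. P \<sigma> \<and> Q \<sigma>)"
proof (rule index_leI[where G = "\<lambda>\<sigma>. (cut_class U Y P \<sigma>, cut_class U Y Q \<sigma>)"])
  let ?L = "{\<sigma>. \<forall>i. \<sigma> i \<subseteq> Y}"
  show "finite (cut_class U Y P ` ?L \<times> cut_class U Y Q ` ?L)"
    "card (cut_class U Y P ` ?L \<times> cut_class U Y Q ` ?L) \<le> N * M"
    using assms unfolding index_le_def by (auto simp: card_cartesian_product mult_le_mono)
next
  fix \<sigma> \<sigma>' \<tau>
  assume "(cut_class U Y P \<sigma>, cut_class U Y Q \<sigma>) = (cut_class U Y P \<sigma>', cut_class U Y Q \<sigma>')"
    "\<forall>i. \<tau> i \<subseteq> U - Y" "P (\<lambda>i. \<sigma> i \<union> \<tau> i) \<and> Q (\<lambda>i. \<sigma> i \<union> \<tau> i)"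
  then show "P (\<lambda>i. \<sigma>' i \<union> \<tau> i) \<and> Q (\<lambda>i. \<sigma>' i \<union> \<tau> i)"
    using index_leD[of U Y P \<sigma> \<sigma>'] index_leD[of U Y Q \<sigma> \<sigma>'] by blast
qed auto

lemma index_le_const: "index_le 1 U Y (\<lambda>_. b)"
  by (rule index_leI[where G = "\<lambda>_. ()" and S = "{()}"]) auto

lemma index_le_all:
  assumes "\<And>i. i < (k::nat) \<Longrightarrow> index_le N U Y (P i)"
  shows "index_le (N ^ k) U Y (\<lambda>\<sigma>. \<forall>i<k. P i \<sigma>)"
  using assms
proof (induction k)
  case 0
  then show ?case using index_le_const[of U Y True] by simp
next
  case (Suc k)
  have "index_le (N ^ k * N) U Y (\<lambda>\<sigma>. (\<forall>i<k. P i \<sigma>) \<and> P k \<sigma>)"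
    using Suc by (intro index_le_conj) auto
  then show ?case by (simp only: All_less_Suc power_Suc2 conj_commute)
qed

lemma index_le_bex:
  assumes "\<And>i. i < (k::nat) \<Longrightarrow> index_le N U Y (P i)"
  shows "index_le (N ^ k) U Y (\<lambda>\<sigma>. \<exists>i<k. P i \<sigma>)"
  using index_le_neg[OF index_le_all[of k N U Y "\<lambda>i \<sigma>. \<not> P i \<sigma>"]] index_le_neg[OF assms] by simp

text \<open>A class of \<open>\<exists>Z. P\<close> is determined by the set of classes of \<open>P\<close> that the part of \<open>Z\<close>
  inside \<open>Y\<close> can produce; this is the powerset construction for automata.\<close>

lemma index_le_ex_set:
  assumes P: "index_le N U Y P" and YU: "Y \<subseteq> U"
  shows "index_le (2 ^ N) U Y (\<lambda>\<sigma>. \<exists>Z\<subseteq>U. P (\<sigma>(i := Z)))"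
proof (rule index_leI[where G = "\<lambda>\<sigma>. (\<lambda>Z. cut_class U Y P (\<sigma>(i := Z))) ` Pow Y"])
  let ?L = "{\<sigma>. \<forall>i. \<sigma> i \<subseteq> Y}"
  have f: "finite (cut_class U Y P ` ?L)" "card (cut_class U Y P ` ?L) \<le> N"
    using P unfolding index_le_def by auto
  show "finite (Pow (cut_class U Y P ` ?L))" using f by simp
  show "card (Pow (cut_class U Y P ` ?L)) \<le> 2 ^ N" using f by (simp add: card_Pow)
  show "(\<lambda>Z. cut_class U Y P (\<sigma>(i := Z))) ` Pow Y \<in> Pow (cut_class U Y P ` ?L)"
    if "\<forall>i. \<sigma> i \<subseteq> Y" for \<sigma>
    using that by auto
next
  fix \<sigma> \<sigma>' \<tau>
  assume *: "(\<lambda>Z. cut_class U Y P (\<sigma>(i := Z))) ` Pow Y = (\<lambda>Z. cut_class U Y P (\<sigma>'(i := Z))) ` Pow Y"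
    "\<forall>i. \<tau> i \<subseteq> U - Y" "\<exists>Z\<subseteq>U. P ((\<lambda>i. \<sigma> i \<union> \<tau> i)(i := Z))"
  then obtain Z where Z: "Z \<subseteq> U" "P ((\<lambda>i. \<sigma> i \<union> \<tau> i)(i := Z))" by blast
  \<comment> \<open>The witness splits along the cut: its inner part is exchanged for one with the
    same class, its outer part is kept.\<close>
  have split: "(\<lambda>i. \<sigma> i \<union> \<tau> i)(i := Z) = (\<lambda>j. (\<sigma>(i := Z \<inter> Y)) j \<union> (\<tau>(i := Z - Y)) j)"
    by (auto simp: fun_eq_iff)
  have "cut_class U Y P (\<sigma>(i := Z \<inter> Y)) \<in> (\<lambda>Z. cut_class U Y P (\<sigma>'(i := Z))) ` Pow Y"
    unfolding *(1)[symmetric] by blast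
  then obtain Z' where Z': "Z' \<subseteq> Y" "cut_class U Y P (\<sigma>(i := Z \<inter> Y)) = cut_class U Y P (\<sigma>'(i := Z'))"
    by auto
  have "\<forall>j. (\<tau>(i := Z - Y)) j \<subseteq> U - Y" using *(2) Z(1) by auto
  then have "P (\<lambda>j. (\<sigma>'(i := Z')) j \<union> (\<tau>(i := Z - Y)) j)"
    using index_leD[OF Z'(2)] Z(2) split by metis
  also have "(\<lambda>j. (\<sigma>'(i := Z')) j \<union> (\<tau>(i := Z - Y)) j)
      = (\<lambda>i. \<sigma>' i \<union> \<tau> i)(i := Z' \<union> (Z - Y))"
    by (auto simp: fun_eq_iff)
  finally have "P ((\<lambda>i. \<sigma>' i \<union> \<tau> i)(i := Z' \<union> (Z - Y)))" .
  moreover have "Z' \<union> (Z - Y) \<subseteq> U" using Z' Z(1) YU by auto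
  ultimately show "\<exists>Z\<subseteq>U. P ((\<lambda>i. \<sigma>' i \<union> \<tau> i)(i := Z))" by blast
qed

section \<open>Atomic predicates\<close>

lemma index_le_meet: "index_le 2 U Y (\<lambda>\<sigma>. \<sigma> i \<inter> \<sigma> j \<noteq> {})"
proof (rule index_leI[where G = "\<lambda>\<sigma>. \<sigma> i \<inter> \<sigma> j \<noteq> {}" and S = UNIV])
  fix \<sigma> \<sigma>' \<tau>
  assume *: "\<forall>i. \<sigma> i \<subseteq> Y" "\<forall>i. \<sigma>' i \<subseteq> Y" "\<forall>i. \<tau> i \<subseteq> U - Y"
    "(\<sigma> i \<inter> \<sigma> j \<noteq> {}) = (\<sigma>' i \<inter> \<sigma>' j \<noteq> {})" "(\<sigma> i \<union> \<tau> i) \<inter> (\<sigma> j \<union> \<tau> j) \<noteq> {}"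
  \<comment> \<open>Inner and outer parts never meet, so the mixed intersections vanish and one bit
    about the inner parts decides.\<close>
  have "(\<sigma> i \<union> \<tau> i) \<inter> (\<sigma> j \<union> \<tau> j) = (\<sigma> i \<inter> \<sigma> j) \<union> (\<tau> i \<inter> \<tau> j)"
    using *(1)[rule_format, of i] *(1)[rule_format, of j] *(3)[rule_format, of i] *(3)[rule_format, of j]
    by blast
  then show "(\<sigma>' i \<union> \<tau> i) \<inter> (\<sigma>' j \<union> \<tau> j) \<noteq> {}" using * by blast
qed auto

lemma index_le_subset: "index_le 2 U Y (\<lambda>\<sigma>. \<sigma> i \<subseteq> C)"
  by (rule index_leI[where G = "\<lambda>\<sigma>. \<sigma> i \<subseteq> C" and S = UNIV]) auto

text \<open>The inner part is empty, a singleton or larger. As the two parts are disjoint, their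
  union is a singleton only if one of them is and the other is empty.\<close>

lemma index_le_singleton: "index_le 3 U Y (\<lambda>\<sigma>. is_singleton (\<sigma> i))"
proof (rule index_leI[where S = "{0, 1, 2}"
      and G = "\<lambda>\<sigma>. if \<sigma> i = {} then 0 else if is_singleton (\<sigma> i) then 1 else (2::nat)"])
  fix \<sigma> \<sigma>' \<tau>
  assume *: "\<forall>i. \<sigma> i \<subseteq> Y" "\<forall>i. \<sigma>' i \<subseteq> Y" "\<forall>i. \<tau> i \<subseteq> U - Y"
    "(if \<sigma> i = {} then 0 else if is_singleton (\<sigma> i) then 1 else (2::nat)) =
     (if \<sigma>' i = {} then 0 else if is_singleton (\<sigma>' i) then 1 else (2::nat))"
    "is_singleton (\<sigma> i \<union> \<tau> i)"
  obtain x where x: "\<sigma> i \<union> \<tau> i = {x}" using *(5) by (auto simp: is_singleton_def)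
  have disj: "\<sigma> i \<inter> \<tau> i = {}" using *(1,3) by fast
  from x consider "\<sigma> i = {}" "\<tau> i = {x}" | "\<sigma> i = {x}" "\<tau> i = {}"
    using disj by (auto simp: Un_singleton_iff)
  then show "is_singleton (\<sigma>' i \<union> \<tau> i)"
  proof cases
    case 1
    then have "\<sigma>' i = {}" using *(4) by (auto split: if_splits)
    then show ?thesis using 1 by simp
  next
    case 2
    then have "is_singleton (\<sigma>' i)" using *(4) by (auto split: if_splits)
    then show ?thesis using 2 by simp
  qed
qed auto

lemma index_le_card_mod:
  assumes "finite U" "Y \<subseteq> U" "m > 0"
  shows "index_le m U Y (\<lambda>\<sigma>. card (\<sigma> i) mod m = r mod m)"
proof (rule index_leI[where G = "\<lambda>\<sigma>. card (\<sigma> i) mod m" and S = "{..<m}"])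
  fix \<sigma> \<sigma>' \<tau>
  assume *: "\<forall>i. \<sigma> i \<subseteq> Y" "\<forall>i. \<sigma>' i \<subseteq> Y" "\<forall>i. \<tau> i \<subseteq> U - Y"
    "card (\<sigma> i) mod m = card (\<sigma>' i) mod m" "card (\<sigma> i \<union> \<tau> i) mod m = r mod m"
  have c: "card (f i \<union> \<tau> i) = card (f i) + card (\<tau> i)" if "\<forall>i. f i \<subseteq> Y" for f
    using that[rule_format, of i] *(3)[rule_format, of i] assms
    by (intro card_Un_disjoint) (auto intro: finite_subset)
  show "card (\<sigma>' i \<union> \<tau> i) mod m = r mod m"
    using *(4,5) c[OF *(1)] c[OF *(2)] by (metis mod_add_cong)
qed (use assms in auto)

text \<open>The inner parts of the \<open>n\<close> arguments determine the class, and each is one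
  of at most \<open>2 ^ k\<close> sets. This holds for every relation, and serves for cuts at single
  tree nodes and among the copies of one element.\<close>

lemma index_le_small:
  assumes "finite Y" "card Y \<le> k"
  shows "index_le (2 ^ (k * n)) U Y (\<lambda>\<sigma>. R (map \<sigma> [0..<n]))"
proof (rule index_leI[where G = "\<lambda>\<sigma>. map \<sigma> [0..<n]" and S = "{Xs. set Xs \<subseteq> Pow Y \<and> length Xs = n}"])
  show "finite {Xs. set Xs \<subseteq> Pow Y \<and> length Xs = n}"
    using assms by (intro finite_lists_length_eq) auto
  have "card {Xs. set Xs \<subseteq> Pow Y \<and> length Xs = n} = (2 ^ card Y) ^ n"
    using assms by (subst card_lists_length_eq) (auto simp: card_Pow)
  then show "card {Xs. set Xs \<subseteq> Pow Y \<and> length Xs = n} \<le> 2 ^ (k * n)"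
    using assms by (auto simp: power_mult[symmetric] intro!: power_increasing mult_right_mono)
next
  fix \<sigma> \<sigma>' \<tau> :: "nat \<Rightarrow> 'a set"
  assume "map \<sigma> [0..<n] = map \<sigma>' [0..<n]" and R: "R (map (\<lambda>i. \<sigma> i \<union> \<tau> i) [0..<n])"
  then have "map (\<lambda>i. \<sigma> i \<union> \<tau> i) [0..<n] = map (\<lambda>i. \<sigma>' i \<union> \<tau> i) [0..<n]" by simp
  then show "R (map (\<lambda>i. \<sigma>' i \<union> \<tau> i) [0..<n])" using R by (simp only:)
qed auto

section \<open>Formulas over structures with a cut of bounded index\<close>

text \<open>Gives element relations the form of set relations, so that a cut can split their
  arguments.\<close>

definition singleton_rel :: "'a struct \<Rightarrow> nat \<Rightarrow> 'a set list \<Rightarrow> bool" where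
  "singleton_rel A R Xs \<longleftrightarrow> (\<exists>xs. Xs = map (\<lambda>x. {x}) xs \<and> elem_rel A R xs)"

definition good_cut :: "nat \<Rightarrow> vocabulary \<Rightarrow> 'a struct \<Rightarrow> 'a set \<Rightarrow> bool" where
  "good_cut N V A Y \<longleftrightarrow> Y \<subseteq> universe A \<and>
     (\<forall>R<length (elem_arities V).
        index_le N (universe A) Y (\<lambda>\<sigma>. singleton_rel A R (map \<sigma> [0..<elem_arities V ! R]))) \<and>
     (\<forall>R<length (set_arities V).
        index_le N (universe A) Y (\<lambda>\<sigma>. set_rel A R (map \<sigma> [0..<set_arities V ! R])))"

text \<open>Element variables are interpreted by singletons, and only the atoms are read in such a way
  that they have bounded index also on other sets.\<close>

fun set_sat :: "'a struct \<Rightarrow> (nat + nat \<Rightarrow> 'a set) \<Rightarrow> mso \<Rightarrow> bool" where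
  "set_sat A \<sigma> (Eq x y) \<longleftrightarrow> \<sigma> (Inl x) \<inter> \<sigma> (Inl y) \<noteq> {}"
| "set_sat A \<sigma> (Mem x X) \<longleftrightarrow> \<sigma> (Inl x) \<inter> \<sigma> (Inr X) \<noteq> {}"
| "set_sat A \<sigma> (Elem_Rel R xs) \<longleftrightarrow> singleton_rel A R (map (\<lambda>x. \<sigma> (Inl x)) xs)"
| "set_sat A \<sigma> (Set_Rel R Xs) \<longleftrightarrow> set_rel A R (map (\<lambda>X. \<sigma> (Inr X)) Xs)"
| "set_sat A \<sigma> (Card_Mod X r m) \<longleftrightarrow> card (\<sigma> (Inr X)) mod m = r mod m"
| "set_sat A \<sigma> (Neg \<phi>) \<longleftrightarrow> \<not> set_sat A \<sigma> \<phi>"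
| "set_sat A \<sigma> (Conj \<phi> \<psi>) \<longleftrightarrow> set_sat A \<sigma> \<phi> \<and> set_sat A \<sigma> \<psi>"
| "set_sat A \<sigma> (Ex_Elem x \<phi>) \<longleftrightarrow>
     (\<exists>Z\<subseteq>universe A. is_singleton ((\<sigma>(Inl x := Z)) (Inl x)) \<and> set_sat A (\<sigma>(Inl x := Z)) \<phi>)"
| "set_sat A \<sigma> (Ex_Set X \<phi>) \<longleftrightarrow> (\<exists>Z\<subseteq>universe A. set_sat A (\<sigma>(Inr X := Z)) \<phi>)"

lemma map_singleton_eq_iff: "map (\<lambda>x. {x}) xs = map (\<lambda>x. {x}) ys \<longleftrightarrow> xs = ys"
  by (rule inj_map_eq_map) (simp add: inj_def)

text \<open>An element quantifier of \<open>set_sat\<close> demands a singleton, so the values of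
  element variables stay singletons, and on these the two readings of the atoms agree.\<close>

lemma sat_iff_set_sat: "sat A e s \<phi> \<longleftrightarrow> set_sat A (case_sum (\<lambda>x. {e x}) s) \<phi>"
proof (induction \<phi> arbitrary: e s)
  case (Elem_Rel R xs)
  have "map (\<lambda>x. {e x}) xs = map (\<lambda>x. {x}) ys \<longleftrightarrow> ys = map e xs" for ys
    using map_singleton_eq_iff[of "map e xs" ys] by (auto simp: o_def)
  then show ?case by (simp add: singleton_rel_def)
next
  case (Ex_Elem x \<phi>)
  have "(case_sum (\<lambda>x. {e x}) s)(Inl x := {a}) = case_sum (\<lambda>y. {(e(x := a)) y}) s" for a
    by (auto simp: fun_eq_iff split: sum.split)
  then have "(sat A (e(x := a)) s \<phi>) = set_sat A ((case_sum (\<lambda>x. {e x}) s)(Inl x := {a})) \<phi>" for a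
    using Ex_Elem.IH[of "e(x := a)" s] by (simp only:)
  then show ?case by (auto simp: is_singleton_def)
next
  case (Ex_Set X \<phi>)
  have "(case_sum (\<lambda>x. {e x}) s)(Inr X := Z) = case_sum (\<lambda>y. {e y}) (s(X := Z))" for Z
    by (auto simp: fun_eq_iff split: sum.split)
  then show ?case using Ex_Set.IH by simp
qed auto

lemma set_sat_cong:
  assumes "\<And>x. x \<in> free_elem \<phi> \<Longrightarrow> \<sigma> (Inl x) = \<sigma>' (Inl x)"
    and "\<And>X. X \<in> free_set \<phi> \<Longrightarrow> \<sigma> (Inr X) = \<sigma>' (Inr X)"
  shows "set_sat A \<sigma> \<phi> \<longleftrightarrow> set_sat A \<sigma>' \<phi>"
  using assms
proof (induction \<phi> arbitrary: \<sigma> \<sigma>')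
  case (Elem_Rel R xs)
  then have "map (\<lambda>x. \<sigma> (Inl x)) xs = map (\<lambda>x. \<sigma>' (Inl x)) xs" by simp
  then show ?case by (simp only: set_sat.simps)
next
  case (Set_Rel R Xs)
  then have "map (\<lambda>X. \<sigma> (Inr X)) Xs = map (\<lambda>X. \<sigma>' (Inr X)) Xs" by simp
  then show ?case by (simp only: set_sat.simps)
next
  case (Conj \<phi> \<psi>)
  have "set_sat A \<sigma> \<phi> = set_sat A \<sigma>' \<phi>" "set_sat A \<sigma> \<psi> = set_sat A \<sigma>' \<psi>"
    by (rule Conj.IH; simp add: Conj.prems)+
  then show ?case by simp
next
  case (Neg \<phi>)
  have "set_sat A \<sigma> \<phi> = set_sat A \<sigma>' \<phi>" by (rule Neg.IH; simp add: Neg.prems)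
  then show ?case by simp
next
  case (Ex_Elem x \<phi>)
  have "set_sat A (\<sigma>(Inl x := Z)) \<phi> = set_sat A (\<sigma>'(Inl x := Z)) \<phi>" for Z
    by (rule Ex_Elem.IH; simp add: Ex_Elem.prems)
  then show ?case by simp
next
  case (Ex_Set X \<phi>)
  have "set_sat A (\<sigma>(Inr X := Z)) \<phi> = set_sat A (\<sigma>'(Inr X := Z)) \<phi>" for Z
    by (rule Ex_Set.IH; simp add: Ex_Set.prems)
  then show ?case by simp
qed auto

text \<open>The factor 3 pays for the conjunct \<open>is_singleton\<close>; the power of two counts
  the sets of classes that a quantified set can reach.\<close>

fun index_bound :: "nat \<Rightarrow> mso \<Rightarrow> nat" where
  "index_bound N (Eq x y) = 2"
| "index_bound N (Mem x X) = 2"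
| "index_bound N (Elem_Rel R xs) = N"
| "index_bound N (Set_Rel R Xs) = N"
| "index_bound N (Card_Mod X r m) = m"
| "index_bound N (Neg \<phi>) = index_bound N \<phi>"
| "index_bound N (Conj \<phi> \<psi>) = index_bound N \<phi> * index_bound N \<psi>"
| "index_bound N (Ex_Elem x \<phi>) = 2 ^ (3 * index_bound N \<phi>)"
| "index_bound N (Ex_Set X \<phi>) = 2 ^ index_bound N \<phi>"

text \<open>Variables of an atom may be repeated or permuted: position \<open>j\<close> of the
  relation is fed with the variable at place \<open>j\<close> of the list, and positions from
  \<open>n\<close> on with the empty set.\<close>

lemma index_le_reindex:
  fixes P :: "'a set list \<Rightarrow> bool" and xs :: "nat list"
  assumes "index_le N U Y (\<lambda>\<sigma>. P (map \<sigma> [0..<n]))" "length xs = n" "Y \<subseteq> U"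
  shows "index_le N U Y (\<lambda>\<sigma>. P (map (\<lambda>x. \<sigma> (f x)) xs))"
proof (rule index_le_comp[where r = "\<lambda>\<sigma> j. if j < n then \<sigma> (f (xs ! j)) else {}", OF assms(1)])
  fix \<sigma> :: "'b \<Rightarrow> 'a set"
  have "map (\<lambda>j. if j < n then \<sigma> (f (xs ! j)) else {}) [0..<n] = map (\<lambda>x. \<sigma> (f x)) xs"
    using assms(2) by (intro nth_equalityI) auto
  then show "P (map (\<lambda>x. \<sigma> (f x)) xs) \<longleftrightarrow>
      P (map (\<lambda>j. if j < n then \<sigma> (f (xs ! j)) else {}) [0..<n])" by simp
qed (use assms(3) in \<open>auto simp: fun_eq_iff\<close>)

lemma index_le_formula:
  assumes "good_cut N V A Y" "finite (universe A)" "formula_over V \<phi>"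
  shows "index_le (index_bound N \<phi>) (universe A) Y (\<lambda>\<sigma>. set_sat A \<sigma> \<phi>)"
  using assms(3)
proof (induction \<phi>)
  case (Elem_Rel R xs)
  show ?case unfolding set_sat.simps index_bound.simps
    by (rule index_le_reindex[where n = "elem_arities V ! R"]) (use Elem_Rel assms in \<open>auto simp: good_cut_def\<close>)
next
  case (Set_Rel R xs)
  show ?case unfolding set_sat.simps index_bound.simps
    by (rule index_le_reindex[where n = "set_arities V ! R"]) (use Set_Rel assms in \<open>auto simp: good_cut_def\<close>)
next
  case (Card_Mod X r m)
  show ?case unfolding set_sat.simps index_bound.simps
    by (rule index_le_card_mod) (use Card_Mod assms in \<open>auto simp: good_cut_def\<close>)
next
  case (Ex_Elem x \<phi>)
  have "index_le (3 * index_bound N \<phi>) (universe A) Y (\<lambda>\<sigma>. is_singleton (\<sigma> (Inl x)) \<and> set_sat A \<sigma> \<phi>)"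
    using Ex_Elem by (intro index_le_conj index_le_singleton) auto
  from index_le_ex_set[OF this, of "Inl x"] show ?case using assms(1) by (simp add: good_cut_def)
next
  case (Ex_Set X \<phi>)
  show ?case unfolding set_sat.simps index_bound.simps
    by (rule index_le_ex_set) (use Ex_Set assms in \<open>auto simp: good_cut_def\<close>)
next
  case (Neg \<phi>)
  then show ?case by (simp add: index_le_neg)
next
  case (Conj \<phi> \<psi>)
  then show ?case by (simp add: index_le_conj)
qed (simp_all only: set_sat.simps index_bound.simps index_le_meet)

section \<open>Bounded index is preserved by transductions\<close>

text \<open>The empty universe is a case of its own because a \<open>btree\<close> has at least one
  leaf.\<close>

definition decomposable :: "nat \<Rightarrow> vocabulary \<Rightarrow> 'a struct \<Rightarrow> bool" where
  "decomposable N V A \<longleftrightarrow> universe A = {} \<or>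
     (\<exists>t. distinct (leaves t) \<and> set (leaves t) = universe A \<and> (\<forall>Y\<in>edge_sets t. good_cut N V A Y))"

lemma good_cut_mono:
  assumes "good_cut N V A Y" "N \<le> N'"
  shows "good_cut N' V A Y"
  using assms(1) unfolding good_cut_def by (simp add: index_le_mono[OF _ assms(2)])

lemma good_cut_small:
  assumes "Y \<subseteq> universe A" "finite Y" "card Y \<le> k"
    and "\<And>n. n \<in> set (elem_arities V) \<union> set (set_arities V) \<Longrightarrow> n \<le> m"
  shows "good_cut (2 ^ (k * m)) V A Y"
proof -
  have "index_le (2 ^ (k * m)) (universe A) Y (\<lambda>\<sigma>. R (map \<sigma> [0..<n]))" if "n \<le> m" for n and R :: "'a set list \<Rightarrow> bool"
    using index_le_mono[OF index_le_small[OF assms(2,3)]] that by (simp add: power_increasing)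
  then show ?thesis unfolding good_cut_def using assms(1,4) by simp
qed

subsection \<open>Isomorphisms\<close>

lemma leaves_map_btree: "leaves (map_btree f t) = map f (leaves t)"
  by (induction t) auto

lemma edge_sets_map_btree: "edge_sets (map_btree f t) = (`) f ` edge_sets t"
  by (induction t) (auto simp: leaves_map_btree image_Un)

lemma edge_sets_subset: "X \<in> edge_sets t \<Longrightarrow> X \<subseteq> set (leaves t)"
  by (induction t) auto

lemma isomorphismD:
  assumes "isomorphism f A B"
  shows "inj_on f (universe A)" "f ` universe A = universe B"
    "set xs \<subseteq> universe A \<Longrightarrow> elem_rel A R xs \<longleftrightarrow> elem_rel B R (map f xs)"
    "\<forall>X\<in>set Xs. X \<subseteq> universe A \<Longrightarrow> set_rel A R Xs \<longleftrightarrow> set_rel B R (map ((`) f) Xs)"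
  using assms unfolding isomorphism_def bij_betw_def by auto

lemma isomorphism_inv:
  assumes "isomorphism f A B"
  shows "isomorphism (inv_into (universe A) f) B A"
proof -
  let ?g = "inv_into (universe A) f"
  note D = isomorphismD[OF assms]
  have bij: "bij_betw ?g (universe B) (universe A)"
    using assms by (auto simp: isomorphism_def bij_betw_inv_into)
  have "elem_rel B R xs \<longleftrightarrow> elem_rel A R (map ?g xs)" if xs: "set xs \<subseteq> universe B" for R xs
  proof -
    have 1: "map f (map ?g xs) = xs" using xs f_inv_into_f[of _ f "universe A"] D(2)
      by (simp add: map_idI subset_iff)
    have "set (map ?g xs) \<subseteq> universe A" using xs bij by (auto simp: bij_betw_def)
    from D(3)[OF this, of R] show ?thesis unfolding 1 by simp
  qed
  moreover have "set_rel B R Xs \<longleftrightarrow> set_rel A R (map ((`) ?g) Xs)"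
    if Xs: "\<forall>X\<in>set Xs. X \<subseteq> universe B" for R Xs
  proof -
    have "f ` ?g ` X = X" if "X \<subseteq> universe B" for X
      using that D(2) by (simp add: image_inv_into_cancel)
    then have 1: "map ((`) f) (map ((`) ?g) Xs) = Xs" using Xs by (simp add: map_idI)
    have "\<forall>X\<in>set (map ((`) ?g) Xs). X \<subseteq> universe A" using Xs bij by (fastforce simp: bij_betw_def)
    from D(4)[OF this, of R] show ?thesis unfolding 1 by simp
  qed
  ultimately show ?thesis unfolding isomorphism_def using bij by blast
qed

lemma isomorphic_sym: "isomorphic A B \<Longrightarrow> isomorphic B A"
  unfolding isomorphic_def using isomorphism_inv by blast

lemma isomorphic_refl: "isomorphic A A"
  unfolding isomorphic_def isomorphism_def
  by (rule exI[of _ id]) auto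

text \<open>The backward direction rests on injectivity: a set whose image is a singleton is itself
  a singleton.\<close>

lemma singleton_rel_iso:
  assumes "isomorphism g B A" "\<forall>X\<in>set Xs. X \<subseteq> universe B"
  shows "singleton_rel B R Xs \<longleftrightarrow> singleton_rel A R (map ((`) g) Xs)"
proof
  assume "singleton_rel B R Xs"
  then obtain xs where xs: "Xs = map (\<lambda>x. {x}) xs" "elem_rel B R xs"
    unfolding singleton_rel_def by blast
  then have "elem_rel A R (map g xs)" using isomorphismD(3)[OF assms(1)] assms(2) by auto
  moreover have "map ((`) g) Xs = map (\<lambda>x. {x}) (map g xs)" using xs(1) by simp
  ultimately show "singleton_rel A R (map ((`) g) Xs)" unfolding singleton_rel_def by blast
next
  assume "singleton_rel A R (map ((`) g) Xs)"
  then obtain ys where ys: "map ((`) g) Xs = map (\<lambda>x. {x}) ys" "elem_rel A R ys"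
    unfolding singleton_rel_def by blast
  have "is_singleton X" if X: "X \<in> set Xs" for X
  proof -
    have "g ` X \<in> set (map (\<lambda>x. {x}) ys)" unfolding ys(1)[symmetric] using X by simp
    then have "card (g ` X) = 1" by auto
    moreover have "inj_on g X" using isomorphismD(1)[OF assms(1)] assms(2) X inj_on_subset by blast
    ultimately show ?thesis by (simp add: card_image is_singleton_altdef)
  qed
  then have Xs: "Xs = map (\<lambda>x. {x}) (map the_elem Xs)"
    by (auto simp: is_singleton_the_elem intro!: map_idI[symmetric])
  have "map (\<lambda>x. {x}) ys = map (\<lambda>x. {x}) (map g (map the_elem Xs))"
    unfolding ys(1)[symmetric] by (subst Xs) simp
  then have "ys = map g (map the_elem Xs)" using map_singleton_eq_iff by blast
  moreover have "set (map the_elem Xs) \<subseteq> universe B"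
    using assms(2) Xs by (metis (no_types, lifting) image_subset_iff list.set_map singletonI subset_iff)
  ultimately have "elem_rel B R (map the_elem Xs)" using ys(2) isomorphismD(3)[OF assms(1)] by blast
  then show "singleton_rel B R Xs" unfolding singleton_rel_def using Xs by blast
qed

lemma good_cut_iso:
  assumes g: "isomorphism g B A" and Y: "Y \<subseteq> universe B" and cut: "good_cut N V A (g ` Y)"
  shows "good_cut N V B Y"
proof -
  have "index_le N (universe B) Y (\<lambda>\<sigma>. Q (map \<sigma> [0..<n]))"
    if "index_le N (universe A) (g ` Y) (\<lambda>\<sigma>. P (map \<sigma> [0..<n]))"
      "\<And>Xs. \<forall>X\<in>set Xs. X \<subseteq> universe B \<Longrightarrow> Q Xs \<longleftrightarrow> P (map ((`) g) Xs)" for P Q n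
  proof (rule index_le_comp[where r = "\<lambda>\<sigma> i. g ` \<sigma> i", OF that(1)])
    show "g ` \<tau> j \<subseteq> universe A - g ` Y" if "\<forall>i. \<tau> i \<subseteq> universe B - Y" for \<tau> :: "nat \<Rightarrow> 'a set" and j
      using image_mono[of "\<tau> j" _ g] that inj_on_image_set_diff[OF isomorphismD(1)[OF g], of "universe B" Y]
        isomorphismD(2)[OF g] Y by (metis Diff_subset)
    show "Q (map \<sigma> [0..<n]) \<longleftrightarrow> P (map (\<lambda>i. g ` \<sigma> i) [0..<n])"
      if "\<forall>i. \<sigma> i \<subseteq> universe B" for \<sigma> :: "nat \<Rightarrow> 'a set"
      using \<open>\<And>Xs. \<forall>X\<in>set Xs. X \<subseteq> universe B \<Longrightarrow> Q Xs \<longleftrightarrow> P (map ((`) g) Xs)\<close>[of "map \<sigma> [0..<n]"] that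
      by (simp add: o_def)
  qed (use Y in \<open>auto simp: image_Un\<close>)
  note transfer = this
  show ?thesis
    unfolding good_cut_def
  proof (intro conjI allI impI)
    fix R assume "R < length (elem_arities V)"
    then show "index_le N (universe B) Y (\<lambda>\<sigma>. singleton_rel B R (map \<sigma> [0..<elem_arities V ! R]))"
      using cut by (intro transfer[of "singleton_rel A R"] singleton_rel_iso[OF g]) (auto simp: good_cut_def)
  next
    fix R assume "R < length (set_arities V)"
    then show "index_le N (universe B) Y (\<lambda>\<sigma>. set_rel B R (map \<sigma> [0..<set_arities V ! R]))"
      using cut by (intro transfer[of "set_rel A R"] isomorphismD(4)[OF g]) (auto simp: good_cut_def)
  qed (use Y in simp)
qed

lemma decomposable_iso:
  assumes "isomorphic A B" "decomposable N V A"
  shows "decomposable N V B"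
proof -
  obtain f where f: "isomorphism f A B" using assms(1) unfolding isomorphic_def by blast
  note g = isomorphism_inv[OF f] and D = isomorphismD[OF f]
  show ?thesis
  proof (cases "universe A = {}")
    case True
    then show ?thesis using D(2) by (simp add: decomposable_def)
  next
    case False
    then obtain t where t: "distinct (leaves t)" "set (leaves t) = universe A"
      "\<forall>Y\<in>edge_sets t. good_cut N V A Y"
      using assms(2) unfolding decomposable_def by blast
    have "good_cut N V B (f ` Y)" if "Y \<in> edge_sets t" for Y
    proof (rule good_cut_iso[OF g])
      have sub: "Y \<subseteq> universe A" using edge_sets_subset[OF that] t(2) by simp
      then show "f ` Y \<subseteq> universe B" using D(2) by blast
      show "good_cut N V A (inv_into (universe A) f ` f ` Y)"
        using t(3) that inv_into_image_cancel[OF D(1) sub] by simp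
    qed
    then show ?thesis
      unfolding decomposable_def using t D
      by (intro disjI2 exI[of _ "map_btree f t"])
         (auto simp: leaves_map_btree edge_sets_map_btree distinct_map)
  qed
qed

subsection \<open>Interpretations\<close>

fun prune :: "('a \<Rightarrow> bool) \<Rightarrow> 'a btree \<Rightarrow> 'a btree option" where
  "prune P (Leaf x) = (if P x then Some (Leaf x) else None)"
| "prune P (Node l r) =
     (case prune P l of None \<Rightarrow> prune P r
      | Some l' \<Rightarrow> (case prune P r of None \<Rightarrow> Some l' | Some r' \<Rightarrow> Some (Node l' r')))"

lemma prune_None: "prune P t = None \<Longrightarrow> filter P (leaves t) = []"
  by (induction t) (auto split: if_splits option.splits)

lemma prune_Some:
  "prune P t = Some t' \<Longrightarrow>
     leaves t' = filter P (leaves t) \<and> edge_sets t' \<subseteq> (\<lambda>Y. Y \<inter> Collect P) ` edge_sets t"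
proof (induction t arbitrary: t')
  case (Node l r)
  consider "prune P l = None" "prune P r = Some t'" | "prune P l = Some t'" "prune P r = None"
    | l' r' where "prune P l = Some l'" "prune P r = Some r'" "t' = Node l' r'"
    using Node.prems by (auto split: option.splits)
  then show ?case
  proof cases
    case 1
    then show ?thesis using Node.IH(2)[of t'] prune_None[OF 1(1)] by (auto simp: image_Un)
  next
    case 2
    then show ?thesis using Node.IH(1)[of t'] prune_None[OF 2(2)] by (auto simp: image_Un)
  next
    case 3
    have "set (leaves l') = set (leaves l) \<inter> Collect P" "set (leaves r') = set (leaves r) \<inter> Collect P"
      using 3 Node.IH by auto
    then show ?thesis using 3 Node.IH(1)[OF 3(1)] Node.IH(2)[OF 3(2)] by (auto simp: image_Un)
  qed
qed (auto split: if_splits)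

text \<open>Every cut of the pruned tree is the trace of a cut of the old tree, so it is enough to
  bound the index at traces. Interpretations shrink the universe; colourings are the case of an
  unchanged universe.\<close>

lemma decomposable_restrict:
  assumes "decomposable N V A" "universe B \<subseteq> universe A"
    and "\<And>Y. good_cut N V A Y \<Longrightarrow> good_cut N' W B (Y \<inter> universe B)"
  shows "decomposable N' W B"
proof (cases "universe B = {}")
  case False
  then obtain t where t: "distinct (leaves t)" "set (leaves t) = universe A"
      "\<forall>Y\<in>edge_sets t. good_cut N V A Y"
    using assms(1,2) unfolding decomposable_def by blast
  show ?thesis
  proof (cases "prune (\<lambda>x. x \<in> universe B) t")
    case None
    then show ?thesis using prune_None[OF None] t(2) assms(2) False by (auto simp: filter_empty_conv)
  next
    case (Some t')
    have "\<forall>Y\<in>edge_sets t'. good_cut N' W B Y" using prune_Some[OF Some] t(3) assms(3) by auto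
    then show ?thesis unfolding decomposable_def
      using prune_Some[OF Some] t assms(2) by (intro disjI2 exI[of _ t']) auto
  qed
qed (simp add: decomposable_def)

text \<open>Families of subsets of the new universe are families of subsets of the old one, so the
  index of the defining formula bounds that of the new relation. The arguments of an element
  relation must moreover be singletons, each at the cost of a factor 3.\<close>

lemma good_cut_interpretation:
  assumes I: "interpretation_from_to V W I" and A: "struct_over V A" and cut: "good_cut N V A Y"
    and N': "\<And>R. R < length (elem_arities W) \<Longrightarrow>
        3 ^ (elem_arities W ! R) * index_bound N (elem_formulas I ! R) \<le> N'"
      "\<And>R. R < length (set_arities W) \<Longrightarrow> index_bound N (set_formulas I ! R) \<le> N'"
  shows "good_cut N' W (interpreted_struct W I A) (Y \<inter> interpreted_universe I A)"
proof -
  let ?B = "interpreted_struct W I A" and ?U = "interpreted_universe I A"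
  have fin: "finite (universe A)" using A by (simp add: struct_over_def)
  have UB: "universe ?B = ?U" by (simp add: interpreted_struct_def)
  have UA: "?U \<subseteq> universe A" by (auto simp: interpreted_universe_def)
  have YA: "Y \<subseteq> universe A" using cut by (simp add: good_cut_def)
  have elem: "index_le N' ?U (Y \<inter> ?U) (\<lambda>\<sigma>. singleton_rel ?B R (map \<sigma> [0..<elem_arities W ! R]))"
    if R: "R < length (elem_arities W)" for R
  proof -
    let ?\<phi> = "elem_formulas I ! R" and ?n = "elem_arities W ! R"
    have \<phi>: "formula_over V ?\<phi>" "free_elem ?\<phi> \<subseteq> {..<?n}" "free_set ?\<phi> = {}"
      using I R unfolding interpretation_from_to_def by auto
    have "index_le (index_bound N ?\<phi>) ?U (Y \<inter> ?U) (\<lambda>\<sigma>. set_sat A (case_sum \<sigma> (\<lambda>_. {})) ?\<phi>)"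
      by (rule index_le_comp[OF index_le_formula[OF cut fin \<phi>(1)]])
        (use UA in \<open>auto simp: fun_eq_iff split: sum.splits\<close>)
    then have idx: "index_le (3 ^ ?n * index_bound N ?\<phi>) ?U (Y \<inter> ?U)
        (\<lambda>\<sigma>. (\<forall>i<?n. is_singleton (\<sigma> i)) \<and> set_sat A (case_sum \<sigma> (\<lambda>_. {})) ?\<phi>)"
      by (intro index_le_conj index_le_all index_le_singleton)
    have eq: "singleton_rel ?B R (map \<sigma> [0..<?n]) \<longleftrightarrow>
        (\<forall>i<?n. is_singleton (\<sigma> i)) \<and> set_sat A (case_sum \<sigma> (\<lambda>_. {})) ?\<phi>"
      if \<sigma>: "\<forall>i. \<sigma> i \<subseteq> ?U" for \<sigma>
    proof -
      \<comment> \<open>The two families may differ beyond the length of \<open>xs\<close>, but the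
        free variables of the formula lie below \<open>?n\<close>.\<close>
      have key: "sat A (\<lambda>i. xs ! i) (\<lambda>_. {}) ?\<phi> \<longleftrightarrow> set_sat A (case_sum \<sigma> (\<lambda>_. {})) ?\<phi>"
        if xs: "map \<sigma> [0..<?n] = map (\<lambda>x. {x}) xs" for xs
      proof -
        have len: "length xs = ?n" using arg_cong[OF xs, of length] by simp
        have "\<sigma> i = {xs ! i}" if "i < ?n" for i
          using arg_cong[OF xs, of "\<lambda>l. l ! i"] that len by simp
        then show ?thesis unfolding sat_iff_set_sat using \<phi>(2,3) by (intro set_sat_cong) auto
      qed
      have sing: "(\<exists>xs. map \<sigma> [0..<?n] = map (\<lambda>x. {x}) xs) \<longleftrightarrow> (\<forall>i<?n. is_singleton (\<sigma> i))"
      proof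
        assume "\<exists>xs. map \<sigma> [0..<?n] = map (\<lambda>x. {x}) xs"
        then obtain xs where xs: "map \<sigma> [0..<?n] = map (\<lambda>x. {x}) xs" by blast
        have len: "length xs = ?n" using arg_cong[OF xs, of length] by simp
        have "\<sigma> i = {xs ! i}" if "i < ?n" for i
          using arg_cong[OF xs, of "\<lambda>l. l ! i"] that len by simp
        then show "\<forall>i<?n. is_singleton (\<sigma> i)" by (auto simp: is_singleton_def)
      next
        assume "\<forall>i<?n. is_singleton (\<sigma> i)"
        then show "\<exists>xs. map \<sigma> [0..<?n] = map (\<lambda>x. {x}) xs"
          by (intro exI[of _ "map (\<lambda>i. the_elem (\<sigma> i)) [0..<?n]"]) (auto simp: is_singleton_the_elem)
      qed
      have "singleton_rel ?B R (map \<sigma> [0..<?n]) \<longleftrightarrow>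
          (\<exists>xs. map \<sigma> [0..<?n] = map (\<lambda>x. {x}) xs \<and> sat A (\<lambda>i. xs ! i) (\<lambda>_. {}) ?\<phi>)"
      proof -
        have "length xs = ?n \<and> set xs \<subseteq> ?U" if xs: "map \<sigma> [0..<?n] = map (\<lambda>x. {x}) xs" for xs
        proof
          show "length xs = ?n" using arg_cong[OF xs, of length] by simp
          have "(\<lambda>x. {x}) ` set xs = \<sigma> ` {0..<?n}" using arg_cong[OF xs, of set] by simp
          then have "\<exists>i. {x} = \<sigma> i" if "x \<in> set xs" for x using that by (metis imageE imageI)
          then show "set xs \<subseteq> ?U" using \<sigma> by (metis insert_subset subsetI)
        qed
        then show ?thesis using R unfolding singleton_rel_def interpreted_struct_def by auto
      qed
      then show ?thesis using key sing by blast
    qed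
    show ?thesis
      by (rule index_le_mono[OF index_le_cong[OF idx] N'(1)[OF R]]) (use eq in auto)
  qed
  have set: "index_le N' ?U (Y \<inter> ?U) (\<lambda>\<sigma>. set_rel ?B R (map \<sigma> [0..<set_arities W ! R]))"
    if R: "R < length (set_arities W)" for R
  proof -
    let ?\<phi> = "set_formulas I ! R" and ?n = "set_arities W ! R"
    have \<phi>: "formula_over V ?\<phi>" "free_elem ?\<phi> = {}" "free_set ?\<phi> \<subseteq> {..<?n}"
      using I R unfolding interpretation_from_to_def by auto
    \<comment> \<open>The formula has no free element variable, so element variables can be given
      the empty set, which respects every cut.\<close>
    have idx: "index_le (index_bound N ?\<phi>) ?U (Y \<inter> ?U) (\<lambda>\<sigma>. set_sat A (case_sum (\<lambda>_. {}) \<sigma>) ?\<phi>)"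
      by (rule index_le_comp[OF index_le_formula[OF cut fin \<phi>(1)]])
        (use UA in \<open>auto simp: fun_eq_iff split: sum.splits\<close>)
    have eq: "set_rel ?B R (map \<sigma> [0..<?n]) \<longleftrightarrow> set_sat A (case_sum (\<lambda>_. {}) \<sigma>) ?\<phi>"
      if \<sigma>: "\<forall>i. \<sigma> i \<subseteq> ?U" for \<sigma>
    proof -
      have "set_rel ?B R (map \<sigma> [0..<?n]) \<longleftrightarrow>
          sat A (\<lambda>_. undefined) (\<lambda>i. map \<sigma> [0..<?n] ! i) ?\<phi>"
        using R \<sigma> by (auto simp: interpreted_struct_def)
      also have "\<dots> \<longleftrightarrow> set_sat A (case_sum (\<lambda>_. {}) \<sigma>) ?\<phi>"
        unfolding sat_iff_set_sat using \<phi>(2,3) by (intro set_sat_cong) auto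
      finally show ?thesis .
    qed
    show ?thesis
      by (rule index_le_mono[OF index_le_cong[OF idx] N'(2)[OF R]]) (use eq in auto)
  qed
  show ?thesis unfolding good_cut_def UB using elem set by auto
qed

lemma decomposable_interpretation:
  assumes I: "interpretation_from_to V W I"
  shows "\<exists>N'. \<forall>A. struct_over V A \<longrightarrow> decomposable N V A \<longrightarrow> decomposable N' W (interpreted_struct W I A)"
proof -
  define f where "f R = 3 ^ (elem_arities W ! R) * index_bound N (elem_formulas I ! R)" for R
  define g where "g R = index_bound N (set_formulas I ! R)" for R
  \<comment> \<open>A sum over the finitely many relation names is a common upper bound.\<close>
  define N' where "N' = (\<Sum>R<length (elem_arities W). f R) + (\<Sum>R<length (set_arities W). g R)"
  have N'1: "f R \<le> N'" if "R < length (elem_arities W)" for R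
    unfolding N'_def using that by (intro trans_le_add1 member_le_sum) auto
  have N'2: "g R \<le> N'" if "R < length (set_arities W)" for R
    unfolding N'_def using that by (intro trans_le_add2 member_le_sum) auto
  have "decomposable N' W (interpreted_struct W I A)" if A: "struct_over V A" "decomposable N V A" for A :: "'a struct"
  proof (rule decomposable_restrict[OF A(2)])
    show "universe (interpreted_struct W I A) \<subseteq> universe A"
      by (auto simp: interpreted_struct_def interpreted_universe_def)
    fix Y assume "good_cut N V A Y"
    from good_cut_interpretation[OF I A(1) this, of N'] N'1 N'2
    show "good_cut N' W (interpreted_struct W I A) (Y \<inter> universe (interpreted_struct W I A))"
      unfolding f_def g_def by (simp add: interpreted_struct_def)
  qed
  then show ?thesis by blast
qed

subsection \<open>Colouring and copying\<close>

text \<open>The 6 is 3 * 2: a colour predicate asks for a singleton and for containment in the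
  colour class.\<close>

lemma decomposable_colouring:
  fixes A :: "'a struct"
  assumes "decomposable N V A"
  shows "decomposable (N + 6) (colour_vocabulary k V) (colour_struct V k c A)"
proof (rule decomposable_restrict[OF assms])
  let ?B = "colour_struct V k c A" and ?W = "colour_vocabulary k V" and ?l = "length (elem_arities V)"
  show "universe ?B \<subseteq> universe A" by (simp add: colour_struct_def)
  fix Y assume cut: "good_cut N V A Y"
  have UB: "universe ?B = universe A" by (simp add: colour_struct_def)
  have YA: "Y \<subseteq> universe A" using cut by (simp add: good_cut_def)
  have elem: "index_le (N + 6) (universe A) Y (\<lambda>\<sigma>. singleton_rel ?B R (map \<sigma> [0..<elem_arities ?W ! R]))"
    if R: "R < length (elem_arities ?W)" for R
  proof (cases "R < ?l")
    case True
    then have "singleton_rel ?B R Xs = singleton_rel A R Xs" for Xs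
      by (auto simp: singleton_rel_def colour_struct_def)
    moreover have "elem_arities ?W ! R = elem_arities V ! R"
      using True by (simp add: colour_vocabulary_def nth_append)
    moreover have "index_le N (universe A) Y (\<lambda>\<sigma>. singleton_rel A R (map \<sigma> [0..<elem_arities V ! R]))"
      using cut True by (simp add: good_cut_def)
    ultimately show ?thesis by (simp add: index_le_mono[of N])
  next
    case False
    define i where "i = R - ?l"
    have i: "R = ?l + i" "i < k" using R False by (auto simp: i_def colour_vocabulary_def)
    have n: "elem_arities ?W ! R = 1" using i by (simp add: colour_vocabulary_def nth_append)
    have idx: "index_le (3 * 2) (universe A) Y
        (\<lambda>\<sigma>::nat \<Rightarrow> 'a set. is_singleton (\<sigma> 0) \<and> \<sigma> 0 \<subseteq> {a \<in> universe A. c a = i})"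
      by (intro index_le_conj index_le_singleton index_le_subset)
    have "singleton_rel ?B R (map \<sigma> [0..<1]) \<longleftrightarrow>
        is_singleton (\<sigma> 0) \<and> \<sigma> 0 \<subseteq> {a \<in> universe A. c a = i}" for \<sigma> :: "nat \<Rightarrow> 'a set"
    proof -
      have "singleton_rel ?B R Xs \<longleftrightarrow> (\<exists>a\<in>universe A. c a = i \<and> Xs = [{a}])" for Xs
      proof -
        have "elem_rel ?B R xs \<longleftrightarrow> (\<exists>a\<in>universe A. c a = i \<and> xs = [a])" for xs
          using i by (auto simp: colour_struct_def)
        then show ?thesis unfolding singleton_rel_def
          by (auto intro!: exI[of _ "[x]" for x])
      qed
      then show ?thesis by (auto simp: is_singleton_def)
    qed
    then show ?thesis unfolding n
      by (intro index_le_mono[OF index_le_cong[OF idx YA]]) auto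
  qed
  have set: "index_le (N + 6) (universe A) Y (\<lambda>\<sigma>. set_rel ?B R (map \<sigma> [0..<set_arities ?W ! R]))"
    if R: "R < length (set_arities ?W)" for R
    using R cut by (simp add: good_cut_def colour_vocabulary_def colour_struct_def index_le_mono[of N])
  show "good_cut (N + 6) ?W ?B (Y \<inter> universe ?B)"
    unfolding good_cut_def UB using elem set YA by (auto simp: Int_absorb2)
qed

section \<open>Copies: slices and trees\<close>

definition slice :: "nat \<Rightarrow> (nat \<times> 'a) set \<Rightarrow> 'a set" where
  "slice i X = {a. (i, a) \<in> X}"

lemma slice_simps [simp]:
  "slice i (X \<union> Y) = slice i X \<union> slice i Y"
  "slice i (Pair i ` Z) = Z"
  by (auto simp: slice_def)

lemma Pair_slice: "X \<subseteq> {i} \<times> UNIV \<Longrightarrow> Pair i ` slice i X = X"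
  by (auto simp: slice_def)

text \<open>A caterpillar on the copies 0 to \<open>j\<close>, hence on \<open>Suc j\<close> of
  them, since a \<open>btree\<close> cannot be empty; \<open>k\<close>-copying uses it with
  \<open>k - 1\<close>.\<close>

fun copies :: "nat \<Rightarrow> 'a \<Rightarrow> (nat \<times> 'a) btree" where
  "copies 0 a = Leaf (0, a)"
| "copies (Suc j) a = Node (copies j a) (Leaf (Suc j, a))"

fun copy_btree :: "nat \<Rightarrow> 'a btree \<Rightarrow> (nat \<times> 'a) btree" where
  "copy_btree k (Leaf a) = copies k a"
| "copy_btree k (Node l r) = Node (copy_btree k l) (copy_btree k r)"

lemma leaves_copies: "leaves (copies j a) = map (\<lambda>i. (i, a)) [0..<Suc j]"
  by (induction j) auto

lemma leaves_copy_btree: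
  "set (leaves (copy_btree k t)) = {..k} \<times> set (leaves t)"
  by (induction t) (auto simp: leaves_copies)

lemma distinct_copy_btree: "distinct (leaves t) \<Longrightarrow> distinct (leaves (copy_btree k t))"
proof (induction t)
  case (Leaf a)
  have "inj_on (\<lambda>i. (i, a)) S" for S :: "nat set" by (auto simp: inj_on_def)
  then show ?case by (simp add: leaves_copies distinct_map del: upt_Suc)
qed (auto simp: leaves_copy_btree)

text \<open>An edge of the new tree either stands for an old edge or lies inside the caterpillar of
  one element.\<close>

lemma edge_sets_copy_btree:
  "Y \<in> edge_sets (copy_btree k t) \<Longrightarrow>
     (\<exists>Z\<in>edge_sets t. Y = {..k} \<times> Z) \<or> (\<exists>a\<in>set (leaves t). Y \<subseteq> {..k} \<times> {a})"
proof (induction t)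
  case (Leaf a)
  have "Y \<subseteq> set (leaves (copies k a))" using Leaf edge_sets_subset by auto
  then show ?case by (auto simp: leaves_copies)
qed (auto simp: leaves_copy_btree)

text \<open>Slices commute with unions, so in this form the index is pulled back from the original
  relation.\<close>

lemma singleton_rel_copy:
  assumes "R < length (elem_arities V)"
  shows "singleton_rel (copy_struct V k A) R Xs \<longleftrightarrow>
    (\<exists>i<k. (\<forall>X\<in>set Xs. X \<subseteq> {i} \<times> UNIV) \<and> singleton_rel A R (map (slice i) Xs))"
proof
  assume "singleton_rel (copy_struct V k A) R Xs"
  then obtain i ys where i: "i < k" "elem_rel A R ys" "Xs = map (\<lambda>x. {x}) (map (Pair i) ys)"
    using assms unfolding singleton_rel_def copy_struct_def by auto
  then have "map (slice i) Xs = map (\<lambda>x. {x}) ys" by (auto simp: slice_def)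
  then have "singleton_rel A R (map (slice i) Xs)" using i(2) unfolding singleton_rel_def by blast
  moreover have "\<forall>X\<in>set Xs. X \<subseteq> {i} \<times> UNIV" using i(3) by auto
  ultimately show "\<exists>i<k. (\<forall>X\<in>set Xs. X \<subseteq> {i} \<times> UNIV) \<and> singleton_rel A R (map (slice i) Xs)"
    using i(1) by blast
next
  assume "\<exists>i<k. (\<forall>X\<in>set Xs. X \<subseteq> {i} \<times> UNIV) \<and> singleton_rel A R (map (slice i) Xs)"
  then obtain i ys where i: "i < k" "\<forall>X\<in>set Xs. X \<subseteq> {i} \<times> UNIV"
    "map (slice i) Xs = map (\<lambda>x. {x}) ys" "elem_rel A R ys"
    unfolding singleton_rel_def by blast
  have "Xs = map ((`) (Pair i)) (map (slice i) Xs)"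
    using i(2) by (subst map_map, intro map_idI[symmetric]) (simp add: Pair_slice)
  also have "\<dots> = map (\<lambda>x. {x}) (map (Pair i) ys)" unfolding i(3) by simp
  finally have Xs: "Xs = map (\<lambda>x. {x}) (map (Pair i) ys)" .
  have "elem_rel (copy_struct V k A) R (map (Pair i) ys)"
    using i(1,4) assms unfolding copy_struct_def by auto
  then show "singleton_rel (copy_struct V k A) R Xs"
    unfolding singleton_rel_def using Xs by blast
qed

lemma set_rel_copy:
  "set_rel (copy_struct V k A) R Xs \<longleftrightarrow>
    (\<exists>i<k. (\<forall>X\<in>set Xs. X \<subseteq> {i} \<times> UNIV) \<and> set_rel A R (map (slice i) Xs))"
proof
  assume "set_rel (copy_struct V k A) R Xs"
  then obtain i Ys where i: "i < k" "set_rel A R Ys" "Xs = map ((`) (Pair i)) Ys"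
    unfolding copy_struct_def by auto
  then have "map (slice i) Xs = Ys" by (simp add: map_idI)
  then show "\<exists>i<k. (\<forall>X\<in>set Xs. X \<subseteq> {i} \<times> UNIV) \<and> set_rel A R (map (slice i) Xs)"
    using i by (intro exI[of _ i]) auto
next
  assume "\<exists>i<k. (\<forall>X\<in>set Xs. X \<subseteq> {i} \<times> UNIV) \<and> set_rel A R (map (slice i) Xs)"
  then obtain i where i: "i < k" "\<forall>X\<in>set Xs. X \<subseteq> {i} \<times> UNIV" "set_rel A R (map (slice i) Xs)"
    by blast
  have "Xs = map ((`) (Pair i)) (map (slice i) Xs)"
    using i(2) by (subst map_map, intro map_idI[symmetric]) (simp add: Pair_slice)
  then show "set_rel (copy_struct V k A) R Xs"
    unfolding copy_struct_def struct.simps using i(1,3) by blast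
qed

text \<open>It suffices to compare each argument with the one in copy 0, and for singletons equality
  of the underlying elements is a nonempty intersection, a predicate of index 2.\<close>

lemma singleton_rel_copy_new:
  assumes "k > 0" and Xs: "length Xs = k" "\<forall>X\<in>set Xs. X \<subseteq> {..<k} \<times> universe A"
  shows "singleton_rel (copy_struct V k A) (length (elem_arities V)) Xs \<longleftrightarrow>
    (\<forall>i<k. (is_singleton (Xs ! i) \<and> Xs ! i \<subseteq> {i} \<times> UNIV) \<and> slice i (Xs ! i) \<inter> slice 0 (Xs ! 0) \<noteq> {})"
    (is "?L \<longleftrightarrow> ?R")
proof -
  have L: "?L \<longleftrightarrow> (\<exists>a\<in>universe A. Xs = map (\<lambda>i. {(i, a)}) [0..<k])"
  proof -
    have "elem_rel (copy_struct V k A) (length (elem_arities V)) xs \<longleftrightarrow>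
        (\<exists>a\<in>universe A. xs = map (\<lambda>i. (i, a)) [0..<k])" for xs
      by (auto simp: copy_struct_def)
    then have "?L \<longleftrightarrow> (\<exists>a\<in>universe A. Xs = map (\<lambda>x. {x}) (map (\<lambda>i. (i, a)) [0..<k]))"
      unfolding singleton_rel_def by metis
    then show ?thesis by (simp add: o_def)
  qed
  show ?thesis
  proof
    assume ?L
    then obtain a where "Xs = map (\<lambda>i. {(i, a)}) [0..<k]" using L by blast
    then show ?R using assms(1) by (auto simp: is_singleton_def slice_def)
  next
    assume R: ?R
    then have "is_singleton (Xs ! 0)" "Xs ! 0 \<subseteq> {0} \<times> UNIV" using assms(1) by auto
    then obtain a where a: "Xs ! 0 = {(0, a)}" by (auto simp: is_singleton_def)
    have "Xs ! 0 \<in> set Xs" using assms(1) Xs(1) by simp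
    then have aU: "a \<in> universe A" using Xs(2) a by auto
    have "Xs ! i = {(i, a)}" if "i < k" for i
    proof -
      have "is_singleton (Xs ! i)" using R that by blast
      then obtain x where "Xs ! i = {x}" by (rule is_singletonE)
      moreover have "(i, a) \<in> Xs ! i" using R that a by (auto simp: slice_def)
      ultimately show ?thesis by auto
    qed
    then have "Xs = map (\<lambda>i. {(i, a)}) [0..<k]" using Xs(1) by (intro nth_equalityI) auto
    then show ?L using L aU by blast
  qed
qed

text \<open>The factor \<open>2 ^ n\<close> tests that all arguments lie in copy \<open>i\<close>,
  \<open>N\<close> is for the relation on the slices, and the exponent \<open>k\<close> is for the
  disjunction over the copies.\<close>

lemma index_le_slices:
  assumes P: "index_le N U Y (\<lambda>\<sigma>. P (map \<sigma> [0..<n]))" and "Y \<subseteq> U"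
  shows "index_le ((2 ^ n * N) ^ k) ({..<k} \<times> U) ({..<k} \<times> Y)
    (\<lambda>\<sigma>. \<exists>i<k. (\<forall>X\<in>set (map \<sigma> [0..<n]). X \<subseteq> {i} \<times> UNIV) \<and> P (map (slice i) (map \<sigma> [0..<n])))"
proof (rule index_le_bex)
  fix i assume "i < k"
  let ?U = "{..<k} \<times> U" and ?Y = "{..<k} \<times> Y"
  have 1: "index_le (2 ^ n) ?U ?Y (\<lambda>\<sigma>. \<forall>j<n. \<sigma> j \<subseteq> {i} \<times> UNIV)"
    by (intro index_le_all index_le_subset)
  have 2: "index_le N ?U ?Y (\<lambda>\<sigma>. P (map (slice i) (map \<sigma> [0..<n])))"
    by (rule index_le_comp[OF P, where r = "\<lambda>\<sigma> j. slice i (\<sigma> j)"])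
      (use assms(2) in \<open>auto simp: slice_def o_def\<close>)
  show "index_le (2 ^ n * N) ?U ?Y (\<lambda>\<sigma>. (\<forall>X\<in>set (map \<sigma> [0..<n]). X \<subseteq> {i} \<times> UNIV) \<and>
      P (map (slice i) (map \<sigma> [0..<n])))"
  proof -
    have "(\<forall>X\<in>set (map \<sigma> [0..<n]). X \<subseteq> {i} \<times> UNIV) \<longleftrightarrow> (\<forall>j<n. \<sigma> j \<subseteq> {i} \<times> UNIV)"
      for \<sigma> :: "nat \<Rightarrow> (nat \<times> 'a) set" by auto
    then show ?thesis using index_le_conj[OF 1 2] by (simp only:)
  qed
qed

text \<open>The summands belong to the old relations at copied cuts, to the new relation there, and
  to the cuts inside a caterpillar. The 12 is 3 * 2 * 2, for being a singleton, lying in the right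
  copy, and matching copy 0.\<close>

lemma decomposable_copying:
  fixes A :: "'a struct"
  assumes "k > 0" "finite (universe A)"
    and m: "\<And>n. n \<in> set (elem_arities (copy_vocabulary k V)) \<union> set (set_arities (copy_vocabulary k V)) \<Longrightarrow> n \<le> m"
    and dec: "decomposable N V A"
  shows "decomposable ((2 ^ m * N) ^ k + 12 ^ k + 2 ^ (k * m)) (copy_vocabulary k V) (copy_struct V k A)"
proof -
  let ?B = "copy_struct V k A" and ?W = "copy_vocabulary k V" and ?l = "length (elem_arities V)"
  let ?N = "(2 ^ m * N) ^ k + 12 ^ k + 2 ^ (k * m)"
  have UB: "universe ?B = {..<k} \<times> universe A" by (simp add: copy_struct_def)
  have big: "good_cut ?N ?W ?B ({..<k} \<times> Y)" if cut: "good_cut N V A Y" for Y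
  proof -
    have YA: "Y \<subseteq> universe A" using cut by (simp add: good_cut_def)
    have le: "(2 ^ n * N) ^ k \<le> ?N" if "n \<le> m" for n
      using that by (intro trans_le_add1 power_mono mult_right_mono power_increasing) auto
    have elem: "index_le ?N (universe ?B) ({..<k} \<times> Y) (\<lambda>\<sigma>. singleton_rel ?B R (map \<sigma> [0..<elem_arities ?W ! R]))"
      if R: "R < length (elem_arities ?W)" for R
    proof (cases "R < ?l")
      case True
      then have n: "elem_arities ?W ! R = elem_arities V ! R" "elem_arities V ! R \<le> m"
        using m by (auto simp: copy_vocabulary_def nth_append)
      have "index_le N (universe A) Y (\<lambda>\<sigma>. singleton_rel A R (map \<sigma> [0..<elem_arities V ! R]))"
        using cut True by (simp add: good_cut_def)
      from index_le_mono[OF index_le_slices[OF this YA] le[OF n(2)]]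
      show ?thesis unfolding UB n(1) singleton_rel_copy[OF True] .
    next
      case False
      then have Rl: "R = ?l" and n: "elem_arities ?W ! R = k"
        using R by (auto simp: copy_vocabulary_def nth_append)
      have meet: "index_le 2 (universe ?B) ({..<k} \<times> Y)
          (\<lambda>\<sigma>::nat \<Rightarrow> (nat \<times> 'a) set. slice i (\<sigma> i) \<inter> slice 0 (\<sigma> 0) \<noteq> {})" for i
        by (rule index_le_comp[where r = "\<lambda>\<sigma> j. if j = 0 then slice i (\<sigma> i) else slice 0 (\<sigma> 0)",
              OF index_le_meet[of "universe A" Y 0 1]])
          (use YA in \<open>auto simp: slice_def UB fun_eq_iff\<close>)
      have "index_le ((3 * 2 * 2) ^ k) (universe ?B) ({..<k} \<times> Y) (\<lambda>\<sigma>. \<forall>i<k.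
          (is_singleton (\<sigma> i) \<and> \<sigma> i \<subseteq> {i} \<times> UNIV) \<and> slice i (\<sigma> i) \<inter> slice 0 (\<sigma> 0) \<noteq> {})"
        by (intro index_le_all index_le_conj index_le_singleton index_le_subset meet)
      then have idx: "index_le ?N (universe ?B) ({..<k} \<times> Y) (\<lambda>\<sigma>. \<forall>i<k.
          (is_singleton (\<sigma> i) \<and> \<sigma> i \<subseteq> {i} \<times> UNIV) \<and> slice i (\<sigma> i) \<inter> slice 0 (\<sigma> 0) \<noteq> {})"
        by (rule index_le_mono) simp
      show ?thesis unfolding n unfolding Rl
      proof (rule index_le_cong[OF idx])
        show "{..<k} \<times> Y \<subseteq> universe ?B" using YA UB by auto
        fix \<sigma> :: "nat \<Rightarrow> (nat \<times> 'a) set" assume "\<forall>i. \<sigma> i \<subseteq> universe ?B"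
        then show "singleton_rel ?B ?l (map \<sigma> [0..<k]) \<longleftrightarrow> (\<forall>i<k.
            (is_singleton (\<sigma> i) \<and> \<sigma> i \<subseteq> {i} \<times> UNIV) \<and> slice i (\<sigma> i) \<inter> slice 0 (\<sigma> 0) \<noteq> {})"
          using assms(1) UB by (subst singleton_rel_copy_new) auto
      qed
    qed
    have set: "index_le ?N (universe ?B) ({..<k} \<times> Y) (\<lambda>\<sigma>. set_rel ?B R (map \<sigma> [0..<set_arities ?W ! R]))"
      if R: "R < length (set_arities ?W)" for R
    proof -
      have n: "set_arities ?W ! R = set_arities V ! R" "set_arities V ! R \<le> m"
        using m R by (auto simp: copy_vocabulary_def)
      have "index_le N (universe A) Y (\<lambda>\<sigma>. set_rel A R (map \<sigma> [0..<set_arities V ! R]))"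
        using cut R by (simp add: good_cut_def copy_vocabulary_def)
      from index_le_mono[OF index_le_slices[OF this YA] le[OF n(2)]]
      show ?thesis unfolding UB n(1) set_rel_copy .
    qed
    show ?thesis unfolding good_cut_def using elem set YA UB by auto
  qed
  have small: "good_cut ?N ?W ?B Y" if "Y \<subseteq> {..<k} \<times> {a}" "a \<in> universe A" for Y a
  proof -
    have fin: "finite Y" using that(1) finite_subset by blast
    have "card Y \<le> k" using card_mono[OF _ that(1)] by (simp add: card_cartesian_product)
    moreover have "Y \<subseteq> universe ?B" using that UB by auto
    ultimately have "good_cut (2 ^ (k * m)) ?W ?B Y" using fin m by (intro good_cut_small) auto
    then show ?thesis by (rule good_cut_mono) simp
  qed
  show ?thesis
  proof (cases "universe A = {}")
    case True
    then show ?thesis by (simp add: decomposable_def UB)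
  next
    case False
    then obtain t where t: "distinct (leaves t)" "set (leaves t) = universe A"
      "\<forall>Y\<in>edge_sets t. good_cut N V A Y"
      using dec unfolding decomposable_def by blast
    obtain k' where k': "k = Suc k'" using assms(1) by (cases k) auto
    have eq: "{..k'} = {..<k}" using k' by auto
    have "good_cut ?N ?W ?B Y" if "Y \<in> edge_sets (copy_btree k' t)" for Y
      using edge_sets_copy_btree[OF that] big small t(2,3) unfolding eq by metis
    moreover have "set (leaves (copy_btree k' t)) = universe ?B"
      unfolding leaves_copy_btree eq UB t(2) ..
    ultimately show ?thesis
      unfolding decomposable_def using distinct_copy_btree[OF t(1), of k'] by blast
  qed
qed

text \<open>\<open>N\<close> is arbitrary in the induction because the second factor of a
  composition starts from the bound that the first one yields.\<close>

lemma decomposable_transduction: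
  assumes "mso_transduction V W T"
  shows "\<exists>N'. \<forall>A B. T A B \<longrightarrow> decomposable N V A \<longrightarrow> decomposable N' W B"
  using assms
proof (induction arbitrary: N)
  case (interpreting V W I)
  from decomposable_interpretation[OF this, of N] obtain N' where
    "\<forall>A::nat struct. struct_over V A \<longrightarrow> decomposable N V A \<longrightarrow> decomposable N' W (interpreted_struct W I A)"
    by blast
  then show ?case using decomposable_iso by blast
next
  case (filtering V \<phi>)
  then show ?case using decomposable_iso by blast
next
  case (copying k V)
  let ?S = "set (elem_arities (copy_vocabulary k V)) \<union> set (set_arities (copy_vocabulary k V))"
  have m: "n \<le> Max ?S" if "n \<in> ?S" for n using that by (intro Max_ge) auto
  show ?case
    using decomposable_copying[OF copying, of _ V "Max ?S"] m decomposable_iso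
    unfolding struct_over_def by blast
next
  case (colouring k V)
  have "decomposable (N + 6) (colour_vocabulary k V) B"
    if "decomposable N V A" "isomorphic (colour_struct V k c A) B" for A B :: "nat struct" and c
    using decomposable_iso[OF that(2) decomposable_colouring[OF that(1)]] .
  then show ?case by blast
next
  case (composition U V S W T)
  obtain N1 where N1: "\<forall>A B. S A B \<longrightarrow> decomposable N U A \<longrightarrow> decomposable N1 V B"
    using composition.IH(1) by blast
  obtain N2 where N2: "\<forall>A B. T A B \<longrightarrow> decomposable N1 V A \<longrightarrow> decomposable N2 W B"
    using composition.IH(2) by blast
  show ?case using N1 N2 by (intro exI[of _ N2]) (auto elim!: relcomppE)
qed

subsection \<open>Trees\<close>

text \<open>An edge crosses a cut of the second kind only into \<open>Y\<close>, and only from the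
  one node \<open>v\<close>. Single nodes are listed separately because an inner node, placed as a
  leaf beside its proper descendants, is not closed under children.\<close>

definition tree_cut :: "'a rel \<Rightarrow> 'a set \<Rightarrow> bool" where
  "tree_cut E Y \<longleftrightarrow> (\<exists>y. Y = {y}) \<or>
     (\<forall>x y. (x, y) \<in> E \<longrightarrow> x \<in> Y \<longrightarrow> y \<in> Y) \<and>
     (\<exists>v. \<forall>x y. (x, y) \<in> E \<longrightarrow> x \<notin> Y \<longrightarrow> y \<in> Y \<longrightarrow> x = v)"

locale rooted_tree =
  fixes E :: "'a rel" and r :: 'a
  assumes finite_edges: "finite E"
    and root: "(x, r) \<notin> E"
    and parent_unique: "(x, y) \<in> E \<Longrightarrow> (x', y) \<in> E \<Longrightarrow> x = x'"
begin

abbreviation desc :: "'a \<Rightarrow> 'a set" where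
  "desc v \<equiv> E\<^sup>* `` {v}"

text \<open>Walking back along the unique parents, both paths reach the parentless node
  \<open>r\<close> at the same moment. Acyclicity enters the construction in this form.\<close>

lemma depth_unique: "(r, x) \<in> E ^^ n \<Longrightarrow> (r, x) \<in> E ^^ m \<Longrightarrow> n = m"
proof (induction n arbitrary: x m)
  case 0
  then show ?case using root by (cases m) auto
next
  case (Suc n)
  obtain z where z: "(r, z) \<in> E ^^ n" "(z, x) \<in> E" using Suc.prems(1) by auto
  obtain m' where m': "m = Suc m'" using Suc.prems(2) z(2) root by (cases m) auto
  then obtain z' where "(r, z') \<in> E ^^ m'" "(z', x) \<in> E" using Suc.prems(2) by auto
  then show ?case using Suc.IH z parent_unique m' by blast
qed

lemma ancestor_unique: "(a, y) \<in> E ^^ n \<Longrightarrow> (b, y) \<in> E ^^ n \<Longrightarrow> a = b"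
proof (induction n arbitrary: y)
  case (Suc n)
  then show ?case using parent_unique by (metis relpow_Suc_E)
qed auto

lemma finite_desc: "finite (desc v)"
proof (rule finite_subset)
  show "desc v \<subseteq> insert v (Range E)" by (auto elim: rtranclE)
  show "finite (insert v (Range E))" using finite_edges by (simp add: finite_Range)
qed

text \<open>Both paths to \<open>y\<close> have the length given by its depth, and ancestors at
  equal distance coincide.\<close>

lemma desc_children_disjoint:
  assumes "(r, v) \<in> E\<^sup>*" "(v, c) \<in> E" "(v, c') \<in> E" "y \<in> desc c" "y \<in> desc c'"
  shows "c = c'"
proof -
  obtain d n m where d: "(r, v) \<in> E ^^ d" and n: "(c, y) \<in> E ^^ n" and m: "(c', y) \<in> E ^^ m"
    using assms by (auto simp: rtrancl_power)
  have "(r, y) \<in> E ^^ (Suc d + n)" "(r, y) \<in> E ^^ (Suc d + m)"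
    unfolding relpow_add using relpow_Suc_I[OF d assms(2)] relpow_Suc_I[OF d assms(3)] n m by blast+
  then have "Suc d + n = Suc d + m" by (rule depth_unique)
  then have "n = m" by simp
  then show ?thesis using ancestor_unique n m by blast
qed

lemma not_desc_child:
  assumes "(r, v) \<in> E\<^sup>*" "(v, c) \<in> E"
  shows "v \<notin> desc c"
proof
  assume "v \<in> desc c"
  then obtain d n where d: "(r, v) \<in> E ^^ d" and n: "(c, v) \<in> E ^^ n"
    using assms by (auto simp: rtrancl_power)
  then have "(r, v) \<in> E ^^ (Suc d + n)"
    unfolding relpow_add using relpow_Suc_I[OF d assms(2)] by blast
  then have "d = Suc d + n" using depth_unique d by blast
  then show False by simp
qed

lemma desc_unfold: "desc v = insert v (\<Union>c\<in>E `` {v}. desc c)"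
  by (auto elim: converse_rtranclE intro: converse_rtrancl_into_rtrancl)

text \<open>On the path from some \<open>c\<close> to \<open>y\<close>, either \<open>y\<close> is
  \<open>c\<close>, whose parent is \<open>v\<close>, or the parent of \<open>y\<close> already lies
  below \<open>c\<close>.\<close>

lemma tree_cut_siblings:
  assumes "C \<subseteq> E `` {v}"
  shows "tree_cut E (\<Union>c\<in>C. desc c)"
proof -
  let ?Y = "\<Union>c\<in>C. desc c"
  have "x = v" if xy: "(x, y) \<in> E" "x \<notin> ?Y" "y \<in> ?Y" for x y
  proof -
    obtain c where c: "c \<in> C" "(c, y) \<in> E\<^sup>*" using xy(3) by auto
    from c(2) show ?thesis
    proof (cases rule: rtranclE)
      case base
      then show ?thesis using xy(1) c(1) assms parent_unique by blast
    next
      case (step z)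
      then have "z = x" using xy(1) parent_unique by blast
      then show ?thesis using step(1) c(1) xy(2) by blast
    qed
  qed
  moreover have "y \<in> ?Y" if "(x, y) \<in> E" "x \<in> ?Y" for x y
    using that by (auto intro: rtrancl_into_rtrancl)
  ultimately show ?thesis unfolding tree_cut_def by blast
qed

text \<open>Siblings are attached one at a time, which copes with unbounded degree: each spine edge
  cuts off a union of subtrees of siblings.\<close>

lemma forest_btree:
  assumes v: "(r, v) \<in> E\<^sup>*" and "finite C" "C \<noteq> {}" "C \<subseteq> E `` {v}"
    and "\<And>c. c \<in> C \<Longrightarrow> \<exists>t. distinct (leaves t) \<and> set (leaves t) = desc c \<and> (\<forall>Y\<in>edge_sets t. tree_cut E Y)"
  shows "\<exists>t. distinct (leaves t) \<and> set (leaves t) = (\<Union>c\<in>C. desc c) \<and> (\<forall>Y\<in>edge_sets t. tree_cut E Y)"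
  using assms(2-)
proof (induction C rule: finite_ne_induct)
  case (singleton c)
  then show ?case by simp
next
  case (insert c C)
  obtain t where t: "distinct (leaves t)" "set (leaves t) = (\<Union>c\<in>C. desc c)" "\<forall>Y\<in>edge_sets t. tree_cut E Y"
    using insert by auto
  obtain s where s: "distinct (leaves s)" "set (leaves s) = desc c" "\<forall>Y\<in>edge_sets s. tree_cut E Y"
    using insert.prems(2)[of c] by auto
  have "desc c \<inter> (\<Union>c\<in>C. desc c) = {}"
    using desc_children_disjoint[OF v] insert.hyps(3) insert.prems(1) by blast
  moreover have "tree_cut E (desc c)" "tree_cut E (\<Union>c\<in>C. desc c)"
    using tree_cut_siblings[of "{c}" v] tree_cut_siblings[of C v] insert.prems(1) by auto
  ultimately show ?case using s t by (intro exI[of _ "Node s t"]) auto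
qed

text \<open>The node becomes a leaf beside the tree of its proper descendants. A child has fewer
  descendants, as \<open>v\<close> is not below it.\<close>

lemma subtree_btree:
  assumes "(r, v) \<in> E\<^sup>*"
  shows "\<exists>t. distinct (leaves t) \<and> set (leaves t) = desc v \<and> (\<forall>Y\<in>edge_sets t. tree_cut E Y)"
  using assms
proof (induction "card (desc v)" arbitrary: v rule: less_induct)
  case less
  show ?case
  proof (cases "E `` {v} = {}")
    case True
    then show ?thesis using desc_unfold[of v] by (intro exI[of _ "Leaf v"]) simp
  next
    case False
    have "\<exists>t. distinct (leaves t) \<and> set (leaves t) = desc c \<and> (\<forall>Y\<in>edge_sets t. tree_cut E Y)"
      if c: "c \<in> E `` {v}" for c
    proof (rule less.hyps)
      have "desc c \<subseteq> desc v" "v \<in> desc v" using c desc_unfold[of v] by auto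
      then show "card (desc c) < card (desc v)"
        using not_desc_child[OF less.prems, of c] c finite_desc by (intro psubset_card_mono) auto
      show "(r, c) \<in> E\<^sup>*" using c less.prems by (auto intro: rtrancl_into_rtrancl)
    qed
    moreover have "finite (E `` {v})" using finite_edges by (rule finite_Image)
    ultimately obtain t where t: "distinct (leaves t)" "set (leaves t) = (\<Union>c\<in>E `` {v}. desc c)"
      "\<forall>Y\<in>edge_sets t. tree_cut E Y"
      using forest_btree[OF less.prems _ False order_refl] by blast
    have "v \<notin> set (leaves t)" using not_desc_child[OF less.prems] t(2) by auto
    moreover have "tree_cut E {v}" by (auto simp: tree_cut_def)
    moreover have "tree_cut E (set (leaves t))" using tree_cut_siblings[of _ v] t(2) by simp
    moreover have "set (leaves (Node (Leaf v) t)) = desc v" using t(2) desc_unfold[of v] by simp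
    ultimately show ?thesis using t by (intro exI[of _ "Node (Leaf v) t"]) auto
  qed
qed

end

text \<open>The 36 is 3 * 3 * 4: two singleton tests and two bits, namely whether an edge joins the
  inner parts and whether the inner part of the second argument contains a child of
  \<open>v\<close>.\<close>

lemma good_cut_tree:
  assumes A: "struct_over tree_vocabulary A" and Y: "Y \<subseteq> universe A"
    and cut: "tree_cut {(u, v). elem_rel A 0 [u, v]} Y"
  shows "good_cut 36 tree_vocabulary A Y"
proof -
  let ?E = "{(u, v). elem_rel A 0 [u, v]}"
  consider y where "Y = {y}"
    | v where "\<forall>x y. (x, y) \<in> ?E \<longrightarrow> x \<in> Y \<longrightarrow> y \<in> Y"
      "\<forall>x y. (x, y) \<in> ?E \<longrightarrow> x \<notin> Y \<longrightarrow> y \<in> Y \<longrightarrow> x = v"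
    using cut unfolding tree_cut_def by blast
  then show ?thesis
  proof cases
    case 1
    then have "good_cut (2 ^ (1 * 2)) tree_vocabulary A Y"
      using Y by (intro good_cut_small) (auto simp: tree_vocabulary_def)
    then show ?thesis by (rule good_cut_mono) simp
  next
    case 2
    have edge: "index_le 4 (universe A) Y (\<lambda>\<sigma>::nat \<Rightarrow> 'a set. \<sigma> 0 \<times> \<sigma> 1 \<inter> ?E \<noteq> {})"
    proof (rule index_leI[where S = UNIV and
          G = "\<lambda>\<sigma>. (\<sigma> 0 \<times> \<sigma> 1 \<inter> ?E \<noteq> {}, \<sigma> 1 \<inter> ?E `` {v} \<noteq> {})"])
      show "card (UNIV :: (bool \<times> bool) set) \<le> 4" by simp
      fix \<sigma> \<sigma>' \<tau> :: "nat \<Rightarrow> 'a set"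
      assume *: "\<forall>i. \<sigma> i \<subseteq> Y" "\<forall>i. \<sigma>' i \<subseteq> Y" "\<forall>i. \<tau> i \<subseteq> universe A - Y"
        "(\<sigma> 0 \<times> \<sigma> 1 \<inter> ?E \<noteq> {}, \<sigma> 1 \<inter> ?E `` {v} \<noteq> {}) = (\<sigma>' 0 \<times> \<sigma>' 1 \<inter> ?E \<noteq> {}, \<sigma>' 1 \<inter> ?E `` {v} \<noteq> {})"
        "(\<sigma> 0 \<union> \<tau> 0) \<times> (\<sigma> 1 \<union> \<tau> 1) \<inter> ?E \<noteq> {}"
      \<comment> \<open>No edge leaves \<open>Y\<close>, and every edge that enters it starts at
        \<open>v\<close>.\<close>
      have char: "(f 0 \<union> \<tau> 0) \<times> (f 1 \<union> \<tau> 1) \<inter> ?E \<noteq> {} \<longleftrightarrow>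
          f 0 \<times> f 1 \<inter> ?E \<noteq> {} \<or> \<tau> 0 \<times> \<tau> 1 \<inter> ?E \<noteq> {} \<or> (v \<in> \<tau> 0 \<and> f 1 \<inter> ?E `` {v} \<noteq> {})"
        if f: "\<forall>i. f i \<subseteq> Y" for f
      proof -
        have e1: "f 0 \<times> \<tau> 1 \<inter> ?E = {}" using f *(3) 2(1) by blast
        have e2: "\<tau> 0 \<times> f 1 \<inter> ?E \<noteq> {} \<longleftrightarrow> v \<in> \<tau> 0 \<and> f 1 \<inter> ?E `` {v} \<noteq> {}"
          using f *(3) 2(2) by blast
        have e3: "(f 0 \<union> \<tau> 0) \<times> (f 1 \<union> \<tau> 1) \<inter> ?E =
            (f 0 \<times> f 1 \<inter> ?E) \<union> (\<tau> 0 \<times> \<tau> 1 \<inter> ?E) \<union> (f 0 \<times> \<tau> 1 \<inter> ?E) \<union> (\<tau> 0 \<times> f 1 \<inter> ?E)"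
          by blast
        show ?thesis unfolding e3 Un_empty using e1 e2 by argo
      qed
      show "(\<sigma>' 0 \<union> \<tau> 0) \<times> (\<sigma>' 1 \<union> \<tau> 1) \<inter> ?E \<noteq> {}"
        using *(4,5) unfolding char[OF *(1)] char[OF *(2)] prod.inject by argo
    qed auto
    have idx: "index_le (3 * 3 * 4) (universe A) Y (\<lambda>\<sigma>::nat \<Rightarrow> 'a set.
        (is_singleton (\<sigma> 0) \<and> is_singleton (\<sigma> 1)) \<and> \<sigma> 0 \<times> \<sigma> 1 \<inter> ?E \<noteq> {})"
      by (intro index_le_conj index_le_singleton edge)
    have "singleton_rel A 0 (map \<sigma> [0..<2]) \<longleftrightarrow>
        (is_singleton (\<sigma> 0) \<and> is_singleton (\<sigma> 1)) \<and> \<sigma> 0 \<times> \<sigma> 1 \<inter> ?E \<noteq> {}" (is "?L \<longleftrightarrow> ?R")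
      for \<sigma> :: "nat \<Rightarrow> 'a set"
    proof -
      have two: "map \<sigma> [0..<2] = [\<sigma> 0, \<sigma> 1]" by (simp add: numeral_2_eq_2)
      show ?thesis
      proof
        assume ?L
        then obtain xs where xs: "[\<sigma> 0, \<sigma> 1] = map (\<lambda>x. {x}) xs" "elem_rel A 0 xs"
          unfolding singleton_rel_def two by (elim exE conjE)
        then obtain x y where "xs = [x, y]" by (auto simp: Cons_eq_map_conv)
        then show ?R using xs by auto
      next
        assume ?R
        then obtain x y where xy: "\<sigma> 0 = {x}" "\<sigma> 1 = {y}" by (elim conjE is_singletonE)
        with \<open>?R\<close> have "elem_rel A 0 [x, y]" by simp
        with xy show ?L unfolding singleton_rel_def two by (intro exI[of _ "[x, y]"]) simp
      qed
    qed
    then have "index_le 36 (universe A) Y (\<lambda>\<sigma>. singleton_rel A 0 (map \<sigma> [0..<2]))"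
      using idx by simp
    then show ?thesis using Y by (simp add: good_cut_def tree_vocabulary_def)
  qed
qed

lemma decomposable_tree:
  assumes "is_tree A"
  shows "decomposable 36 tree_vocabulary A"
proof -
  let ?E = "{(u, v). elem_rel A 0 [u, v]}"
  have A: "struct_over tree_vocabulary A" using assms by (simp add: is_tree_def)
  have "set [u, v] \<subseteq> universe A" if "elem_rel A 0 [u, v]" for u v
    using A that unfolding struct_over_def by blast
  then have sub: "?E \<subseteq> universe A \<times> universe A" by auto
  obtain r where r: "r \<in> universe A" "\<forall>x. \<not> elem_rel A 0 [x, r]"
      "\<forall>y\<in>universe A. y \<noteq> r \<longrightarrow> (\<exists>!x. elem_rel A 0 [x, y])" "\<forall>y\<in>universe A. (r, y) \<in> ?E\<^sup>*"
    using assms unfolding is_tree_def by blast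
  interpret rooted_tree ?E r
  proof
    show "finite ?E" using A finite_subset[OF sub] by (simp add: struct_over_def)
    show "(x, r) \<notin> ?E" for x using r(2) by simp
    show "x = x'" if "(x, y) \<in> ?E" "(x', y) \<in> ?E" for x y x'
    proof -
      have "y \<in> universe A" "y \<noteq> r" using that(1) sub r(2) by auto
      then show ?thesis using that r(3) by auto
    qed
  qed
  have desc: "desc r = universe A"
  proof
    show "desc r \<subseteq> universe A" using r(1) sub by (auto elim: rtranclE)
    show "universe A \<subseteq> desc r" using r(4) by blast
  qed
  obtain t where t: "distinct (leaves t)" "set (leaves t) = universe A" "\<forall>Y\<in>edge_sets t. tree_cut ?E Y"
    using subtree_btree[of r] desc by auto
  have "good_cut 36 tree_vocabulary A Y" if "Y \<in> edge_sets t" for Y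
    using good_cut_tree[OF A] edge_sets_subset[OF that] t(2,3) that by simp
  then show ?thesis unfolding decomposable_def using t(1,2) by blast
qed

section \<open>Connectivity is bounded by the index\<close>

text \<open>Independent sets inside a side \<open>Y\<close> of different sizes that all complete a basis of the other
  side to a basis of the matroid have different classes, because the maximal size of a set outside
  \<open>Y\<close> that extends them independently is determined by the class.\<close>

lemma connectivity_le_index:
  fixes scale :: "'f::field \<Rightarrow> 'v::ab_group_add \<Rightarrow> 'v" and M :: "('e, 'v) rep_matroid"
  assumes vs: "vector_space scale" and M: "rep_matroid M"
    and cut: "good_cut N independent_vocabulary (independent_struct scale M) Y"
  shows "connectivity scale M Y (elements M - Y) \<le> N"
proof -
  interpret vector_space scale by (fact vs)
  let ?v = "vec M" and ?E = "elements M" and ?A = "independent_struct scale M"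
  let ?Z = "?E - Y"
  have UA: "universe ?A = ?E" by (simp add: independent_struct_def)
  have fin: "finite ?E" using M by (simp add: rep_matroid_def)
  have YE: "Y \<subseteq> ?E" using cut UA by (simp add: good_cut_def)
  \<comment> \<open>\<open>B\<close> is a basis of the far side; vectors of \<open>Y\<close> extend
    it to a basis \<open>D1\<close> of the matroid.\<close>
  obtain B where B: "B \<subseteq> ?v ` ?Z" "independent B" "?v ` ?Z \<subseteq> span B"
    using maximal_independent_subset by blast
  obtain D1 where D1: "B \<subseteq> D1" "D1 \<subseteq> B \<union> ?v ` Y" "independent D1" "B \<union> ?v ` Y \<subseteq> span D1"
    using maximal_independent_subset_extend[of B "B \<union> ?v ` Y"] B(2) by blast
  \<comment> \<open>The size of \<open>C\<close> is the rank of the matroid minus the rank of the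
    far side. For a basis \<open>D\<close> of \<open>Y\<close> that extends \<open>C\<close>, the
    connectivity is \<open>card D - card C\<close>, and sets between \<open>C\<close> and
    \<open>D\<close> take every size in this range.\<close>
  define C where "C = D1 - B"
  have CY: "C \<subseteq> ?v ` Y" and indC: "independent C"
    using D1 independent_mono[of D1 C] by (auto simp: C_def)
  obtain D where D: "C \<subseteq> D" "D \<subseteq> ?v ` Y" "independent D" "?v ` Y \<subseteq> span D"
    using maximal_independent_subset_extend[OF CY indC] by blast
  have EYZ: "?v ` ?E = ?v ` Y \<union> ?v ` ?Z" using YE by blast
  have D1E: "D1 \<subseteq> ?v ` ?E" "?v ` ?E \<subseteq> span D1"
    using D1(2,4) B(1,3) EYZ span_mono[OF D1(1)] by blast+
  have card_bases: "card B = dim (?v ` ?Z)" "card D1 = dim (?v ` ?E)" "card D = dim (?v ` Y)"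
    using basis_card_eq_dim B D D1(3) D1E by blast+
  have finite_sets: "finite (?v ` ?E)" "finite B" "finite D" "finite D1"
    using fin D1E(1) finite_subset[OF D(2)] finite_subset[OF B(1)] YE
    by (auto intro: finite_subset)
  have card_C: "card C = card D1 - card B" "card B \<le> card D1"
    using D1(1) finite_sets by (auto simp: C_def card_Diff_subset card_mono)
  have bound: "card S \<le> card D1" if "independent S" "S \<subseteq> ?v ` ?E" for S
    using independent_span_bound[OF finite_sets(4) that(1)] that(2) D1E(2) by blast
  have "\<exists>S. C \<subseteq> S \<and> S \<subseteq> D \<and> card S = j" if "card C \<le> j" "j \<le> card D" for j
    using exists_subset_between[OF that D(1) finite_sets(3)] by blast
  then obtain S where S: "\<And>j. card C \<le> j \<Longrightarrow> j \<le> card D \<Longrightarrow> C \<subseteq> S j \<and> S j \<subseteq> D \<and> card (S j) = j"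
    by metis
  \<comment> \<open>The relation speaks of elements, so one element is chosen for each vector; this
    avoids elements with equal vectors.\<close>
  define X where "X j = inv_into Y ?v ` S j" for j
  define \<sigma> where "\<sigma> j i = (if i = (0::nat) then X j else {})" for j i
  define P where "P \<sigma> = set_rel ?A 0 (map \<sigma> [0..<1])" for \<sigma> :: "nat \<Rightarrow> 'e set"
  have P: "P \<sigma> \<longleftrightarrow> \<sigma> 0 \<subseteq> ?E \<and> inj_on ?v (\<sigma> 0) \<and> independent (?v ` \<sigma> 0)" for \<sigma>
    by (auto simp: P_def independent_struct_def)
  have X: "X j \<subseteq> Y" "?v ` X j = S j" "inj_on ?v (X j)" if "card C \<le> j" "j \<le> card D" for j
  proof -
    have sub: "S j \<subseteq> ?v ` Y" using S[OF that] D(2) by blast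
    show "X j \<subseteq> Y" unfolding X_def using sub inv_into_into[of _ ?v Y] by blast
    show "?v ` X j = S j" unfolding X_def using sub by (rule image_inv_into_cancel[OF refl])
    show "inj_on ?v (X j)" unfolding X_def
      using sub by (auto simp: inj_on_def f_inv_into_f subset_iff)
  qed
  have distinct_classes: "cut_class ?E Y P (\<sigma> i) \<noteq> cut_class ?E Y P (\<sigma> j)"
    if ij: "card C \<le> i" "i < j" "j \<le> card D" for i j
  proof
    assume eq: "cut_class ?E Y P (\<sigma> i) = cut_class ?E Y P (\<sigma> j)"
    have i: "card C \<le> i" "i \<le> card D" and j: "card C \<le> j" "j \<le> card D" using ij by auto
    have "independent (S i)" using S[OF i] independent_mono[OF D(3)] by blast
    \<comment> \<open>Since \<open>S i\<close> contains \<open>C\<close>, its union with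
      \<open>B\<close> spans everything, so \<open>S i\<close> is completed to a basis by vectors of
      the far side.\<close>
    then obtain D2 where D2: "S i \<subseteq> D2" "D2 \<subseteq> S i \<union> B" "independent D2" "S i \<union> B \<subseteq> span D2"
      using maximal_independent_subset_extend[of "S i" "S i \<union> B"] by blast
    have "D1 \<subseteq> S i \<union> B" using S[OF i] by (auto simp: C_def)
    then have "D1 \<subseteq> span D2" using D2(4) by blast
    then have "span D1 \<subseteq> span D2" by (simp add: span_minimal)
    moreover have "D2 \<subseteq> ?v ` ?E" using D2(2) S[OF i] D(2) B(1) EYZ by blast
    ultimately have card_D2: "card D2 = card D1"
      using basis_card_eq_dim[of D2 "?v ` ?E"] D1E(2) D2(3) card_bases(2) by simp
    have finD2: "finite D2" using \<open>D2 \<subseteq> ?v ` ?E\<close> finite_sets(1) finite_subset by blast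
    define Z where "Z = inv_into ?Z ?v ` (D2 - S i)"
    have sub: "D2 - S i \<subseteq> ?v ` ?Z" using D2(2) B(1) by blast
    have Z: "Z \<subseteq> ?Z" unfolding Z_def using sub inv_into_into[of _ ?v ?Z] by blast
    have vZ: "?v ` Z = D2 - S i" unfolding Z_def using sub by (rule image_inv_into_cancel[OF refl])
    have injZ: "inj_on ?v Z" unfolding Z_def
      using sub by (auto simp: inj_on_def f_inv_into_f subset_iff simp del: Diff_iff)
    define \<tau> where "\<tau> i = (if i = (0::nat) then Z else {})" for i
    have "?v ` (X i \<union> Z) = D2" using X(2)[OF i] vZ D2(1) by (auto simp: image_Un)
    moreover have "inj_on ?v (X i \<union> Z)"
      using X(2,3)[OF i] vZ injZ by (auto simp: inj_on_Un)
    ultimately have "P (\<lambda>k. \<sigma> i k \<union> \<tau> k)"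
      using D2(3) X(1)[OF i] Z YE by (auto simp: P \<sigma>_def \<tau>_def)
    moreover have "\<forall>k. \<tau> k \<subseteq> ?E - Y" using Z by (simp add: \<tau>_def)
    \<comment> \<open>If the classes were equal, \<open>Z\<close>, which completes
      \<open>X i\<close> to a basis, would also extend the larger set \<open>X j\<close>
      independently, beyond the size of a basis.\<close>
    ultimately have "P (\<lambda>k. \<sigma> j k \<union> \<tau> k)" using index_leD[OF eq] by blast
    then have ind: "inj_on ?v (X j \<union> Z)" "independent (?v ` (X j \<union> Z))"
      by (auto simp: P \<sigma>_def \<tau>_def)
    have "card (?v ` (X j \<union> Z)) = card (X j \<union> Z)" using ind(1) by (rule card_image)
    also have "\<dots> = card (X j) + card Z"
      using X(1)[OF j] Z YE fin by (intro card_Un_disjoint) (auto intro: finite_subset)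
    also have "card (X j) = j" using X(2,3)[OF j] S[OF j] card_image by metis
    also have "card Z = card D1 - i"
      using card_image[OF injZ] vZ D2(1) S[OF i] card_D2 finD2 by (simp add: card_Diff_subset finite_subset)
    finally have "card (?v ` (X j \<union> Z)) > card D1"
      using ij(2) card_mono[OF finD2 D2(1)] S[OF i] card_D2 by simp
    moreover have "?v ` (X j \<union> Z) \<subseteq> ?v ` ?E" using X(1)[OF j] Z YE by (intro image_mono) blast
    ultimately show False using bound[OF ind(2)] by simp
  qed
  have "index_le N ?E Y P"
    using cut UA unfolding good_cut_def independent_vocabulary_def P_def by simp
  then have idx: "finite (cut_class ?E Y P ` {\<sigma>. \<forall>i. \<sigma> i \<subseteq> Y})"
    "card (cut_class ?E Y P ` {\<sigma>. \<forall>i. \<sigma> i \<subseteq> Y}) \<le> N"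
    by (auto simp: index_le_def)
  \<comment> \<open>The interval has \<open>card D - card C + 1\<close> members, hence the strict
    inequality below.\<close>
  have inj: "inj_on (\<lambda>j. cut_class ?E Y P (\<sigma> j)) {card C..card D}"
    using distinct_classes by (intro linorder_inj_onI) auto
  have "(\<lambda>j. cut_class ?E Y P (\<sigma> j)) ` {card C..card D} \<subseteq> cut_class ?E Y P ` {\<sigma>. \<forall>i. \<sigma> i \<subseteq> Y}"
    using X(1) by (auto simp: \<sigma>_def)
  from card_inj_on_le[OF inj this idx(1)] idx(2) have "card D - card C < N"
    using card_mono[OF finite_sets(3) D(1)] by simp
  moreover have "Y \<union> ?Z = ?E" using YE by blast
  ultimately show ?thesis
    using card_C card_bases by (simp add: connectivity_def rank_def)
qed

lemma bounded_branchwidth_if_independent_mso_width: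
  fixes scale :: "'f::field \<Rightarrow> 'v::ab_group_add \<Rightarrow> 'v" and \<C> :: "('e, 'v) rep_matroid set"
  assumes "vector_space scale" "\<forall>M\<in>\<C>. rep_matroid M"
    and "bounded_mso_width independent_vocabulary (independent_struct scale ` \<C>)"
  shows "bounded_branchwidth scale \<C>"
proof -
  obtain T where T: "mso_transduction tree_vocabulary independent_vocabulary T"
    "\<forall>A\<in>independent_struct scale ` \<C>. \<exists>t B. is_tree t \<and> T t B \<and> isomorphic A B"
    using assms(3) unfolding bounded_mso_width_def by blast
  obtain N where N: "\<forall>A B. T A B \<longrightarrow> decomposable 36 tree_vocabulary A \<longrightarrow>
      decomposable N independent_vocabulary B"
    using decomposable_transduction[OF T(1)] by blast
  have "branchwidth scale M \<le> N" if M: "M \<in> \<C>" for M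
  proof -
    have rep: "rep_matroid M" using assms(2) M by blast
    obtain t B where t: "is_tree t" "T t B" "isomorphic (independent_struct scale M) B"
      using T(2) M by blast
    then have "decomposable N independent_vocabulary (independent_struct scale M)"
      using N decomposable_tree decomposable_iso isomorphic_sym by blast
    moreover have "universe (independent_struct scale M) \<noteq> {}"
      using rep by (simp add: independent_struct_def rep_matroid_def)
    ultimately obtain d where d: "distinct (leaves d)"
      "set (leaves d) = universe (independent_struct scale M)"
      "\<forall>Y\<in>edge_sets d. good_cut N independent_vocabulary (independent_struct scale M) Y"
      unfolding decomposable_def by blast
    have bd: "branch_decomposition M d"
      using d by (simp add: branch_decomposition_def independent_struct_def)
    have le: "connectivity scale M Y (elements M - Y) \<le> N" if "Y \<in> edge_sets d" for Y
      using connectivity_le_index[OF assms(1) rep] d(3) that by blast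
    have "decomposition_width scale M d \<le> N"
    proof (cases "edge_sets d = {}")
      case True
      then show ?thesis by (simp add: decomposition_width_def)
    next
      case False
      then show ?thesis unfolding decomposition_width_def using le by (intro cSUP_least) auto
    qed
    moreover have "branchwidth scale M \<le> decomposition_width scale M d"
      unfolding branchwidth_def using bd by (intro cINF_lower) auto
    ultimately show ?thesis by simp
  qed
  then show ?thesis unfolding bounded_branchwidth_def by blast
qed

section \<open>Derived formulas\<close>

definition all_elem :: "nat \<Rightarrow> mso \<Rightarrow> mso" where
  "all_elem x \<phi> = Neg (Ex_Elem x (Neg \<phi>))"

definition imp :: "mso \<Rightarrow> mso \<Rightarrow> mso" where
  "imp \<phi> \<psi> = Neg (Conj \<phi> (Neg \<psi>))"

text \<open>The empty conjunction must be true and have no free variable, hence the quantified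
  equation.\<close>

primrec conjs :: "mso list \<Rightarrow> mso" where
  "conjs [] = all_elem 0 (Eq 0 0)"
| "conjs (\<phi> # \<phi>s) = Conj \<phi> (conjs \<phi>s)"

definition disjs :: "mso list \<Rightarrow> mso" where
  "disjs \<phi>s = Neg (conjs (map Neg \<phi>s))"

definition ex_sets :: "nat list \<Rightarrow> mso \<Rightarrow> mso" where
  "ex_sets Xs \<phi> = foldr Ex_Set Xs \<phi>"

lemma sat_all_elem [simp]: "sat A e s (all_elem x \<phi>) \<longleftrightarrow> (\<forall>a\<in>universe A. sat A (e(x := a)) s \<phi>)"
  by (simp add: all_elem_def)

lemma sat_imp [simp]: "sat A e s (imp \<phi> \<psi>) \<longleftrightarrow> (sat A e s \<phi> \<longrightarrow> sat A e s \<psi>)"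
  by (simp add: imp_def)

lemma sat_conjs [simp]: "sat A e s (conjs \<phi>s) \<longleftrightarrow> (\<forall>\<phi>\<in>set \<phi>s. sat A e s \<phi>)"
  by (induction \<phi>s) auto

lemma sat_disjs [simp]: "sat A e s (disjs \<phi>s) \<longleftrightarrow> (\<exists>\<phi>\<in>set \<phi>s. sat A e s \<phi>)"
  by (auto simp: disjs_def)

lemma sat_ex_sets:
  "sat A e s (ex_sets Xs \<phi>) \<longleftrightarrow>
    (\<exists>Z. (\<forall>X\<in>set Xs. Z X \<subseteq> universe A) \<and> sat A e (override_on s Z (set Xs)) \<phi>)"
proof (induction Xs arbitrary: s)
  case (Cons X Xs)
  have "sat A e s (ex_sets (X # Xs) \<phi>) \<longleftrightarrow> (\<exists>U\<subseteq>universe A. sat A e (s(X := U)) (ex_sets Xs \<phi>))"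
    by (simp add: ex_sets_def)
  also have "\<dots> \<longleftrightarrow> (\<exists>U Z. U \<subseteq> universe A \<and> (\<forall>X\<in>set Xs. Z X \<subseteq> universe A) \<and>
      sat A e (override_on (s(X := U)) Z (set Xs)) \<phi>)"
    unfolding Cons.IH by blast
  also have "\<dots> \<longleftrightarrow> (\<exists>Z. (\<forall>Y\<in>set (X # Xs). Z Y \<subseteq> universe A) \<and>
      sat A e (override_on s Z (set (X # Xs))) \<phi>)" (is "?L \<longleftrightarrow> ?R")
  proof
    assume ?L
    then obtain U Z where U: "U \<subseteq> universe A" "\<forall>X\<in>set Xs. Z X \<subseteq> universe A"
      "sat A e (override_on (s(X := U)) Z (set Xs)) \<phi>" by blast
    \<comment> \<open>If \<open>X\<close> occurs again in \<open>Xs\<close>, the inner quantifier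
      overrides the outer one, so \<open>Z\<close> takes precedence over \<open>U\<close>.\<close>
    define Z' where "Z' = override_on (\<lambda>_. U) Z (set Xs)"
    have "override_on (s(X := U)) Z (set Xs) = override_on s Z' (set (X # Xs))"
      by (auto simp: fun_eq_iff override_on_def Z'_def)
    moreover have "\<forall>Y\<in>set (X # Xs). Z' Y \<subseteq> universe A"
      using U by (auto simp: override_on_def Z'_def)
    ultimately show ?R using U(3) by metis
  next
    assume ?R
    then obtain Z where Z: "\<forall>Y\<in>set (X # Xs). Z Y \<subseteq> universe A"
      "sat A e (override_on s Z (set (X # Xs))) \<phi>" by blast
    have "override_on (s(X := Z X)) Z (set Xs) = override_on s Z (set (X # Xs))"
      by (auto simp: fun_eq_iff override_on_def)
    then show ?L using Z by (metis list.set_intros)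
  qed
  finally show ?case .
qed (auto simp: ex_sets_def)

lemma free_derived [simp]:
  "free_elem (all_elem x \<phi>) = free_elem \<phi> - {x}" "free_set (all_elem x \<phi>) = free_set \<phi>"
  "free_elem (imp \<phi> \<psi>) = free_elem \<phi> \<union> free_elem \<psi>" "free_set (imp \<phi> \<psi>) = free_set \<phi> \<union> free_set \<psi>"
  "free_elem (conjs \<phi>s) = (\<Union>\<phi>\<in>set \<phi>s. free_elem \<phi>)" "free_set (conjs \<phi>s) = (\<Union>\<phi>\<in>set \<phi>s. free_set \<phi>)"
  "free_elem (disjs \<phi>s) = (\<Union>\<phi>\<in>set \<phi>s. free_elem \<phi>)" "free_set (disjs \<phi>s) = (\<Union>\<phi>\<in>set \<phi>s. free_set \<phi>)"
  "free_elem (ex_sets Xs \<phi>) = free_elem \<phi>" "free_set (ex_sets Xs \<phi>) = free_set \<phi> - set Xs"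
proof -
  show conj: "free_elem (conjs \<phi>s) = (\<Union>\<phi>\<in>set \<phi>s. free_elem \<phi>)"
    "free_set (conjs \<phi>s) = (\<Union>\<phi>\<in>set \<phi>s. free_set \<phi>)" for \<phi>s
    by (induction \<phi>s) (auto simp: all_elem_def)
  show "free_elem (disjs \<phi>s) = (\<Union>\<phi>\<in>set \<phi>s. free_elem \<phi>)" "free_set (disjs \<phi>s) = (\<Union>\<phi>\<in>set \<phi>s. free_set \<phi>)"
    by (simp_all add: disjs_def conj)
  show "free_elem (ex_sets Xs \<phi>) = free_elem \<phi>" "free_set (ex_sets Xs \<phi>) = free_set \<phi> - set Xs"
    by (induction Xs) (auto simp: ex_sets_def)
qed (simp_all add: all_elem_def imp_def)

lemma formula_over_derived [simp]:
  "formula_over V (all_elem x \<phi>) \<longleftrightarrow> formula_over V \<phi>"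
  "formula_over V (imp \<phi> \<psi>) \<longleftrightarrow> formula_over V \<phi> \<and> formula_over V \<psi>"
  "formula_over V (conjs \<phi>s) \<longleftrightarrow> (\<forall>\<phi>\<in>set \<phi>s. formula_over V \<phi>)"
  "formula_over V (disjs \<phi>s) \<longleftrightarrow> (\<forall>\<phi>\<in>set \<phi>s. formula_over V \<phi>)"
  "formula_over V (ex_sets Xs \<phi>) \<longleftrightarrow> formula_over V \<phi>"
proof -
  show conj: "formula_over V (conjs \<phi>s) \<longleftrightarrow> (\<forall>\<phi>\<in>set \<phi>s. formula_over V \<phi>)" for \<phi>s
    by (induction \<phi>s) (auto simp: all_elem_def)
  show "formula_over V (disjs \<phi>s) \<longleftrightarrow> (\<forall>\<phi>\<in>set \<phi>s. formula_over V \<phi>)"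
    by (simp add: disjs_def conj)
  show "formula_over V (ex_sets Xs \<phi>) \<longleftrightarrow> formula_over V \<phi>"
    by (induction Xs) (auto simp: ex_sets_def)
qed (simp_all add: all_elem_def imp_def)

section \<open>Independence in terms of the null relation\<close>

text \<open>The coefficient of the vector of \<open>x\<close> in the sum of the null relation. The
  sets may overlap, and then their scalars add up.\<close>

definition weight :: "'f::field list \<Rightarrow> 'e set list \<Rightarrow> 'e \<Rightarrow> 'f" where
  "weight cs Xs x = (\<Sum>i<length cs. if x \<in> Xs ! i then cs ! i else 0)"

lemma null_rel_iff_weight:
  fixes scale :: "'f::field \<Rightarrow> 'v::ab_group_add \<Rightarrow> 'v"
  assumes "vector_space scale" "finite (elements M)"
    and "length Xs = length cs" "\<forall>X\<in>set Xs. X \<subseteq> elements M"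
  shows "set_rel (null_struct scale cs M) 0 Xs \<longleftrightarrow>
    (\<Sum>x\<in>elements M. scale (weight cs Xs x) (vec M x)) = 0"
proof -
  interpret vector_space scale by (fact assms(1))
  let ?E = "elements M"
  have "(\<Sum>x\<in>?E. scale (weight cs Xs x) (vec M x)) =
      (\<Sum>x\<in>?E. \<Sum>i<length cs. scale (if x \<in> Xs ! i then cs ! i else 0) (vec M x))"
    by (simp add: weight_def scale_sum_left)
  also have "\<dots> = (\<Sum>i<length cs. \<Sum>x\<in>?E. scale (if x \<in> Xs ! i then cs ! i else 0) (vec M x))"
    by (rule sum.swap)
  also have "\<dots> = (\<Sum>i<length cs. scale (cs ! i) (\<Sum>x\<in>Xs ! i. vec M x))"
  proof (rule sum.cong)
    fix i assume "i \<in> {..<length cs}"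
    then have sub: "Xs ! i \<subseteq> ?E" using assms(3,4) by simp
    have "(\<Sum>x\<in>?E. scale (if x \<in> Xs ! i then cs ! i else 0) (vec M x)) =
        (\<Sum>x\<in>Xs ! i. scale (cs ! i) (vec M x))"
      using sub assms(2) by (intro sum.mono_neutral_cong_right) auto
    then show "(\<Sum>x\<in>?E. scale (if x \<in> Xs ! i then cs ! i else 0) (vec M x)) =
        scale (cs ! i) (\<Sum>x\<in>Xs ! i. vec M x)"
      by (simp add: scale_sum_right)
  qed simp
  finally show ?thesis using assms(3,4) by (simp add: null_struct_def)
qed

text \<open>Passes from sets of vectors to indexed families. Two indices with the same vector
  violate the right-hand side through the coefficients 1 and -1.\<close>

lemma (in vector_space) independent_family_iff:
  assumes "finite X"
  shows "inj_on v X \<and> independent (v ` X) \<longleftrightarrow>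
    (\<forall>u. (\<Sum>x\<in>X. scale (u x) (v x)) = 0 \<longrightarrow> (\<forall>x\<in>X. u x = 0))" (is "?L \<longleftrightarrow> ?R")
proof
  assume L: ?L
  show ?R
  proof (intro allI impI)
    fix u assume u: "(\<Sum>x\<in>X. scale (u x) (v x)) = 0"
    define w where "w y = u (inv_into X v y)" for y
    have w: "w (v x) = u x" if "x \<in> X" for x using L that by (simp add: w_def)
    have "(\<Sum>y\<in>v ` X. scale (w y) y) = (\<Sum>x\<in>X. scale (u x) (v x))"
      using L w by (subst sum.reindex) auto
    then have "\<forall>y\<in>v ` X. w y = 0"
      using L u dependent_finite[of "v ` X"] assms by auto
    then show "\<forall>x\<in>X. u x = 0" using w by simp
  qed
next
  assume R: ?R
  have inj: "inj_on v X"
  proof (rule inj_onI, rule ccontr)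
    fix x y assume xy: "x \<in> X" "y \<in> X" "v x = v y" "x \<noteq> y"
    define u where "u z = (if z = x then 1 else if z = y then - 1 else (0::'a))" for z
    have "(\<Sum>z\<in>X. scale (u z) (v z)) = (\<Sum>z\<in>{x, y}. scale (u z) (v z))"
      using xy assms by (intro sum.mono_neutral_right) (auto simp: u_def)
    also have "\<dots> = 0" using xy by (simp add: u_def)
    finally show False using R xy(1) by (force simp: u_def)
  qed
  moreover have "independent (v ` X)"
  proof
    assume "dependent (v ` X)"
    then obtain w y where w: "y \<in> v ` X" "w y \<noteq> 0" "(\<Sum>y\<in>v ` X. scale (w y) y) = 0"
      using dependent_finite[of "v ` X"] assms by auto
    then have "(\<Sum>x\<in>X. scale (w (v x)) (v x)) = 0"
      using inj by (simp add: sum.reindex)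
    then show False using R w by auto
  qed
  ultimately show ?L by blast
qed

text \<open>Guesses a nontrivial linear relation. Set variable 0 is the set under test, and variable
  \<open>i\<close> holds the elements whose coefficient is the scalar number \<open>i - 1\<close>;
  disjointness gives each element at most one coefficient.\<close>

definition dependent_formula :: "nat \<Rightarrow> mso" where
  "dependent_formula n = ex_sets [1..<Suc n] (conjs (
     Set_Rel 0 [1..<Suc n]
     # disjs (map (\<lambda>i. Ex_Elem 0 (Mem 0 i)) [1..<Suc n])
     # map (\<lambda>i. all_elem 0 (imp (Mem 0 i) (Mem 0 0))) [1..<Suc n]
     @ concat (map (\<lambda>i. map (\<lambda>j. Neg (Ex_Elem 0 (Conj (Mem 0 i) (Mem 0 j)))) [1..<i]) [1..<Suc n])))"

definition null_dependent :: "nat \<Rightarrow> 'a struct \<Rightarrow> 'a set \<Rightarrow> bool" where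
  "null_dependent n A X \<longleftrightarrow> (\<exists>Z. (\<forall>i\<in>{1..<Suc n}. Z i \<subseteq> X) \<and>
     (\<forall>i\<in>{1..<Suc n}. \<forall>j\<in>{1..<i}. Z i \<inter> Z j = {}) \<and> (\<exists>i\<in>{1..<Suc n}. Z i \<noteq> {}) \<and>
     set_rel A 0 (map Z [1..<Suc n]))"

lemma sat_dependent_formula:
  assumes "s 0 \<subseteq> universe A"
  shows "sat A e s (dependent_formula n) \<longleftrightarrow> null_dependent n A (s 0)"
proof -
  let ?D = "{1..<Suc n}"
  have body: "sat A e s (ex_sets [1..<Suc n] (conjs (
     Set_Rel 0 [1..<Suc n]
     # disjs (map (\<lambda>i. Ex_Elem 0 (Mem 0 i)) [1..<Suc n])
     # map (\<lambda>i. all_elem 0 (imp (Mem 0 i) (Mem 0 0))) [1..<Suc n]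
     @ concat (map (\<lambda>i. map (\<lambda>j. Neg (Ex_Elem 0 (Conj (Mem 0 i) (Mem 0 j)))) [1..<i]) [1..<Suc n]))))
   \<longleftrightarrow> (\<exists>Z. (\<forall>i\<in>?D. Z i \<subseteq> universe A) \<and> (let Z' = override_on s Z ?D in
     set_rel A 0 (map Z' [1..<Suc n]) \<and> (\<exists>i\<in>?D. \<exists>a\<in>universe A. a \<in> Z' i) \<and>
     (\<forall>i\<in>?D. \<forall>a\<in>universe A. a \<in> Z' i \<longrightarrow> a \<in> Z' 0) \<and>
     (\<forall>i\<in>?D. \<forall>j\<in>{1..<i}. \<not> (\<exists>a\<in>universe A. a \<in> Z' i \<and> a \<in> Z' j))))"
    unfolding sat_ex_sets by (simp add: ball_Un Let_def del: upt_Suc)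
  have at: "override_on s Z ?D 0 = s 0" "map (override_on s Z ?D) [1..<Suc n] = map Z [1..<Suc n]"
    "\<And>i. i \<in> ?D \<Longrightarrow> override_on s Z ?D i = Z i" for Z
    by (auto simp: override_on_def)
  have in_D: "j \<in> ?D" if "i \<in> ?D" "j \<in> {1..<i}" for i j using that by auto
  have eq: "(\<forall>i\<in>?D. Z i \<subseteq> universe A) \<and>
      (let Z' = override_on s Z ?D in
       set_rel A 0 (map Z' [1..<Suc n]) \<and> (\<exists>i\<in>?D. \<exists>a\<in>universe A. a \<in> Z' i) \<and>
       (\<forall>i\<in>?D. \<forall>a\<in>universe A. a \<in> Z' i \<longrightarrow> a \<in> Z' 0) \<and>
       (\<forall>i\<in>?D. \<forall>j\<in>{1..<i}. \<not> (\<exists>a\<in>universe A. a \<in> Z' i \<and> a \<in> Z' j)))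
    \<longleftrightarrow> (\<forall>i\<in>?D. Z i \<subseteq> s 0) \<and> (\<forall>i\<in>?D. \<forall>j\<in>{1..<i}. Z i \<inter> Z j = {}) \<and>
      (\<exists>i\<in>?D. Z i \<noteq> {}) \<and> set_rel A 0 (map Z [1..<Suc n])" (is "?l Z \<longleftrightarrow> ?r Z") for Z
  proof -
    let ?o = "override_on s Z ?D"
    have 1: "(\<exists>i\<in>?D. \<exists>a\<in>universe A. a \<in> ?o i) \<longleftrightarrow> (\<exists>i\<in>?D. \<exists>a\<in>universe A. a \<in> Z i)"
      by (rule bex_cong) (simp_all only: at(3))
    have 2: "(\<forall>i\<in>?D. \<forall>a\<in>universe A. a \<in> ?o i \<longrightarrow> a \<in> s 0) \<longleftrightarrow>
        (\<forall>i\<in>?D. \<forall>a\<in>universe A. a \<in> Z i \<longrightarrow> a \<in> s 0)"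
      by (rule ball_cong) (simp_all only: at(3))
    have 3: "(\<forall>i\<in>?D. \<forall>j\<in>{1..<i}. \<not> (\<exists>a\<in>universe A. a \<in> ?o i \<and> a \<in> ?o j)) \<longleftrightarrow>
        (\<forall>i\<in>?D. \<forall>j\<in>{1..<i}. \<not> (\<exists>a\<in>universe A. a \<in> Z i \<and> a \<in> Z j))"
      using at(3) in_D by (intro ball_cong refl) simp
    show ?thesis
      unfolding Let_def at(1,2) 1 2 3
    proof
      assume L: "(\<forall>i\<in>?D. Z i \<subseteq> universe A) \<and> set_rel A 0 (map Z [1..<Suc n]) \<and>
        (\<exists>i\<in>?D. \<exists>a\<in>universe A. a \<in> Z i) \<and> (\<forall>i\<in>?D. \<forall>a\<in>universe A. a \<in> Z i \<longrightarrow> a \<in> s 0) \<and>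
        (\<forall>i\<in>?D. \<forall>j\<in>{1..<i}. \<not> (\<exists>a\<in>universe A. a \<in> Z i \<and> a \<in> Z j))"
      then have "\<forall>i\<in>?D. Z i \<subseteq> s 0" "\<exists>i\<in>?D. Z i \<noteq> {}" by blast+
      moreover have "Z i \<inter> Z j = {}" if "i \<in> ?D" "j \<in> {1..<i}" for i j
        using L that by blast
      ultimately show "?r Z" using L by blast
    next
      assume R: "?r Z"
      then have U: "\<forall>i\<in>?D. Z i \<subseteq> universe A" using assms by blast
      moreover have "\<exists>i\<in>?D. \<exists>a\<in>universe A. a \<in> Z i" using U R by blast
      moreover have "\<forall>i\<in>?D. \<forall>a\<in>universe A. a \<in> Z i \<longrightarrow> a \<in> s 0" using R by blast
      moreover have "\<forall>i\<in>?D. \<forall>j\<in>{1..<i}. \<not> (\<exists>a\<in>universe A. a \<in> Z i \<and> a \<in> Z j)" using R by blast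
      ultimately show "(\<forall>i\<in>?D. Z i \<subseteq> universe A) \<and> set_rel A 0 (map Z [1..<Suc n]) \<and>
        (\<exists>i\<in>?D. \<exists>a\<in>universe A. a \<in> Z i) \<and> (\<forall>i\<in>?D. \<forall>a\<in>universe A. a \<in> Z i \<longrightarrow> a \<in> s 0) \<and>
        (\<forall>i\<in>?D. \<forall>j\<in>{1..<i}. \<not> (\<exists>a\<in>universe A. a \<in> Z i \<and> a \<in> Z j))"
        using R by blast
    qed
  qed
  show ?thesis
    unfolding dependent_formula_def null_dependent_def body by (rule ex_cong1) (rule eq)
qed

lemma null_dependent_iso:
  assumes "isomorphism f A B" "X \<subseteq> universe A"
  shows "null_dependent n A X \<Longrightarrow> null_dependent n B (f ` X)"
proof -
  assume "null_dependent n A X"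
  then obtain Z where Z: "\<forall>i\<in>{1..<Suc n}. Z i \<subseteq> X"
     "\<forall>i\<in>{1..<Suc n}. \<forall>j\<in>{1..<i}. Z i \<inter> Z j = {}" "\<exists>i\<in>{1..<Suc n}. Z i \<noteq> {}"
     "set_rel A 0 (map Z [1..<Suc n])" unfolding null_dependent_def by blast
  have ZU: "Z i \<subseteq> universe A" if "i \<in> {1..<Suc n}" for i using Z(1) assms(2) that by blast
  have "set_rel B 0 (map (\<lambda>i. f ` Z i) [1..<Suc n])"
    using Z(4) isomorphismD(4)[OF assms(1), of "map Z [1..<Suc n]" 0] ZU by (simp add: o_def del: upt_Suc)
  moreover have "f ` Z i \<inter> f ` Z j = {}" if "i \<in> {1..<Suc n}" "j \<in> {1..<i}" for i j
    using inj_on_image_Int[OF isomorphismD(1)[OF assms(1)], of "Z i" "Z j"] Z(2) that ZU by simp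
  ultimately show "null_dependent n B (f ` X)"
    unfolding null_dependent_def using Z(1,3) by (intro exI[of _ "\<lambda>i. f ` Z i"]) blast
qed

lemma weight_disjoint:
  assumes "\<And>j. j < length cs \<Longrightarrow> x \<in> Xs ! j \<longleftrightarrow> j = i" "i < length cs"
  shows "weight cs Xs x = cs ! i"
proof -
  have "weight cs Xs x = (\<Sum>j<length cs. if j = i then cs ! j else 0)"
    unfolding weight_def using assms(1) by (intro sum.cong) auto
  then show ?thesis using assms(2) by simp
qed

lemma weight_zero: "(\<And>j. j < length cs \<Longrightarrow> x \<notin> Xs ! j) \<Longrightarrow> weight cs Xs x = 0"
  by (simp add: weight_def)

text \<open>As \<open>cs\<close> lists each nonzero scalar once, disjoint tuples of subsets of
  \<open>X\<close> are the level sets of coefficient functions on \<open>X\<close>, and some set is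
  nonempty iff the function is not zero.\<close>

lemma null_dependent_iff:
  fixes scale :: "'f::{field,finite} \<Rightarrow> 'v::ab_group_add \<Rightarrow> 'v"
  assumes vs: "vector_space scale" and cs: "distinct cs" "set cs = UNIV - {0}"
    and fin: "finite (elements M)" and X: "X \<subseteq> elements M"
  shows "set_rel (independent_struct scale M) 0 [X] \<longleftrightarrow>
    \<not> null_dependent (length cs) (null_struct scale cs M) X"
proof -
  interpret vector_space scale by (fact vs)
  let ?n = "length cs" and ?E = "elements M"
  have finX: "finite X" using fin X finite_subset by blast
  have sum_X: "(\<Sum>x\<in>?E. scale (weight cs Xs x) (vec M x)) = (\<Sum>x\<in>X. scale (weight cs Xs x) (vec M x))"
    if "\<And>j. j < ?n \<Longrightarrow> Xs ! j \<subseteq> X" for Xs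
  proof -
    have "weight cs Xs x = 0" if "x \<notin> X" for x
      using weight_zero[of cs x Xs] \<open>\<And>j. j < ?n \<Longrightarrow> Xs ! j \<subseteq> X\<close> that by blast
    then show ?thesis using fin X by (intro sum.mono_neutral_right) auto
  qed
  have nth: "map Z [1..<Suc ?n] ! j = Z (Suc j)" if "j < ?n" for Z :: "nat \<Rightarrow> 'a set" and j
    using that by (simp del: upt_Suc)
  have "null_dependent ?n (null_struct scale cs M) X \<longleftrightarrow>
      (\<exists>u. (\<Sum>x\<in>X. scale (u x) (vec M x)) = 0 \<and> (\<exists>x\<in>X. u x \<noteq> 0))" (is "?L \<longleftrightarrow> ?R")
  proof
    assume ?L
    then obtain Z where Z: "\<forall>i\<in>{1..<Suc ?n}. Z i \<subseteq> X"
       "\<forall>i\<in>{1..<Suc ?n}. \<forall>j\<in>{1..<i}. Z i \<inter> Z j = {}" "\<exists>i\<in>{1..<Suc ?n}. Z i \<noteq> {}"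
       "set_rel (null_struct scale cs M) 0 (map Z [1..<Suc ?n])" unfolding null_dependent_def by blast
    let ?Xs = "map Z [1..<Suc ?n]"
    have sub: "?Xs ! j \<subseteq> X" if "j < ?n" for j using nth[OF that] Z(1) that by auto
    have "\<forall>Y\<in>set ?Xs. Y \<subseteq> ?E" using Z(1) X by (auto simp del: upt_Suc)
    then have "(\<Sum>x\<in>?E. scale (weight cs ?Xs x) (vec M x)) = 0"
      using null_rel_iff_weight[OF vs fin, of ?Xs cs] Z(4) by (simp del: upt_Suc)
    then have 0: "(\<Sum>x\<in>X. scale (weight cs ?Xs x) (vec M x)) = 0"
      using sum_X[of ?Xs] sub by metis
    obtain i x where i: "i \<in> {1..<Suc ?n}" "x \<in> Z i" using Z(3) by blast
    then have "x \<in> X" using Z(1) by blast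
    \<comment> \<open>\<open>null_dependent\<close> compares only indices \<open>j < i\<close>, so
      disjointness is first made symmetric.\<close>
    have uniq: "Z i \<inter> Z j = {}" if "i \<in> {1..<Suc ?n}" "j \<in> {1..<Suc ?n}" "i \<noteq> j" for i j
    proof (cases "i < j")
      case True
      then have "i \<in> {1..<j}" using that(1) by simp
      then show ?thesis using Z(2) that(2) by blast
    next
      case False
      then have "j \<in> {1..<i}" using that(2,3) by simp
      then show ?thesis using Z(2) that(1) by blast
    qed
    have "x \<in> ?Xs ! j \<longleftrightarrow> j = i - 1" if j: "j < ?n" for j
    proof -
      have "x \<in> Z (Suc j) \<longleftrightarrow> Suc j = i" using uniq[of "Suc j" i] i j by auto
      then show ?thesis unfolding nth[OF j] using i(1) by auto
    qed
    moreover have i1: "i - 1 < ?n" using i(1) by auto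
    ultimately have "weight cs ?Xs x = cs ! (i - 1)" by (rule weight_disjoint)
    also have "\<dots> \<noteq> 0" using cs(2) nth_mem[OF i1] by auto
    finally have "weight cs ?Xs x \<noteq> 0" .
    then show ?R using 0 \<open>x \<in> X\<close> by blast
  next
    assume ?R
    then obtain u where u: "(\<Sum>x\<in>X. scale (u x) (vec M x)) = 0" "\<exists>x\<in>X. u x \<noteq> 0" by blast
    \<comment> \<open>Level sets of \<open>u\<close>, shifted by one because set variables start at
      1 and list positions at 0.\<close>
    define Z where "Z i = {x \<in> X. u x = cs ! (i - 1)}" for i
    let ?Xs = "map Z [1..<Suc ?n]"
    have ex: "\<exists>i<?n. u x = cs ! i" if "u x \<noteq> 0" for x
      using cs(2) that by (metis DiffI UNIV_I in_set_conv_nth singletonD)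
    have w: "weight cs ?Xs x = u x" if x: "x \<in> X" for x
    proof (cases "u x = 0")
      case True
      have "x \<notin> ?Xs ! j" if j: "j < ?n" for j
        unfolding nth[OF j] using True cs(2) nth_mem[OF j] by (auto simp: Z_def)
      then show ?thesis using True weight_zero by metis
    next
      case False
      then obtain i where i: "i < ?n" "u x = cs ! i" using ex by blast
      have "x \<in> ?Xs ! j \<longleftrightarrow> j = i" if j: "j < ?n" for j
        unfolding nth[OF j] using i x cs(1) j by (auto simp: Z_def nth_eq_iff_index_eq)
      then show ?thesis using weight_disjoint[of cs x ?Xs i] i by simp
    qed
    have sub: "?Xs ! j \<subseteq> X" if "j < ?n" for j unfolding nth[OF that] by (auto simp: Z_def)
    have "(\<Sum>x\<in>?E. scale (weight cs ?Xs x) (vec M x)) = 0"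
      using sum_X[OF sub] u(1) w by (simp del: upt_Suc)
    moreover have "\<forall>Y\<in>set ?Xs. Y \<subseteq> ?E" using X by (auto simp: Z_def simp del: upt_Suc)
    ultimately have "set_rel (null_struct scale cs M) 0 ?Xs"
      using null_rel_iff_weight[OF vs fin, of ?Xs cs] by (simp del: upt_Suc)
    moreover have "\<exists>i\<in>{1..<Suc ?n}. Z i \<noteq> {}"
    proof -
      obtain x where x: "x \<in> X" "u x \<noteq> 0" using u(2) by blast
      then obtain i where "i < ?n" "u x = cs ! i" using ex by blast
      then show ?thesis using x by (intro bexI[of _ "Suc i"]) (auto simp: Z_def)
    qed
    moreover have "Z i \<inter> Z j = {}" if "i \<in> {1..<Suc ?n}" "j \<in> {1..<i}" for i j
      using that cs(1) by (auto simp: Z_def nth_eq_iff_index_eq)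
    moreover have "Z i \<subseteq> X" for i by (auto simp: Z_def)
    ultimately show ?L
      unfolding null_dependent_def by (intro exI[of _ Z] conjI ballI) (simp_all del: upt_Suc)
  qed
  moreover have "set_rel (independent_struct scale M) 0 [X] \<longleftrightarrow> inj_on (vec M) X \<and> independent (vec M ` X)"
    using X by (simp add: independent_struct_def)
  ultimately show ?thesis using independent_family_iff[OF finX, of "vec M"] by blast
qed

lemma struct_over_transduction:
  assumes "mso_transduction V W T" "T A B"
  shows "struct_over W B"
  using assms by (induction arbitrary: A B) auto

definition independence_interpretation :: "nat \<Rightarrow> mso_interpretation" where
  "independence_interpretation n =
     \<lparr>universe_formula = conjs [], elem_formulas = [], set_formulas = [Neg (dependent_formula n)]\<rparr>"

lemma independence_interpretation_from_to:
  "interpretation_from_to (null_vocabulary n) independent_vocabulary (independence_interpretation n)"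
  unfolding interpretation_from_to_def independence_interpretation_def independent_vocabulary_def
    null_vocabulary_def dependent_formula_def
  by (auto simp del: upt_Suc)

text \<open>The transduction produces only an isomorphic copy \<open>B\<close> of the null
  structure. Dependence is transported along \<open>f\<close>, which thereby becomes an isomorphism
  from the independence structure onto the interpretation of \<open>B\<close>.\<close>

lemma independent_mso_width_if_null_mso_width:
  fixes scale :: "'f::{field,finite} \<Rightarrow> 'v::ab_group_add \<Rightarrow> 'v" and \<C> :: "('e, 'v) rep_matroid set"
  assumes vs: "vector_space scale" and cs: "distinct cs" "set cs = UNIV - {0}"
    and rep: "\<forall>M\<in>\<C>. rep_matroid M"
    and null: "bounded_mso_width (null_vocabulary (length cs)) (null_struct scale cs ` \<C>)"
  shows "bounded_mso_width independent_vocabulary (independent_struct scale ` \<C>)"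
proof -
  let ?V = "null_vocabulary (length cs)" and ?W = independent_vocabulary
  let ?I = "independence_interpretation (length cs)"
  obtain T where T: "mso_transduction tree_vocabulary ?V T"
    "\<forall>A\<in>null_struct scale cs ` \<C>. \<exists>t B. is_tree t \<and> T t B \<and> isomorphic A B"
    using null unfolding bounded_mso_width_def by blast
  define T' where "T' A B \<longleftrightarrow> struct_over ?V A \<and> struct_over ?W B \<and>
    isomorphic (interpreted_struct ?W ?I A) B" for A B :: "nat struct"
  have "mso_transduction ?V ?W T'"
    unfolding T'_def by (rule interpreting[OF independence_interpretation_from_to])
  then have comp: "mso_transduction tree_vocabulary ?W (T OO T')"
    by (rule composition[OF T(1)])
  have "\<exists>t B. is_tree t \<and> (T OO T') t B \<and> isomorphic (independent_struct scale M) B" if M: "M \<in> \<C>" for M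
  proof -
    let ?N = "null_struct scale cs M" and ?J = "independent_struct scale M"
    have fin: "finite (elements M)" using rep M by (simp add: rep_matroid_def)
    obtain t B where t: "is_tree t" "T t B" "isomorphic ?N B" using T(2) M by blast
    then obtain f where f: "isomorphism f ?N B" unfolding isomorphic_def by blast
    note F = isomorphismD[OF f] and G = isomorphism_inv[OF f]
    let ?B = "interpreted_struct ?W ?I B"
    have UN: "universe ?N = elements M" by (simp add: null_struct_def)
    have U: "universe ?B = universe B"
      by (auto simp: interpreted_struct_def interpreted_universe_def independence_interpretation_def)
    have B_over: "struct_over ?V B" using struct_over_transduction[OF T(1) t(2)] .
    have dep: "null_dependent (length cs) ?N X \<longleftrightarrow> null_dependent (length cs) B (f ` X)"
      if X: "X \<subseteq> elements M" for X
    proof -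
      have "inv_into (universe ?N) f ` f ` X = X"
        using inv_into_image_cancel[OF F(1)] X UN by simp
      moreover have "f ` X \<subseteq> universe B" using X F(2) UN by auto
      ultimately show ?thesis
        using null_dependent_iso[OF f, of X] null_dependent_iso[OF G, of "f ` X"] X UN by auto
    qed
    have rel: "set_rel ?J R Xs \<longleftrightarrow> set_rel ?B R (map ((`) f) Xs)"
      if Xs: "\<forall>X\<in>set Xs. X \<subseteq> elements M" for R Xs
    proof (cases "R = 0 \<and> length Xs = 1")
      case True
      then obtain X where X: "R = 0" "Xs = [X]" by (auto simp: length_Suc_conv)
      have fX: "f ` X \<subseteq> universe B" using Xs X(2) F(2) UN by auto
      have "set_rel ?B R (map ((`) f) Xs) \<longleftrightarrow>
          \<not> sat B (\<lambda>_. undefined) (\<lambda>i. [f ` X] ! i) (dependent_formula (length cs))"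
        using X fX U by (simp add: interpreted_struct_def independent_vocabulary_def independence_interpretation_def)
      also have "\<dots> \<longleftrightarrow> \<not> null_dependent (length cs) B (f ` X)"
        using fX by (subst sat_dependent_formula) auto
      also have "\<dots> \<longleftrightarrow> set_rel ?J R Xs"
        using null_dependent_iff[OF vs cs fin, of X] dep[of X] Xs X by simp
      finally show ?thesis by simp
    next
      case False
      then show ?thesis
        by (auto simp: independent_struct_def interpreted_struct_def independent_vocabulary_def)
    qed
    have "isomorphism f ?J ?B"
      unfolding isomorphism_def
    proof (intro conjI allI impI)
      show "bij_betw f (universe ?J) (universe ?B)"
        using f U UN by (simp add: isomorphism_def independent_struct_def)
      show "elem_rel ?J R xs = elem_rel ?B R (map f xs)" for R xs
        by (simp add: independent_struct_def interpreted_struct_def independent_vocabulary_def)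
    qed (use rel in \<open>simp add: independent_struct_def\<close>)
    moreover have "struct_over ?W ?B"
      using B_over U by (auto simp: struct_over_def interpreted_struct_def)
    ultimately show ?thesis
      using t(1,2) B_over isomorphic_refl unfolding T'_def isomorphic_def by blast
  qed
  then show ?thesis unfolding bounded_mso_width_def using comp by blast
qed

section \<open>Runs on branch decompositions\<close>

text \<open>Positions are read from the bottom upwards, so that the children of \<open>p\<close> are
  \<open>False # p\<close> and \<open>True # p\<close>.\<close>

primrec subtree_at :: "'e btree \<Rightarrow> bool list \<Rightarrow> 'e btree option" where
  "subtree_at t [] = Some t"
| "subtree_at t (b # p) =
     (case subtree_at t p of Some (Node l r) \<Rightarrow> Some (if b then r else l) | _ \<Rightarrow> None)"

definition positions :: "'e btree \<Rightarrow> bool list set" where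
  "positions t = {p. subtree_at t p \<noteq> None}"

lemma subtree_at_Cons_Some:
  assumes "subtree_at t (b # p) = Some u"
  obtains l r where "subtree_at t p = Some (Node l r)" "u = (if b then r else l)"
  using assms by (auto split: option.splits btree.splits)

lemma positions_Cons: "b # p \<in> positions t \<longleftrightarrow> (\<exists>l r. subtree_at t p = Some (Node l r))"
  by (auto simp: positions_def split: option.splits btree.splits)

lemma positions_tl: "b # p \<in> positions t \<Longrightarrow> p \<in> positions t"
  by (auto simp: positions_Cons) (simp add: positions_def)

lemma subtree_at_size: "subtree_at t p = Some u \<Longrightarrow> length p + size u \<le> size t"
proof (induction p arbitrary: u)
  case (Cons b p)
  from Cons.prems obtain l r where lr: "subtree_at t p = Some (Node l r)" "u = (if b then r else l)"
    by (rule subtree_at_Cons_Some)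
  have "size u < size (Node l r)" using lr(2) by auto
  then show ?case using Cons.IH[OF lr(1)] by simp
qed simp

lemma finite_positions: "finite (positions t)"
proof (rule finite_subset)
  show "positions t \<subseteq> {p. set p \<subseteq> UNIV \<and> length p \<le> size t}"
    using subtree_at_size[of t] by (fastforce simp: positions_def)
  show "finite {p :: bool list. set p \<subseteq> UNIV \<and> length p \<le> size t}"
    by (intro finite_lists_length_le) simp
qed

lemma subtree_at_leaves:
  assumes "subtree_at t p = Some u"
  shows "edge_sets u \<subseteq> edge_sets t \<and> (p \<noteq> [] \<longrightarrow> set (leaves u) \<in> edge_sets t) \<and>
    set (leaves u) \<subseteq> set (leaves t) \<and> (distinct (leaves t) \<longrightarrow> distinct (leaves u))"
  using assms
proof (induction p arbitrary: u)
  case (Cons b p)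
  from Cons.prems obtain l r where lr: "subtree_at t p = Some (Node l r)" "u = (if b then r else l)"
    by (rule subtree_at_Cons_Some)
  show ?case using Cons.IH[OF lr(1)] lr(2) by auto
qed simp

lemma subtree_at_append:
  "subtree_at (Node l r) (p @ [b]) = subtree_at (if b then r else l) p"
  by (induction p) auto

lemma leaf_position: "x \<in> set (leaves t) \<Longrightarrow> \<exists>p. subtree_at t p = Some (Leaf x)"
proof (induction t)
  case (Leaf y)
  then show ?case by (intro exI[of _ "[]"]) simp
next
  case (Node l r)
  then obtain p b where "subtree_at (if b then r else l) p = Some (Leaf x)"
    by (metis (full_types) Un_iff leaves.simps(2) set_append)
  then show ?case using subtree_at_append by metis
qed

lemma leaf_position_unique:
  assumes "distinct (leaves t)" "subtree_at t p = Some (Leaf x)" "subtree_at t q = Some (Leaf x)"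
  shows "p = q"
  using assms
proof (induction t arbitrary: p q)
  case (Leaf y)
  have "p = []" if "subtree_at (Leaf y) p = Some u" for p and u :: "'a btree"
    using subtree_at_size[OF that] by (cases u) auto
  then show ?case using Leaf.prems by blast
next
  case (Node l r)
  obtain p' b where p: "p = p' @ [b]" using Node.prems(2) by (cases p rule: rev_cases) auto
  obtain q' c where q: "q = q' @ [c]" using Node.prems(3) by (cases q rule: rev_cases) auto
  have p': "subtree_at (if b then r else l) p' = Some (Leaf x)"
    using Node.prems(2) unfolding p subtree_at_append .
  have q': "subtree_at (if c then r else l) q' = Some (Leaf x)"
    using Node.prems(3) unfolding q subtree_at_append .
  have "x \<in> set (leaves (if b then r else l))" "x \<in> set (leaves (if c then r else l))"
    using subtree_at_leaves[OF p'] subtree_at_leaves[OF q'] by auto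
  then have "b = c" using Node.prems(1) by (auto split: if_splits)
  then show ?case
    using Node.IH(1)[of p' q'] Node.IH(2)[of p' q'] p' q' Node.prems(1) p q by (cases c) auto
qed

text \<open>A basis \<open>B0\<close> of the intersection extends to bases \<open>B1\<close> and
  \<open>B2\<close> of both spans. It lies in \<open>B1 \<inter> B2\<close>, and inclusion-exclusion
  bounds this set by \<open>k\<close> because \<open>B1 \<union> B2\<close> spans the sum. A vector
  of the intersection is then given by at most \<open>k\<close> coordinates.\<close>

lemma card_span_Int_le:
  fixes scale :: "'f::{field,finite} \<Rightarrow> 'v::ab_group_add \<Rightarrow> 'v"
  assumes "vector_space scale" "finite S" "finite T"
    and k: "vector_space.dim scale S + vector_space.dim scale T \<le> k + vector_space.dim scale (S \<union> T)"
  shows "finite (module.span scale S \<inter> module.span scale T) \<and>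
    card (module.span scale S \<inter> module.span scale T) \<le> CARD('f) ^ k"
proof -
  interpret vector_space scale by (fact assms(1))
  let ?V = "span S \<inter> span T"
  obtain B0 where B0: "B0 \<subseteq> ?V" "independent B0" "?V \<subseteq> span B0"
    using maximal_independent_subset by blast
  have ext: "\<exists>B. B0 \<subseteq> B \<and> B \<subseteq> span R \<and> finite B \<and> card B = dim R \<and> R \<subseteq> span B"
    if R: "finite R" "B0 \<subseteq> span R" for R
  proof -
    obtain B where B: "B0 \<subseteq> B" "B \<subseteq> span R" "independent B" "span R \<subseteq> span B"
      using maximal_independent_subset_extend[OF R(2) B0(2)] by blast
    have "finite B" using independent_span_bound[OF R(1) B(3,2)] by blast
    moreover have "card B = dim R" using basis_card_eq_dim[OF B(2,4,3)] by simp
    moreover have "R \<subseteq> span B" using B(4) span_superset by blast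
    ultimately show ?thesis using B by blast
  qed
  obtain B1 where B1: "B0 \<subseteq> B1" "finite B1" "card B1 = dim S" "S \<subseteq> span B1"
    using ext[OF assms(2)] B0(1) by blast
  obtain B2 where B2: "B0 \<subseteq> B2" "finite B2" "card B2 = dim T" "T \<subseteq> span B2"
    using ext[OF assms(3)] B0(1) by blast
  have "S \<union> T \<subseteq> span (B1 \<union> B2)"
    using B1(4) B2(4) span_mono[of B1 "B1 \<union> B2"] span_mono[of B2 "B1 \<union> B2"] by blast
  then have "dim (S \<union> T) \<le> card (B1 \<union> B2)" using B1(2) B2(2) by (intro dim_le_card) auto
  moreover have "card B0 \<le> card (B1 \<inter> B2)" using B1 B2 by (intro card_mono) auto
  moreover have "card B1 + card B2 = card (B1 \<union> B2) + card (B1 \<inter> B2)"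
    using B1(2) B2(2) by (rule card_Un_Int)
  ultimately have card_B0: "card B0 \<le> k" using B1(3) B2(3) k by linarith
  have finB0: "finite B0" using B1(1,2) finite_subset by blast
  have "span B0 \<subseteq> (\<lambda>u. \<Sum>b\<in>B0. scale (u b) b) ` (B0 \<rightarrow>\<^sub>E (UNIV :: 'f set))"
  proof
    fix x assume "x \<in> span B0"
    then obtain u where "x = (\<Sum>b\<in>B0. scale (u b) b)" using span_finite[OF finB0] by auto
    then have "x = (\<Sum>b\<in>B0. scale (restrict u B0 b) b)" by simp
    moreover have "restrict u B0 \<in> B0 \<rightarrow>\<^sub>E (UNIV :: 'f set)" by simp
    ultimately show "x \<in> (\<lambda>u. \<Sum>b\<in>B0. scale (u b) b) ` (B0 \<rightarrow>\<^sub>E (UNIV :: 'f set))"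
      by (rule image_eqI)
  qed
  then have sub: "?V \<subseteq> (\<lambda>u. \<Sum>b\<in>B0. scale (u b) b) ` (B0 \<rightarrow>\<^sub>E (UNIV :: 'f set))" using B0(3) by blast
  have fin: "finite (B0 \<rightarrow>\<^sub>E (UNIV :: 'f set))" using finB0 by (intro finite_PiE) auto
  have "card ?V \<le> card (B0 \<rightarrow>\<^sub>E (UNIV :: 'f set))"
    using card_mono[OF finite_imageI[OF fin] sub] card_image_le[OF fin] le_trans by blast
  also have "\<dots> = CARD('f) ^ card B0" using finB0 by (simp add: card_PiE)
  also have "\<dots> \<le> CARD('f) ^ k" using card_B0 by (intro power_increasing) (auto simp: Suc_le_eq)
  finally show ?thesis using finite_subset[OF sub finite_imageI[OF fin]] by blast
qed

text \<open>\<open>enc\<close> numbers the vectors common to both sides of a cut by naturals below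
  \<open>m\<close>, separately for each cut; the tables defined below relate the numberings.
  Position \<open>[]\<close> is included, where the intersection is the zero space.\<close>

locale decomposed_matroid = vector_space scale
  for scale :: "'f::field \<Rightarrow> 'v::ab_group_add \<Rightarrow> 'v" +
  fixes cs :: "'f list" and M :: "('e, 'v) rep_matroid" and t :: "'e btree"
    and m :: nat and enc :: "'e set \<Rightarrow> 'v \<Rightarrow> nat"
  assumes decomposition: "branch_decomposition M t"
    and enc: "\<And>p u. subtree_at t p = Some u \<Longrightarrow>
      inj_on (enc (set (leaves u)))
        (span (vec M ` set (leaves u)) \<inter> span (vec M ` (elements M - set (leaves u)))) \<and>
      enc (set (leaves u)) `
        (span (vec M ` set (leaves u)) \<inter> span (vec M ` (elements M - set (leaves u)))) \<subseteq> {..<m}"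
begin

text \<open>If the whole sum is zero, the partial sum over \<open>Y\<close> lies here, because the
  far side has to cancel it.\<close>

definition boundary :: "'e set \<Rightarrow> 'v set" where
  "boundary Y = span (vec M ` Y) \<inter> span (vec M ` (elements M - Y))"

text \<open>A partial operation: a sum outside the boundary space cannot be cancelled by the far
  side and has no entry.\<close>

definition node_table :: "'e set \<Rightarrow> 'e set \<Rightarrow> (nat \<times> nat \<times> nat) set" where
  "node_table Y Z = {(enc Y a, enc Z b, enc (Y \<union> Z) (a + b)) | a b.
     a \<in> boundary Y \<and> b \<in> boundary Z \<and> a + b \<in> boundary (Y \<union> Z)}"

text \<open>\<open>I\<close> stands for the set of argument positions whose set contains
  \<open>x\<close>; there may be several.\<close>

definition leaf_table :: "'e \<Rightarrow> (nat set \<times> nat) set" where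
  "leaf_table x = {(I, enc {x} (scale (\<Sum>i\<in>I. cs ! i) (vec M x))) | I.
     I \<subseteq> {..<length cs} \<and> scale (\<Sum>i\<in>I. cs ! i) (vec M x) \<in> boundary {x}}"

text \<open>\<open>Z l\<close> is the set of positions with label \<open>l\<close>. Every position
  must have some label and every combination of labels must respect the tables; uniqueness of labels
  below \<open>m\<close> then follows.\<close>

definition is_run :: "'e set list \<Rightarrow> (nat \<Rightarrow> bool list set) \<Rightarrow> bool" where
  "is_run Xs Z \<longleftrightarrow>
     (\<forall>p\<in>positions t. \<exists>l<m. p \<in> Z l) \<and>
     (\<forall>p u w i j l. subtree_at t p = Some (Node u w) \<longrightarrow> i < m \<longrightarrow> j < m \<longrightarrow> l < m \<longrightarrow>
        False # p \<in> Z i \<longrightarrow> True # p \<in> Z j \<longrightarrow> p \<in> Z l \<longrightarrow>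
        (i, j, l) \<in> node_table (set (leaves u)) (set (leaves w))) \<and>
     (\<forall>p x l. subtree_at t p = Some (Leaf x) \<longrightarrow> l < m \<longrightarrow> p \<in> Z l \<longrightarrow>
        ({i. i < length cs \<and> x \<in> Xs ! i}, l) \<in> leaf_table x)"

definition partial_sum :: "'e set list \<Rightarrow> 'e set \<Rightarrow> 'v" where
  "partial_sum Xs Y = (\<Sum>x\<in>Y. scale (weight cs Xs x) (vec M x))"

lemma elements_eq: "set (leaves t) = elements M"
  using decomposition by (simp add: branch_decomposition_def)

lemma finite_elements: "finite (elements M)"
  unfolding elements_eq[symmetric] by simp

lemma enc_boundary:
  assumes "subtree_at t p = Some u"
  shows "inj_on (enc (set (leaves u))) (boundary (set (leaves u)))"
    "a \<in> boundary (set (leaves u)) \<Longrightarrow> enc (set (leaves u)) a < m"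
  using enc[OF assms] unfolding boundary_def by auto

lemma partial_sum_in_span: "partial_sum Xs Y \<in> span (vec M ` Y)"
  unfolding partial_sum_def by (intro span_sum span_scale span_base) auto

lemma weight_eq: "weight cs Xs x = (\<Sum>i\<in>{i. i < length cs \<and> x \<in> Xs ! i}. cs ! i)"
  unfolding weight_def using sum.inter_filter[of "{..<length cs}" "\<lambda>i. cs ! i" "\<lambda>i. x \<in> Xs ! i"] by simp

lemma subtree_leaves_Node:
  assumes "subtree_at t p = Some (Node u w)"
  shows "subtree_at t (False # p) = Some u" "subtree_at t (True # p) = Some w"
    "set (leaves u) \<inter> set (leaves w) = {}"
  using assms subtree_at_leaves[OF assms] decomposition by (auto simp: branch_decomposition_def)

text \<open>Induction from the leaves: \<open>enc\<close> is injective on boundary spaces, so the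
  labels of the children give back their partial sums, and the table adds these.\<close>

lemma run_determined:
  assumes run: "is_run Xs Z"
  shows "subtree_at t p = Some u \<Longrightarrow> l < m \<Longrightarrow> p \<in> Z l \<Longrightarrow>
    partial_sum Xs (set (leaves u)) \<in> boundary (set (leaves u)) \<and>
    enc (set (leaves u)) (partial_sum Xs (set (leaves u))) = l"
proof (induction u arbitrary: p l)
  case (Leaf x)
  then have "({i. i < length cs \<and> x \<in> Xs ! i}, l) \<in> leaf_table x"
    using run unfolding is_run_def by blast
  then show ?case by (auto simp: leaf_table_def partial_sum_def weight_eq)
next
  case (Node u w)
  let ?U = "set (leaves u)" and ?W = "set (leaves w)"
  note sub = subtree_leaves_Node[OF Node.prems(1)]
  have "False # p \<in> positions t" "True # p \<in> positions t"
    using sub by (simp_all add: positions_def)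
  then obtain i j where ij: "i < m" "False # p \<in> Z i" "j < m" "True # p \<in> Z j"
    using run unfolding is_run_def by meson
  have "(i, j, l) \<in> node_table ?U ?W"
    using run Node.prems ij unfolding is_run_def by blast
  then obtain a b where ab: "a \<in> boundary ?U" "b \<in> boundary ?W" "a + b \<in> boundary (?U \<union> ?W)"
    "i = enc ?U a" "j = enc ?W b" "l = enc (?U \<union> ?W) (a + b)"
    unfolding node_table_def by blast
  have "partial_sum Xs ?U = a"
    using Node.IH(1)[OF sub(1) ij(1,2)] ab(1,4) enc_boundary(1)[OF sub(1)] by (auto dest: inj_onD)
  moreover have "partial_sum Xs ?W = b"
    using Node.IH(2)[OF sub(2) ij(3,4)] ab(2,5) enc_boundary(1)[OF sub(2)] by (auto dest: inj_onD)
  ultimately have "partial_sum Xs (?U \<union> ?W) = a + b"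
    using sub(3) by (simp add: partial_sum_def sum.union_disjoint)
  then show ?case using ab(3,6) by simp
qed

lemma run_iff: "(\<exists>Z. is_run Xs Z) \<longleftrightarrow> partial_sum Xs (elements M) = 0"
proof
  assume "\<exists>Z. is_run Xs Z"
  then obtain Z where Z: "is_run Xs Z" by blast
  have "[] \<in> positions t" by (simp add: positions_def)
  then obtain l where "l < m" "[] \<in> Z l" using Z unfolding is_run_def by blast
  \<comment> \<open>The far side of the root is empty, so the boundary space there is zero.\<close>
  then have "partial_sum Xs (elements M) \<in> boundary (elements M)"
    using run_determined[OF Z, of "[]" t] elements_eq by simp
  then show "partial_sum Xs (elements M) = 0" by (simp add: boundary_def)
next
  assume zero: "partial_sum Xs (elements M) = 0"
  \<comment> \<open>The complement of \<open>Y\<close> has the opposite partial sum, so the vector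
    lies in both spans.\<close>
  have boundary: "partial_sum Xs Y \<in> boundary Y" if "Y \<subseteq> elements M" for Y
  proof -
    have "partial_sum Xs (elements M) = partial_sum Xs (elements M - Y) + partial_sum Xs Y"
      unfolding partial_sum_def by (rule sum.subset_diff[OF that finite_elements])
    then have "partial_sum Xs Y = - partial_sum Xs (elements M - Y)"
      using zero by (simp add: eq_neg_iff_add_eq_0 add.commute)
    then show ?thesis
      unfolding boundary_def using partial_sum_in_span[of Xs Y] partial_sum_in_span[of Xs "elements M - Y"]
      by (simp add: span_neg)
  qed
  define Z where "Z l = {p. \<exists>u. subtree_at t p = Some u \<and>
      enc (set (leaves u)) (partial_sum Xs (set (leaves u))) = l}" for l
  have sub: "set (leaves u) \<subseteq> elements M" if "subtree_at t p = Some u" for p u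
    using subtree_at_leaves[OF that] elements_eq by simp
  have "is_run Xs Z"
    unfolding is_run_def
  proof (intro conjI allI impI ballI)
    fix p assume "p \<in> positions t"
    then obtain u where u: "subtree_at t p = Some u" by (auto simp: positions_def)
    show "\<exists>l<m. p \<in> Z l"
      using enc_boundary(2)[OF u boundary[OF sub[OF u]]] u by (auto simp: Z_def)
  next
    fix p u w i j l
    assume p: "subtree_at t p = Some (Node u w)" and Z: "False # p \<in> Z i" "True # p \<in> Z j" "p \<in> Z l"
    let ?U = "set (leaves u)" and ?W = "set (leaves w)"
    note s = subtree_leaves_Node[OF p]
    have "i = enc ?U (partial_sum Xs ?U)" "j = enc ?W (partial_sum Xs ?W)"
      "l = enc (?U \<union> ?W) (partial_sum Xs (?U \<union> ?W))"
      using Z p s by (auto simp: Z_def)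
    moreover have "partial_sum Xs (?U \<union> ?W) = partial_sum Xs ?U + partial_sum Xs ?W"
      using s(3) by (simp add: partial_sum_def sum.union_disjoint)
    moreover have "partial_sum Xs ?U \<in> boundary ?U" "partial_sum Xs ?W \<in> boundary ?W"
      "partial_sum Xs (?U \<union> ?W) \<in> boundary (?U \<union> ?W)"
      using boundary sub[OF s(1)] sub[OF s(2)] by auto
    ultimately show "(i, j, l) \<in> node_table ?U ?W" unfolding node_table_def by force
  next
    fix p x l
    assume p: "subtree_at t p = Some (Leaf x)" and "p \<in> Z l"
    then have "l = enc {x} (partial_sum Xs {x})" by (auto simp: Z_def)
    moreover have "partial_sum Xs {x} \<in> boundary {x}" using boundary sub[OF p] by simp
    ultimately show "({i. i < length cs \<and> x \<in> Xs ! i}, l) \<in> leaf_table x"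
      by (auto simp: leaf_table_def partial_sum_def weight_eq)
  qed
  then show "\<exists>Z. is_run Xs Z" by blast
qed

text \<open>The bounding sets depend only on \<open>m\<close> and the number of scalars, so finitely
  many colours serve all matroids of a class.\<close>

lemma tables_bounded:
  assumes "subtree_at t p = Some u"
  shows "u = Node v w \<Longrightarrow> node_table (set (leaves v)) (set (leaves w)) \<subseteq> {..<m} \<times> {..<m} \<times> {..<m}"
    and "u = Leaf x \<Longrightarrow> leaf_table x \<subseteq> Pow {..<length cs} \<times> {..<m}"
proof -
  assume u: "u = Node v w"
  note s = subtree_leaves_Node[OF assms[unfolded u]]
  show "node_table (set (leaves v)) (set (leaves w)) \<subseteq> {..<m} \<times> {..<m} \<times> {..<m}"
    using enc_boundary(2)[OF s(1)] enc_boundary(2)[OF s(2)] enc_boundary(2)[OF assms] u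
    by (auto simp: node_table_def)
next
  assume u: "u = Leaf x"
  then show "leaf_table x \<subseteq> Pow {..<length cs} \<times> {..<m}"
    using enc_boundary(2)[OF assms] by (auto simp: leaf_table_def)
qed

end

section \<open>The run formula\<close>

text \<open>Relation 0 is the parent relation, so colour \<open>c\<close> is relation
  \<open>Suc c\<close>. The functions \<open>sd\<close>, \<open>\<Delta>\<close> and
  \<open>\<Lambda>\<close> decode a colour into a side, a node table and a leaf table.\<close>

definition side_formula :: "nat \<Rightarrow> (nat \<Rightarrow> bool) \<Rightarrow> bool \<Rightarrow> nat \<Rightarrow> mso" where
  "side_formula K sd b x = disjs (map (\<lambda>c. Elem_Rel (Suc c) [x]) (filter (\<lambda>c. sd c = b) [0..<K]))"

text \<open>Element variables 0, 1, 2 are a node, its left child and its right child. Set variable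
  \<open>n + i\<close> holds the nodes with label \<open>i\<close>; those below \<open>n\<close> are
  the arguments of the null relation.\<close>

definition node_formula ::
  "nat \<Rightarrow> nat \<Rightarrow> (nat \<Rightarrow> bool) \<Rightarrow> (nat \<Rightarrow> (nat \<times> nat \<times> nat) set) \<Rightarrow> nat \<Rightarrow> nat \<Rightarrow> nat \<Rightarrow> mso" where
  "node_formula n K sd \<Delta> i j l = all_elem 0 (all_elem 1 (all_elem 2 (imp
     (conjs [Elem_Rel 0 [0, 1], Elem_Rel 0 [0, 2], Mem 1 (n + i), Mem 2 (n + j), Mem 0 (n + l),
        side_formula K sd False 1, side_formula K sd True 2])
     (disjs (map (\<lambda>c. Elem_Rel (Suc c) [0]) (filter (\<lambda>c. (i, j, l) \<in> \<Delta> c) [0..<K]))))))"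

definition is_leaf :: mso where
  "is_leaf = Neg (Ex_Elem 1 (Elem_Rel 0 [0, 1]))"

definition literal :: "nat list \<Rightarrow> nat \<Rightarrow> mso" where
  "literal I i = (if i \<in> set I then Mem 0 i else Neg (Mem 0 i))"

definition leaf_formula :: "nat \<Rightarrow> nat \<Rightarrow> (nat \<Rightarrow> (nat set \<times> nat) set) \<Rightarrow> nat \<Rightarrow> mso" where
  "leaf_formula n K \<Lambda> l = all_elem 0 (imp (Conj is_leaf (Mem 0 (n + l)))
     (disjs (map (\<lambda>c. Conj (Elem_Rel (Suc c) [0])
        (disjs (map (\<lambda>I. conjs (map (literal I) [0..<n]))
           (filter (\<lambda>I. (set I, l) \<in> \<Lambda> c) (subseqs [0..<n]))))) [0..<K])))"

definition run_formula ::
  "nat \<Rightarrow> nat \<Rightarrow> nat \<Rightarrow> (nat \<Rightarrow> bool) \<Rightarrow> (nat \<Rightarrow> (nat \<times> nat \<times> nat) set) \<Rightarrow> (nat \<Rightarrow> (nat set \<times> nat) set) \<Rightarrow> mso" where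
  "run_formula n m K sd \<Delta> \<Lambda> = ex_sets [n..<n + m] (conjs (
     all_elem 0 (disjs (map (\<lambda>l. Mem 0 (n + l)) [0..<m]))
     # map (\<lambda>(i, j, l). node_formula n K sd \<Delta> i j l) (List.product [0..<m] (List.product [0..<m] [0..<m]))
     @ map (leaf_formula n K \<Lambda>) [0..<m]))"

section \<open>Semantics of the run formula\<close>

lemma sat_side_formula:
  "sat A e s (side_formula K sd b x) \<longleftrightarrow> (\<exists>c<K. sd c = b \<and> elem_rel A (Suc c) [e x])"
  by (auto simp: side_formula_def)

lemma sat_node_formula:
  "sat A e s (node_formula n K sd \<Delta> i j l) \<longleftrightarrow>
    (\<forall>a\<in>universe A. \<forall>b\<in>universe A. \<forall>b'\<in>universe A.
      elem_rel A 0 [a, b] \<and> elem_rel A 0 [a, b'] \<and> b \<in> s (n + i) \<and> b' \<in> s (n + j) \<and> a \<in> s (n + l) \<and>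
      (\<exists>c<K. sd c = False \<and> elem_rel A (Suc c) [b]) \<and> (\<exists>c<K. sd c = True \<and> elem_rel A (Suc c) [b']) \<longrightarrow>
      (\<exists>c<K. (i, j, l) \<in> \<Delta> c \<and> elem_rel A (Suc c) [a]))"
proof -
  have "(\<exists>\<phi>\<in>set (map (\<lambda>c. Elem_Rel (Suc c) [0]) (filter (\<lambda>c. (i, j, l) \<in> \<Delta> c) [0..<K])). sat A e' s \<phi>)
      \<longleftrightarrow> (\<exists>c<K. (i, j, l) \<in> \<Delta> c \<and> elem_rel A (Suc c) [e' 0])" for e'
    by auto
  then show ?thesis
    unfolding node_formula_def sat_all_elem sat_imp sat_conjs sat_disjs
    by (simp add: sat_side_formula)
qed

text \<open>Exactly one subset of the indices agrees with \<open>Q\<close>, so the search through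
  all of them evaluates \<open>P\<close> there.\<close>

lemma ex_subseqs_iff:
  "(\<exists>I\<in>set (subseqs [0..<n]). P (set I) \<and> (\<forall>i<n. Q i \<longleftrightarrow> i \<in> set I)) \<longleftrightarrow> P {i. i < n \<and> Q i}"
proof -
  have "(\<exists>I\<in>set (subseqs [0..<n]). P (set I) \<and> (\<forall>i<n. Q i \<longleftrightarrow> i \<in> set I)) \<longleftrightarrow>
      (\<exists>I\<in>set ` set (subseqs [0..<n]). P I \<and> (\<forall>i<n. Q i \<longleftrightarrow> i \<in> I))"
    by simp
  also have "\<dots> \<longleftrightarrow> (\<exists>I\<subseteq>{..<n}. P I \<and> (\<forall>i<n. Q i \<longleftrightarrow> i \<in> I))"
    unfolding subseqs_powset by (auto simp: atLeast0LessThan)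
  also have "\<dots> \<longleftrightarrow> P {i. i < n \<and> Q i}"
  proof
    assume "\<exists>I\<subseteq>{..<n}. P I \<and> (\<forall>i<n. Q i \<longleftrightarrow> i \<in> I)"
    then obtain I where I: "I \<subseteq> {..<n}" "P I" "\<forall>i<n. Q i \<longleftrightarrow> i \<in> I" by blast
    then have "I = {i. i < n \<and> Q i}" by auto
    then show "P {i. i < n \<and> Q i}" using I(2) by simp
  next
    assume "P {i. i < n \<and> Q i}"
    then show "\<exists>I\<subseteq>{..<n}. P I \<and> (\<forall>i<n. Q i \<longleftrightarrow> i \<in> I)"
      by (intro exI[of _ "{i. i < n \<and> Q i}"]) auto
  qed
  finally show ?thesis .
qed

lemma sat_leaf_formula:
  "sat A e s (leaf_formula n K \<Lambda> l) \<longleftrightarrow>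
    (\<forall>a\<in>universe A. (\<forall>b\<in>universe A. \<not> elem_rel A 0 [a, b]) \<and> a \<in> s (n + l) \<longrightarrow>
      (\<exists>c<K. ({i. i < n \<and> a \<in> s i}, l) \<in> \<Lambda> c \<and> elem_rel A (Suc c) [a]))"
proof -
  have member: "sat A e' s (literal I i) \<longleftrightarrow> (e' 0 \<in> s i \<longleftrightarrow> i \<in> set I)" for e' i I
    by (simp add: literal_def)
  have literals: "sat A e' s (conjs (map (literal I) [0..<n])) \<longleftrightarrow> (\<forall>i<n. e' 0 \<in> s i \<longleftrightarrow> i \<in> set I)" for e' I
    by (auto simp: member)
  have "(\<exists>I\<in>set (subseqs [0..<n]). (set I, l) \<in> \<Lambda> c \<and> (\<forall>i<n. a \<in> s i \<longleftrightarrow> i \<in> set I)) \<longleftrightarrow>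
      ({i. i < n \<and> a \<in> s i}, l) \<in> \<Lambda> c" for a c
    using ex_subseqs_iff[of n "\<lambda>I. (I, l) \<in> \<Lambda> c" "\<lambda>i. a \<in> s i"] .
  note subseqs = this
  define D where "D c = disjs (map (\<lambda>I. conjs (map (literal I) [0..<n]))
     (filter (\<lambda>I. (set I, l) \<in> \<Lambda> c) (subseqs [0..<n])))" for c
  have D: "sat A e' s (D c) \<longleftrightarrow> ({i. i < n \<and> e' 0 \<in> s i}, l) \<in> \<Lambda> c" for e' c
    unfolding D_def using subseqs by (simp add: literals Bex_def conj_assoc del: sat_conjs)
  have "sat A e' s (disjs (map (\<lambda>c. Conj (Elem_Rel (Suc c) [0]) (D c)) [0..<K])) \<longleftrightarrow>
      (\<exists>c<K. ({i. i < n \<and> e' 0 \<in> s i}, l) \<in> \<Lambda> c \<and> elem_rel A (Suc c) [e' 0])" for e'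
    by (auto simp: D)
  then show ?thesis
    unfolding leaf_formula_def is_leaf_def D_def[symmetric] by (simp del: sat_disjs)
qed

text \<open>Separates the labels \<open>Z\<close> from the arguments \<open>s\<close>, which share
  one family of set variables in the formula.\<close>

definition accepts ::
  "nat \<Rightarrow> nat \<Rightarrow> nat \<Rightarrow> (nat \<Rightarrow> bool) \<Rightarrow> (nat \<Rightarrow> (nat \<times> nat \<times> nat) set) \<Rightarrow> (nat \<Rightarrow> (nat set \<times> nat) set) \<Rightarrow>
    'a struct \<Rightarrow> (nat \<Rightarrow> 'a set) \<Rightarrow> (nat \<Rightarrow> 'a set) \<Rightarrow> bool" where
  "accepts n m K sd \<Delta> \<Lambda> A s Z \<longleftrightarrow>
     (\<forall>a\<in>universe A. \<exists>l<m. a \<in> Z l) \<and>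
     (\<forall>i<m. \<forall>j<m. \<forall>l<m. \<forall>a\<in>universe A. \<forall>b\<in>universe A. \<forall>b'\<in>universe A.
      elem_rel A 0 [a, b] \<and> elem_rel A 0 [a, b'] \<and> b \<in> Z i \<and> b' \<in> Z j \<and> a \<in> Z l \<and>
      (\<exists>c<K. sd c = False \<and> elem_rel A (Suc c) [b]) \<and> (\<exists>c<K. sd c = True \<and> elem_rel A (Suc c) [b']) \<longrightarrow>
      (\<exists>c<K. (i, j, l) \<in> \<Delta> c \<and> elem_rel A (Suc c) [a])) \<and>
     (\<forall>l<m. \<forall>a\<in>universe A. (\<forall>b\<in>universe A. \<not> elem_rel A 0 [a, b]) \<and> a \<in> Z l \<longrightarrow>
      (\<exists>c<K. ({i. i < n \<and> a \<in> s i}, l) \<in> \<Lambda> c \<and> elem_rel A (Suc c) [a]))"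

lemma sat_run_formula:
  "sat A e s (run_formula n m K sd \<Delta> \<Lambda>) \<longleftrightarrow>
    (\<exists>Z. (\<forall>l<m. Z l \<subseteq> universe A) \<and> accepts n m K sd \<Delta> \<Lambda> A s Z)"
proof -
  have body: "sat A e s (conjs (
     all_elem 0 (disjs (map (\<lambda>l. Mem 0 (n + l)) [0..<m]))
     # map (\<lambda>(i, j, l). node_formula n K sd \<Delta> i j l) (List.product [0..<m] (List.product [0..<m] [0..<m]))
     @ map (leaf_formula n K \<Lambda>) [0..<m])) \<longleftrightarrow> accepts n m K sd \<Delta> \<Lambda> A s (\<lambda>l. s (n + l))" for s
  proof -
    have 1: "sat A e s (all_elem 0 (disjs (map (\<lambda>l. Mem 0 (n + l)) [0..<m]))) \<longleftrightarrow>
        (\<forall>a\<in>universe A. \<exists>l<m. a \<in> s (n + l))"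
      by (auto simp: Bex_def)
    have 2: "(\<forall>\<phi>\<in>set (map (\<lambda>(i, j, l). node_formula n K sd \<Delta> i j l)
        (List.product [0..<m] (List.product [0..<m] [0..<m]))). sat A e s \<phi>) \<longleftrightarrow>
        (\<forall>i<m. \<forall>j<m. \<forall>l<m. sat A e s (node_formula n K sd \<Delta> i j l))"
      by auto
    have 3: "(\<forall>\<phi>\<in>set (map (leaf_formula n K \<Lambda>) [0..<m]). sat A e s \<phi>) \<longleftrightarrow>
        (\<forall>l<m. sat A e s (leaf_formula n K \<Lambda> l))"
      by auto
    show ?thesis
      unfolding sat_conjs list.set set_append ball_simps(7) ball_Un 1 2 3
        sat_node_formula sat_leaf_formula accepts_def ..
  qed
  have "sat A e s (run_formula n m K sd \<Delta> \<Lambda>) \<longleftrightarrow>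
    (\<exists>Z. (\<forall>X\<in>{n..<n + m}. Z X \<subseteq> universe A) \<and>
      accepts n m K sd \<Delta> \<Lambda> A (override_on s Z {n..<n + m}) (\<lambda>l. override_on s Z {n..<n + m} (n + l)))"
    unfolding run_formula_def sat_ex_sets body by simp
  also have "\<dots> \<longleftrightarrow> (\<exists>Z. (\<forall>X\<in>{n..<n + m}. Z X \<subseteq> universe A) \<and> accepts n m K sd \<Delta> \<Lambda> A s (\<lambda>l. Z (n + l)))"
  proof -
    have "override_on s Z {n..<n + m} (n + l) = Z (n + l)" if "l < m" for Z l
      using that by (simp add: override_on_def)
    moreover have "override_on s Z {n..<n + m} i = s i" if "i < n" for Z i
      using that by (simp add: override_on_def)
    ultimately have "accepts n m K sd \<Delta> \<Lambda> A (override_on s Z {n..<n + m}) (\<lambda>l. override_on s Z {n..<n + m} (n + l))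
        \<longleftrightarrow> accepts n m K sd \<Delta> \<Lambda> A s (\<lambda>l. Z (n + l))" for Z
      unfolding accepts_def by (simp cong: conj_cong)
    then show ?thesis by simp
  qed
  also have "\<dots> \<longleftrightarrow> (\<exists>Z. (\<forall>l<m. Z l \<subseteq> universe A) \<and> accepts n m K sd \<Delta> \<Lambda> A s Z)"
  proof
    assume "\<exists>Z. (\<forall>X\<in>{n..<n + m}. Z X \<subseteq> universe A) \<and> accepts n m K sd \<Delta> \<Lambda> A s (\<lambda>l. Z (n + l))"
    then obtain Z where Z: "\<forall>X\<in>{n..<n + m}. Z X \<subseteq> universe A" "accepts n m K sd \<Delta> \<Lambda> A s (\<lambda>l. Z (n + l))"
      by blast
    then show "\<exists>Z. (\<forall>l<m. Z l \<subseteq> universe A) \<and> accepts n m K sd \<Delta> \<Lambda> A s Z"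
      by (intro exI[of _ "\<lambda>l. Z (n + l)"]) simp
  next
    assume "\<exists>Z. (\<forall>l<m. Z l \<subseteq> universe A) \<and> accepts n m K sd \<Delta> \<Lambda> A s Z"
    then obtain Z where Z: "\<forall>l<m. Z l \<subseteq> universe A" "accepts n m K sd \<Delta> \<Lambda> A s Z" by blast
    have "Z (X - n) \<subseteq> universe A" if "X \<in> {n..<n + m}" for X
      using Z(1) that by (simp add: less_diff_conv2)
    then show "\<exists>Z. (\<forall>X\<in>{n..<n + m}. Z X \<subseteq> universe A) \<and> accepts n m K sd \<Delta> \<Lambda> A s (\<lambda>l. Z (n + l))"
      using Z(2) by (intro exI[of _ "\<lambda>X. Z (X - n)"]) simp
  qed
  finally show ?thesis .
qed

definition null_interpretation ::
  "nat \<Rightarrow> nat \<Rightarrow> nat \<Rightarrow> (nat \<Rightarrow> bool) \<Rightarrow> (nat \<Rightarrow> (nat \<times> nat \<times> nat) set) \<Rightarrow> (nat \<Rightarrow> (nat set \<times> nat) set) \<Rightarrow>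
    mso_interpretation" where
  "null_interpretation n m K sd \<Delta> \<Lambda> =
     \<lparr>universe_formula = is_leaf, elem_formulas = [], set_formulas = [run_formula n m K sd \<Delta> \<Lambda>]\<rparr>"

lemma null_interpretation_from_to:
  "interpretation_from_to (colour_vocabulary K tree_vocabulary) (null_vocabulary n)
    (null_interpretation n m K sd \<Delta> \<Lambda>)"
proof -
  let ?V = "colour_vocabulary K tree_vocabulary"
  have V: "0 < length (elem_arities ?V)" "elem_arities ?V ! 0 = 2"
    "\<And>c. c < K \<Longrightarrow> Suc c < length (elem_arities ?V) \<and> elem_arities ?V ! Suc c = 1"
    by (simp_all add: colour_vocabulary_def tree_vocabulary_def)
  have over: "formula_over ?V (run_formula n m K sd \<Delta> \<Lambda>)" "formula_over ?V is_leaf"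
    using V by (auto simp: run_formula_def node_formula_def leaf_formula_def literal_def side_formula_def is_leaf_def)
  have fe: "free_elem (run_formula n m K sd \<Delta> \<Lambda>) = {}" "free_elem is_leaf = {0}"
    by (auto simp: run_formula_def node_formula_def leaf_formula_def literal_def side_formula_def is_leaf_def split: if_splits)
  have fs: "free_set (run_formula n m K sd \<Delta> \<Lambda>) \<subseteq> {..<n}" "free_set is_leaf = {}"
    by (auto simp: run_formula_def node_formula_def leaf_formula_def literal_def side_formula_def is_leaf_def split: if_splits)
  show ?thesis
    unfolding interpretation_from_to_def null_interpretation_def
    using over fe fs by (simp add: null_vocabulary_def)
qed

section \<open>Bounded branchwidth implies bounded MSO width\<close>

text \<open>Positions are coded by naturals because transductions relate structures over
  \<open>nat\<close>.\<close>

definition tree_struct :: "'e btree \<Rightarrow> nat struct" where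
  "tree_struct t = \<lparr>universe = to_nat ` positions t,
     elem_rel = (\<lambda>R xs. R = 0 \<and> (\<exists>b p. b # p \<in> positions t \<and> xs = [to_nat p, to_nat (b # p)])),
     set_rel = (\<lambda>_ _. False)\<rparr>"

lemma is_tree_tree_struct: "is_tree (tree_struct t)"
proof -
  let ?A = "tree_struct t"
  have rel: "elem_rel ?A 0 [x, y] \<longleftrightarrow> (\<exists>b p. b # p \<in> positions t \<and> x = to_nat p \<and> y = to_nat (b # p))" for x y
    by (auto simp: tree_struct_def)
  have "struct_over tree_vocabulary ?A"
    unfolding struct_over_def
    by (auto simp: tree_struct_def tree_vocabulary_def finite_positions positions_tl)
  moreover have "to_nat ([] :: bool list) \<in> universe ?A"
    by (auto simp: tree_struct_def positions_def)
  moreover have "\<not> elem_rel ?A 0 [x, to_nat ([] :: bool list)]" for x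
    by (auto simp: rel)
  moreover have "\<exists>!x. elem_rel ?A 0 [x, y]" if y: "y \<in> universe ?A" "y \<noteq> to_nat ([] :: bool list)" for y
  proof -
    obtain p where p: "p \<in> positions t" "y = to_nat p" using y(1) by (auto simp: tree_struct_def)
    then obtain b q where "p = b # q" using y(2) by (cases p) auto
    then show ?thesis using p by (intro ex1I[of _ "to_nat q"]) (auto simp: rel)
  qed
  moreover have "(to_nat ([] :: bool list), to_nat p) \<in> {(u, v). elem_rel ?A 0 [u, v]}\<^sup>*"
    if "p \<in> positions t" for p
    using that
  proof (induction p)
    case (Cons b p)
    have "elem_rel ?A 0 [to_nat p, to_nat (b # p)]" using Cons.prems by (auto simp: rel)
    then show ?case using Cons.IH[OF positions_tl[OF Cons.prems]] by (auto intro: rtrancl_into_rtrancl)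
  qed simp
  ultimately show ?thesis
    unfolding is_tree_def
    by (intro conjI bexI[of _ "to_nat ([] :: bool list)"]) (auto simp: tree_struct_def)
qed

section \<open>The coloured decomposition tree\<close>

context decomposed_matroid
begin

text \<open>The head of a position is its last step, hence the side. The root, nobody's child, gets
  \<open>False\<close>, and the table of the wrong kind is empty.\<close>

definition colour_of :: "bool list \<Rightarrow> bool \<times> (nat \<times> nat \<times> nat) set \<times> (nat set \<times> nat) set" where
  "colour_of p = (p \<noteq> [] \<and> hd p,
     case subtree_at t p of Some (Node u w) \<Rightarrow> node_table (set (leaves u)) (set (leaves w)) | _ \<Rightarrow> {},
     case subtree_at t p of Some (Leaf x) \<Rightarrow> leaf_table x | _ \<Rightarrow> {})"

lemma colour_of_bounded:
  "colour_of p \<in> UNIV \<times> Pow ({..<m} \<times> {..<m} \<times> {..<m}) \<times> Pow (Pow {..<length cs} \<times> {..<m})"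
  using tables_bounded[of p]
  unfolding colour_of_def by (auto split: option.splits btree.splits)

definition node :: "'e \<Rightarrow> nat" where
  "node x = to_nat (SOME p. subtree_at t p = Some (Leaf x))"

lemma node_eq_iff:
  assumes "x \<in> elements M"
  shows "node x = to_nat p \<longleftrightarrow> subtree_at t p = Some (Leaf x)"
proof -
  let ?q = "SOME p. subtree_at t p = Some (Leaf x)"
  have q: "subtree_at t ?q = Some (Leaf x)"
    by (rule someI_ex, rule leaf_position) (simp add: elements_eq assms)
  have "distinct (leaves t)" using decomposition by (simp add: branch_decomposition_def)
  then have "subtree_at t p = Some (Leaf x) \<longleftrightarrow> ?q = p"
    using leaf_position_unique q by metis
  then show ?thesis unfolding node_def by simp
qed

lemma inj_node: "inj_on node (elements M)"
proof (rule inj_onI)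
  fix x y assume *: "x \<in> elements M" "y \<in> elements M" "node x = node y"
  obtain p where p: "subtree_at t p = Some (Leaf x)" using leaf_position[of x t] *(1) elements_eq by auto
  then have "node y = to_nat p" using node_eq_iff[OF *(1)] *(3) by simp
  then show "x = y" using node_eq_iff[OF *(2)] p by simp
qed

text \<open>The interpretation is built from \<open>m\<close>, \<open>K\<close>, \<open>g\<close>
  and the number of scalars; what is specific to the matroid sits in the tree and its
  colours.\<close>

lemma isomorphism_interpreted:
  fixes g :: "bool \<times> (nat \<times> nat \<times> nat) set \<times> (nat set \<times> nat) set \<Rightarrow> nat"
  defines "S \<equiv> UNIV \<times> Pow ({..<m} \<times> {..<m} \<times> {..<m}) \<times> Pow (Pow {..<length cs} \<times> {..<m})"
  assumes g: "bij_betw g S {..<K}"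
  defines "d \<equiv> inv_into S g"
  shows "isomorphism node (null_struct scale cs M)
    (interpreted_struct (null_vocabulary (length cs))
      (null_interpretation (length cs) m K (\<lambda>c. fst (d c)) (\<lambda>c. fst (snd (d c))) (\<lambda>c. snd (snd (d c))))
      (colour_struct tree_vocabulary K (\<lambda>a. g (colour_of (from_nat a))) (tree_struct t)))"
proof -
  let ?n = "length cs"
  let ?sd = "\<lambda>c. fst (d c)" and ?\<Delta> = "\<lambda>c. fst (snd (d c))" and ?\<Lambda> = "\<lambda>c. snd (snd (d c))"
  let ?A = "colour_struct tree_vocabulary K (\<lambda>a. g (colour_of (from_nat a))) (tree_struct t)"
  let ?I = "null_interpretation ?n m K ?sd ?\<Delta> ?\<Lambda>"
  let ?B = "interpreted_struct (null_vocabulary ?n) ?I ?A"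
  have UA: "universe ?A = to_nat ` positions t"
    by (simp add: colour_struct_def tree_struct_def)
  have edge: "elem_rel ?A 0 [x, y] \<longleftrightarrow> (\<exists>b p. b # p \<in> positions t \<and> x = to_nat p \<and> y = to_nat (b # p))" for x y
    by (auto simp: colour_struct_def tree_struct_def tree_vocabulary_def)
  have edge_pos: "elem_rel ?A 0 [to_nat p, to_nat q] \<longleftrightarrow> (\<exists>b. q = b # p) \<and> q \<in> positions t" for p q :: "bool list"
    unfolding edge by auto
  have gK: "g (colour_of p) < K" "d (g (colour_of p)) = colour_of p" for p
    using g colour_of_bounded[of p] unfolding S_def[symmetric] d_def
    by (auto simp: bij_betw_def inv_into_f_f)
  have colour: "(\<exists>c<K. P (d c) \<and> elem_rel ?A (Suc c) [to_nat p]) \<longleftrightarrow> P (colour_of p)"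
    if "p \<in> positions t" for P p
  proof -
    have "elem_rel ?A (Suc c) [to_nat p] \<longleftrightarrow> c < K \<and> g (colour_of p) = c" for c
      using that by (auto simp: colour_struct_def tree_struct_def tree_vocabulary_def)
    then show ?thesis using gK[of p] by auto
  qed
  have leaf_iff: "(\<forall>b\<in>universe ?A. \<not> elem_rel ?A 0 [to_nat p, b]) \<longleftrightarrow> (\<exists>x. subtree_at t p = Some (Leaf x))"
    if p: "p \<in> positions t" for p
  proof -
    obtain u where u: "subtree_at t p = Some u" using p by (auto simp: positions_def)
    have "(\<forall>b\<in>universe ?A. \<not> elem_rel ?A 0 [to_nat p, b]) \<longleftrightarrow> (\<forall>b. b # p \<notin> positions t)"
      unfolding UA by (auto simp: edge_pos)
    then show ?thesis using u by (cases u) (auto simp: positions_Cons)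
  qed
  have node_pos: "\<exists>p\<in>positions t. node x = to_nat p \<and> subtree_at t p = Some (Leaf x)" if "x \<in> elements M" for x
    using leaf_position[of x t] node_eq_iff[OF that] that elements_eq by (auto simp: positions_def)
  have UB: "universe ?B = node ` elements M"
  proof -
    have "universe ?B = {a \<in> universe ?A. \<forall>b\<in>universe ?A. \<not> elem_rel ?A 0 [a, b]}"
      by (auto simp: interpreted_struct_def interpreted_universe_def null_interpretation_def is_leaf_def)
    also have "\<dots> = node ` elements M"
    proof (intro set_eqI iffI)
      fix a assume "a \<in> {a \<in> universe ?A. \<forall>b\<in>universe ?A. \<not> elem_rel ?A 0 [a, b]}"
      then obtain p where p: "p \<in> positions t" "a = to_nat p" "\<forall>b\<in>universe ?A. \<not> elem_rel ?A 0 [to_nat p, b]"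
        unfolding UA by blast
      then obtain x where x: "subtree_at t p = Some (Leaf x)" using leaf_iff by blast
      then have "x \<in> elements M" using subtree_at_leaves[OF x] elements_eq by auto
      then have "node x = a" using node_eq_iff x p(2) by simp
      then show "a \<in> node ` elements M" using \<open>x \<in> elements M\<close> by blast
    next
      fix a assume "a \<in> node ` elements M"
      then obtain x where "x \<in> elements M" "a = node x" by blast
      then obtain p where "p \<in> positions t" "a = to_nat p" "subtree_at t p = Some (Leaf x)"
        using node_pos by blast
      then show "a \<in> {a \<in> universe ?A. \<forall>b\<in>universe ?A. \<not> elem_rel ?A 0 [a, b]}"
        using leaf_iff UA by auto
    qed
    finally show ?thesis .
  qed
  have run: "accepts ?n m K ?sd ?\<Delta> ?\<Lambda> ?A s Z \<longleftrightarrow> is_run Xs (\<lambda>l. {p. to_nat p \<in> Z l})"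
    if s: "\<And>i. i < ?n \<Longrightarrow> s i = node ` (Xs ! i)" and Xs: "\<And>i. i < ?n \<Longrightarrow> Xs ! i \<subseteq> elements M" for s Z Xs
  proof -
    let ?Z = "\<lambda>l. {p :: bool list. to_nat p \<in> Z l}"
    have label: "(\<forall>a\<in>universe ?A. \<exists>l<m. a \<in> Z l) \<longleftrightarrow> (\<forall>p\<in>positions t. \<exists>l<m. p \<in> ?Z l)"
      unfolding UA by simp
    have nodes: "(\<forall>a\<in>universe ?A. \<forall>b\<in>universe ?A. \<forall>b'\<in>universe ?A.
        elem_rel ?A 0 [a, b] \<and> elem_rel ?A 0 [a, b'] \<and> b \<in> Z i \<and> b' \<in> Z j \<and> a \<in> Z l \<and>
        (\<exists>c<K. ?sd c = False \<and> elem_rel ?A (Suc c) [b]) \<and> (\<exists>c<K. ?sd c = True \<and> elem_rel ?A (Suc c) [b']) \<longrightarrow>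
        (\<exists>c<K. (i, j, l) \<in> ?\<Delta> c \<and> elem_rel ?A (Suc c) [a])) \<longleftrightarrow>
      (\<forall>p u w. subtree_at t p = Some (Node u w) \<longrightarrow> False # p \<in> ?Z i \<longrightarrow> True # p \<in> ?Z j \<longrightarrow> p \<in> ?Z l \<longrightarrow>
        (i, j, l) \<in> node_table (set (leaves u)) (set (leaves w)))" (is "?L \<longleftrightarrow> ?R") for i j l
    proof -
      have side: "fst (colour_of (b # p)) = b" for b p by (simp add: colour_of_def)
      have "?L \<longleftrightarrow> (\<forall>p\<in>positions t. \<forall>q\<in>positions t. \<forall>q'\<in>positions t.
          (\<exists>b. q = b # p) \<and> (\<exists>b. q' = b # p) \<and> q \<in> ?Z i \<and> q' \<in> ?Z j \<and> p \<in> ?Z l \<and>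
          \<not> fst (colour_of q) \<and> fst (colour_of q') \<longrightarrow> (i, j, l) \<in> fst (snd (colour_of p)))"
        unfolding UA by (simp add: edge_pos colour[where P = "\<lambda>x. fst x = False", simplified]
            colour[where P = "\<lambda>x. fst x = True", simplified] colour[where P = "\<lambda>x. (i, j, l) \<in> fst (snd x)"])
      also have "\<dots> \<longleftrightarrow> (\<forall>p\<in>positions t. False # p \<in> positions t \<longrightarrow> True # p \<in> positions t \<longrightarrow>
          False # p \<in> ?Z i \<longrightarrow> True # p \<in> ?Z j \<longrightarrow> p \<in> ?Z l \<longrightarrow> (i, j, l) \<in> fst (snd (colour_of p)))"
        (is "?L1 \<longleftrightarrow> ?R1")
      proof
          assume L1: ?L1
          show ?R1
          proof (intro ballI impI)
            fix p assume "p \<in> positions t" "False # p \<in> positions t" "True # p \<in> positions t"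
              "False # p \<in> ?Z i" "True # p \<in> ?Z j" "p \<in> ?Z l"
            then show "(i, j, l) \<in> fst (snd (colour_of p))"
              using L1[rule_format, of p "False # p" "True # p"] side by auto
          qed
        next
          assume R1: ?R1
          show ?L1
          proof (intro ballI impI; elim conjE exE)
            fix p q q' b b'
            assume *: "p \<in> positions t" "q \<in> positions t" "q' \<in> positions t" "q \<in> ?Z i" "q' \<in> ?Z j"
              "p \<in> ?Z l" "\<not> fst (colour_of q)" "fst (colour_of q')" "q = b # p" "q' = b' # p"
            \<comment> \<open>The sides stored in the colours tell the two children apart.\<close>
            then have "q = False # p" "q' = True # p" using side by auto
            then show "(i, j, l) \<in> fst (snd (colour_of p))" using R1 * by blast
          qed
      qed
      also have "\<dots> \<longleftrightarrow> ?R"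
        by (auto simp: positions_Cons colour_of_def) (auto simp: positions_def)
      finally show ?thesis .
    qed
    have member: "{i. i < ?n \<and> to_nat p \<in> s i} = {i. i < ?n \<and> x \<in> Xs ! i}"
      if "subtree_at t p = Some (Leaf x)" for p x
    proof -
      have x: "x \<in> elements M" using subtree_at_leaves[OF that] elements_eq by auto
      have "to_nat p \<in> s i \<longleftrightarrow> x \<in> Xs ! i" if i: "i < ?n" for i
      proof -
        have "node x = to_nat p" using node_eq_iff[OF x] \<open>subtree_at t p = Some (Leaf x)\<close> by simp
        then show ?thesis
          using s[OF i] Xs[OF i] x inj_on_image_mem_iff[OF inj_node x Xs[OF i]] by simp
      qed
      then show ?thesis by blast
    qed
    have leafs: "(\<forall>a\<in>universe ?A. (\<forall>b\<in>universe ?A. \<not> elem_rel ?A 0 [a, b]) \<and> a \<in> Z l \<longrightarrow>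
        (\<exists>c<K. ({i. i < ?n \<and> a \<in> s i}, l) \<in> ?\<Lambda> c \<and> elem_rel ?A (Suc c) [a])) \<longleftrightarrow>
      (\<forall>p x. subtree_at t p = Some (Leaf x) \<longrightarrow> p \<in> ?Z l \<longrightarrow>
        ({i. i < ?n \<and> x \<in> Xs ! i}, l) \<in> leaf_table x)" (is "?L \<longleftrightarrow> ?R") for l
    proof -
      have "?L \<longleftrightarrow> (\<forall>p\<in>positions t. (\<forall>b\<in>universe ?A. \<not> elem_rel ?A 0 [to_nat p, b]) \<and> p \<in> ?Z l \<longrightarrow>
          (\<exists>c<K. ({i. i < ?n \<and> to_nat p \<in> s i}, l) \<in> ?\<Lambda> c \<and> elem_rel ?A (Suc c) [to_nat p]))"
        unfolding UA by simp
      also have "\<dots> \<longleftrightarrow> (\<forall>p\<in>positions t. (\<exists>x. subtree_at t p = Some (Leaf x)) \<and> p \<in> ?Z l \<longrightarrow>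
          ({i. i < ?n \<and> to_nat p \<in> s i}, l) \<in> snd (snd (colour_of p)))"
      proof (rule ball_cong[OF refl])
        fix p assume p: "p \<in> positions t"
        show "((\<forall>b\<in>universe ?A. \<not> elem_rel ?A 0 [to_nat p, b]) \<and> p \<in> ?Z l \<longrightarrow>
          (\<exists>c<K. ({i. i < ?n \<and> to_nat p \<in> s i}, l) \<in> ?\<Lambda> c \<and> elem_rel ?A (Suc c) [to_nat p])) \<longleftrightarrow>
          ((\<exists>x. subtree_at t p = Some (Leaf x)) \<and> p \<in> ?Z l \<longrightarrow>
          ({i. i < ?n \<and> to_nat p \<in> s i}, l) \<in> snd (snd (colour_of p)))"
          unfolding leaf_iff[OF p] colour[OF p, of "\<lambda>x. ({i. i < ?n \<and> to_nat p \<in> s i}, l) \<in> snd (snd x)"] ..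
      qed
      also have "\<dots> \<longleftrightarrow> ?R"
        using member by (auto simp: colour_of_def positions_def)
      finally show ?thesis .
    qed
    show ?thesis
      unfolding accepts_def label nodes leafs is_run_def by blast
  qed
  have null: "set_rel (null_struct scale cs M) R Xs \<longleftrightarrow> set_rel ?B R (map ((`) node) Xs)"
    if Xs: "\<forall>X\<in>set Xs. X \<subseteq> elements M" for R Xs
  proof (cases "R = 0 \<and> length Xs = ?n")
    case True
    let ?s = "\<lambda>i. map ((`) node) Xs ! i"
    have s: "?s i = node ` (Xs ! i)" "Xs ! i \<subseteq> elements M" if "i < ?n" for i
      using True Xs that by auto
    have "set_rel (null_struct scale cs M) R Xs \<longleftrightarrow> partial_sum Xs (elements M) = 0"
      using null_rel_iff_weight[OF vector_space_axioms finite_elements _ Xs, of cs] True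
      by (simp add: partial_sum_def)
    also have "\<dots> \<longleftrightarrow> (\<exists>Z. is_run Xs Z)" by (simp add: run_iff)
    also have "\<dots> \<longleftrightarrow> (\<exists>Z. (\<forall>l<m. Z l \<subseteq> universe ?A) \<and> accepts ?n m K ?sd ?\<Delta> ?\<Lambda> ?A ?s Z)"
    proof
      assume "\<exists>Z. is_run Xs Z"
      then obtain Z where Z: "is_run Xs Z" by blast
      \<comment> \<open>The formula quantifies over sets of nodes, so labels at lists that are not
        positions are dropped.\<close>
      have "is_run Xs (\<lambda>l. {p. to_nat p \<in> to_nat ` (Z l \<inter> positions t)})"
      proof -
        have "{p. to_nat p \<in> to_nat ` (Z l \<inter> positions t)} = Z l \<inter> positions t" for l by auto
        then show ?thesis using Z unfolding is_run_def by auto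
      qed
      then have "accepts ?n m K ?sd ?\<Delta> ?\<Lambda> ?A ?s (\<lambda>l. to_nat ` (Z l \<inter> positions t))"
        using run[OF s] by blast
      moreover have "to_nat ` (Z l \<inter> positions t) \<subseteq> universe ?A" for l
        unfolding UA by (rule image_mono) simp
      ultimately show "\<exists>Z. (\<forall>l<m. Z l \<subseteq> universe ?A) \<and> accepts ?n m K ?sd ?\<Delta> ?\<Lambda> ?A ?s Z"
        by (intro exI[of _ "\<lambda>l. to_nat ` (Z l \<inter> positions t)"]) simp
    next
      assume "\<exists>Z. (\<forall>l<m. Z l \<subseteq> universe ?A) \<and> accepts ?n m K ?sd ?\<Delta> ?\<Lambda> ?A ?s Z"
      then obtain Z where "accepts ?n m K ?sd ?\<Delta> ?\<Lambda> ?A ?s Z" by blast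
      then have "is_run Xs (\<lambda>l. {p. to_nat p \<in> Z l})" using run[OF s] by simp
      then show "\<exists>Z. is_run Xs Z" by blast
    qed
    also have "\<dots> \<longleftrightarrow> set_rel ?B R (map ((`) node) Xs)"
    proof -
      have "\<forall>X\<in>set (map ((`) node) Xs). X \<subseteq> universe ?B" using Xs UB by auto
      then have "\<forall>X\<in>set (map ((`) node) Xs). X \<subseteq> interpreted_universe ?I ?A"
        by (simp add: interpreted_struct_def)
      then have "set_rel ?B R (map ((`) node) Xs) \<longleftrightarrow>
          sat ?A (\<lambda>_. undefined) ?s (run_formula ?n m K ?sd ?\<Delta> ?\<Lambda>)"
        using True by (simp add: interpreted_struct_def null_vocabulary_def null_interpretation_def)
      then show ?thesis unfolding sat_run_formula by blast
    qed
    finally show ?thesis .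
  next
    case False
    then show ?thesis
      by (auto simp: null_struct_def interpreted_struct_def null_vocabulary_def)
  qed
  show ?thesis
    unfolding isomorphism_def
  proof (intro conjI allI impI)
    show "bij_betw node (universe (null_struct scale cs M)) (universe ?B)"
      unfolding UB using inj_node by (simp add: null_struct_def bij_betw_def)
    show "elem_rel (null_struct scale cs M) R xs = elem_rel ?B R (map node xs)" for R xs
      by (simp add: null_struct_def interpreted_struct_def null_vocabulary_def)
  qed (use null in \<open>simp add: null_struct_def\<close>)
qed

end

section \<open>Optimal decompositions and the choice of the transduction\<close>

lemma finite_edge_sets: "finite (edge_sets t)"
  by (induction t) auto

lemma branch_decomposition_exists:
  assumes "rep_matroid M"
  shows "\<exists>t. branch_decomposition M t"
proof -
  have "finite E \<Longrightarrow> E \<noteq> {} \<Longrightarrow> \<exists>t. distinct (leaves t) \<and> set (leaves t) = E" for E :: "'a set"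
  proof (induction E rule: finite_ne_induct)
    case (singleton x)
    then show ?case by (intro exI[of _ "Leaf x"]) simp
  next
    case (insert x E)
    then obtain t where "distinct (leaves t)" "set (leaves t) = E" by blast
    then show ?case using insert.hyps(3) by (intro exI[of _ "Node (Leaf x) t"]) simp
  qed
  then show ?thesis using assms unfolding rep_matroid_def branch_decomposition_def by blast
qed

text \<open>An infimum of naturals over a nonempty set is attained, and the supremum over the
  finitely many edges bounds each cut.\<close>

lemma branchwidth_attained:
  assumes "rep_matroid M"
  obtains t where "branch_decomposition M t"
    "\<And>Y. Y \<in> edge_sets t \<Longrightarrow> connectivity scale M Y (elements M - Y) \<le> branchwidth scale M"
proof -
  have "branchwidth scale M \<in> decomposition_width scale M ` {t. branch_decomposition M t}"
    unfolding branchwidth_def using branch_decomposition_exists[OF assms] by (intro Inf_nat_def1) auto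
  then obtain t where t: "branch_decomposition M t" "branchwidth scale M = decomposition_width scale M t"
    by blast
  have "connectivity scale M Y (elements M - Y) \<le> branchwidth scale M" if "Y \<in> edge_sets t" for Y
    unfolding t(2) decomposition_width_def using that finite_edge_sets[of t]
    by (intro cSUP_upper) auto
  then show ?thesis using that t(1) by blast
qed

lemma boundary_encoding:
  fixes scale :: "'f::{field,finite} \<Rightarrow> 'v::ab_group_add \<Rightarrow> 'v"
  assumes vs: "vector_space scale" and M: "rep_matroid M" and t: "branch_decomposition M t"
    and k: "\<And>Y. Y \<in> edge_sets t \<Longrightarrow> connectivity scale M Y (elements M - Y) \<le> k"
  shows "\<exists>enc. decomposed_matroid scale M t (CARD('f) ^ k) enc"
proof -
  interpret vector_space scale by (fact vs)
  let ?B = "\<lambda>Y. span (vec M ` Y) \<inter> span (vec M ` (elements M - Y))" and ?m = "CARD('f) ^ k"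
  have E: "set (leaves t) = elements M" using t by (simp add: branch_decomposition_def)
  have fin: "finite (elements M)" using M by (simp add: rep_matroid_def)
  have bound: "finite (?B Y) \<and> card (?B Y) \<le> ?m" if u: "subtree_at t p = Some u" and Y: "Y = set (leaves u)" for p u Y
  proof (rule card_span_Int_le[OF vs])
    have YE: "Y \<subseteq> elements M" using subtree_at_leaves[OF u] E Y by simp
    then show "finite (vec M ` Y)" "finite (vec M ` (elements M - Y))"
      using fin finite_subset by auto
    have un: "Y \<union> (elements M - Y) = elements M" using YE by blast
    show "dim (vec M ` Y) + dim (vec M ` (elements M - Y)) \<le> k + dim (vec M ` Y \<union> vec M ` (elements M - Y))"
    \<comment> \<open>The root is not an edge, so the bound on connectivity does not speak of it;
      its complement is empty.\<close>
    proof (cases "p = []")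
      case True
      then have empty: "elements M - Y = {}" using u Y E by simp
      have "dim {} = 0" using dim_le_card[of "{}" "{}"] by simp
      then show ?thesis unfolding empty by simp
    next
      case False
      then have "connectivity scale M Y (elements M - Y) \<le> k"
        using k subtree_at_leaves[OF u] Y by simp
      then show ?thesis
        by (simp add: connectivity_def rank_def image_Un[symmetric] le_diff_conv add.commute)
    qed
  qed
  define enc where "enc Y = (SOME e. inj_on e (?B Y) \<and> e ` ?B Y \<subseteq> {..<?m})" for Y
  have "inj_on (enc (set (leaves u))) (?B (set (leaves u))) \<and> enc (set (leaves u)) ` ?B (set (leaves u)) \<subseteq> {..<?m}"
    if u: "subtree_at t p = Some u" for p u
  proof -
    let ?Y = "set (leaves u)"
    obtain e where "bij_betw e (?B ?Y) {0..<card (?B ?Y)}"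
      using ex_bij_betw_finite_nat bound[OF u refl] by blast
    then have "inj_on e (?B ?Y) \<and> e ` ?B ?Y \<subseteq> {..<?m}"
      using bound[OF u refl] by (auto simp: bij_betw_def)
    then show ?thesis
      unfolding enc_def by (rule someI[where P = "\<lambda>e. inj_on e (?B ?Y) \<and> e ` ?B ?Y \<subseteq> {..<?m}"])
  qed
  then have "decomposed_matroid scale M t ?m enc"
    by unfold_locales (use t in auto)
  then show ?thesis by blast
qed

lemma null_mso_width_if_bounded_branchwidth:
  fixes scale :: "'f::{field,finite} \<Rightarrow> 'v::ab_group_add \<Rightarrow> 'v" and \<C> :: "('e, 'v) rep_matroid set"
  assumes vs: "vector_space scale" and rep: "\<forall>M\<in>\<C>. rep_matroid M"
    and "bounded_branchwidth scale \<C>"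
  shows "bounded_mso_width (null_vocabulary (length cs)) (null_struct scale cs ` \<C>)"
proof -
  obtain k where k: "\<forall>M\<in>\<C>. branchwidth scale M \<le> k"
    using assms(3) unfolding bounded_branchwidth_def by blast
  let ?m = "CARD('f) ^ k" and ?n = "length cs"
  \<comment> \<open>All possible colours. The set depends on \<open>k\<close> and the length of
    \<open>cs\<close>, so one transduction serves the whole class.\<close>
  define S where "S = (UNIV :: bool set) \<times> Pow ({..<?m} \<times> {..<?m} \<times> {..<?m}) \<times> Pow (Pow {..<?n} \<times> {..<?m})"
  have "finite S" by (simp add: S_def)
  then obtain g where g: "bij_betw g S {0..<card S}" using ex_bij_betw_finite_nat by blast
  define K where "K = card S"
  have gK: "bij_betw g S {..<K}" using g by (simp add: K_def atLeast0LessThan)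
  have "S \<noteq> {}" by (auto simp: S_def)
  then have K: "K > 0" using \<open>finite S\<close> by (simp add: K_def card_gt_0_iff)
  define d where "d = inv_into S g"
  define I where "I = null_interpretation ?n ?m K (\<lambda>c. fst (d c)) (\<lambda>c. fst (snd (d c))) (\<lambda>c. snd (snd (d c)))"
  let ?T = tree_vocabulary and ?V = "colour_vocabulary K tree_vocabulary" and ?W = "null_vocabulary ?n"
  define T1 where "T1 A B \<longleftrightarrow> struct_over ?T A \<and> struct_over ?V B \<and>
    (\<exists>c. c ` universe A \<subseteq> {..<K} \<and> isomorphic (colour_struct ?T K c A) B)" for A B :: "nat struct"
  define T2 where "T2 A B \<longleftrightarrow> struct_over ?V A \<and> struct_over ?W B \<and>
    isomorphic (interpreted_struct ?W I A) B" for A B :: "nat struct"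
  have "mso_transduction ?T ?V T1" unfolding T1_def by (rule colouring[OF K])
  moreover have "mso_transduction ?V ?W T2"
    unfolding T2_def I_def by (rule interpreting[OF null_interpretation_from_to])
  ultimately have comp: "mso_transduction ?T ?W (T1 OO T2)" by (rule composition)
  have "\<exists>A B. is_tree A \<and> (T1 OO T2) A B \<and> isomorphic (null_struct scale cs M) B" if M: "M \<in> \<C>" for M
  proof -
    have repM: "rep_matroid M" using rep M by blast
    obtain t where t: "branch_decomposition M t"
      "\<And>Y. Y \<in> edge_sets t \<Longrightarrow> connectivity scale M Y (elements M - Y) \<le> branchwidth scale M"
      using branchwidth_attained[OF repM] by blast
    have "connectivity scale M Y (elements M - Y) \<le> k" if "Y \<in> edge_sets t" for Y
      using t(2)[OF that] k M le_trans by blast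
    then obtain enc where "decomposed_matroid scale M t ?m enc"
      using boundary_encoding[OF vs repM t(1)] by blast
    then interpret decomposed_matroid scale cs M t ?m enc .
    let ?c = "\<lambda>a. g (colour_of (from_nat a))"
    let ?A = "tree_struct t" and ?B = "colour_struct ?T K ?c (tree_struct t)"
    have iso: "isomorphism node (null_struct scale cs M) (interpreted_struct ?W I ?B)"
      using isomorphism_interpreted[OF gK[unfolded S_def]] unfolding I_def d_def S_def .
    have tree: "is_tree ?A" by (rule is_tree_tree_struct)
    then have A: "struct_over ?T ?A" by (simp add: is_tree_def)
    have c: "?c ` universe ?A \<subseteq> {..<K}"
      using gK colour_of_bounded unfolding S_def[symmetric] by (auto simp: bij_betw_def)
    have B: "struct_over ?V ?B"
      using A unfolding struct_over_def
      by (auto simp: colour_struct_def colour_vocabulary_def nth_append tree_struct_def)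
    have "struct_over ?W (interpreted_struct ?W I ?B)"
      using B by (auto simp: struct_over_def interpreted_struct_def interpreted_universe_def)
    then have "T2 ?B (interpreted_struct ?W I ?B)"
      using B isomorphic_refl unfolding T2_def by blast
    moreover have "T1 ?A ?B" using A B c isomorphic_refl unfolding T1_def by blast
    ultimately show ?thesis using tree iso unfolding isomorphic_def by blast
  qed
  then show ?thesis unfolding bounded_mso_width_def using comp by blast
qed

theorem mainTheorem4:
  fixes scale :: "'f::{field,finite} \<Rightarrow> 'v::ab_group_add \<Rightarrow> 'v"
    and cs :: "'f list"
    and \<C> :: "('e, 'v) rep_matroid set"
  assumes "vector_space scale"
    and "distinct cs" and "set cs = UNIV - {0}"
    and "\<forall>M\<in>\<C>. rep_matroid M"
  shows "(bounded_mso_width (null_vocabulary (CARD('f) - 1)) (null_struct scale cs ` \<C>)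
            \<longleftrightarrow> bounded_branchwidth scale \<C>) \<and>
         (bounded_mso_width independent_vocabulary (independent_struct scale ` \<C>)
            \<longleftrightarrow> bounded_branchwidth scale \<C>)"
proof -
  have "length cs = CARD('f) - 1"
    using distinct_card[OF assms(2)] assms(3) by (simp add: card_Diff_singleton)
  then show ?thesis
    using null_mso_width_if_bounded_branchwidth[OF assms(1,4), of cs]
      independent_mso_width_if_null_mso_width[OF assms]
      bounded_branchwidth_if_independent_mso_width[OF assms(1,4)]
    by metis
qed

end
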